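(* Let $K\subset\mathbb{R}^n$ be a closed convex set, $\mu_0\in K$, $h\sim\mathcal{N}(0,I_n)$. For $\sigma\ge0$ let $\hat\mu_K^{\mathrm{seq}}(\sigma)=\Pi_K(\mu_0+\sigma h)$, $\mathrm{err}(\sigma)=\|\hat\mu_K^{\mathrm{seq}}(\sigma)-\mu_0\|^2$, and $\mathrm{dof}(\sigma)=\langle\hat\mu_K^{\mathrm{seq}}(\sigma)-\mu_0,\sigma h\rangle$. The following hold. (1) $\mathbb{E}\,\mathrm{dof}(\sigma)=\sigma^2\,\mathbb{E}\,\mathrm{div}\,\hat\mu_K^{\mathrm{seq}}(\sigma)$. (2) $\sigma\mapsto\mathrm{dof}(\sigma)/\sigma^2$ is non-increasing on $(0,\infty)$, and for any $\sigma\ge0$, $M\ge1$, $\mathrm{dof}(\sigma)\le\mathrm{dof}(M\sigma)\le M^2\,\mathrm{dof}(\sigma)$. (3) For any $\sigma>0$, $$\mathrm{err}(\sigma)\le\mathrm{dof}(\sigma)\le\sigma\int_0^\sigma\frac{\mathrm{err}(\tau)}{\tau^2}\,\mathrm{d}\tau.$$ Consequently, $\lim_{\sigma\downarrow0}\mathbb{E}\,\mathrm{div}\,\hat\mu_K^{\mathrm{seq}}(\sigma)=\lim_{\sigma\downarrow0}\mathbb{E}\,\mathrm{err}(\sigma)/\sigma^2=\delta_{T_K(\mu_0)}$. (4) $\mathrm{Var}(\mathrm{dof}(\sigma))\le4\sigma^2\,\mathbb{E}\,\mathrm{err}(\sigma)$. Furthermore there exists an absolute constant $L>0$ such that for all $t\ge0$,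 $$\mathbb{P}\Big(L^{-1}|\mathrm{dof}(\sigma)-\mathbb{E}\,\mathrm{dof}(\sigma)|\ge\sqrt{\sigma^2\,\mathbb{E}\,\mathrm{err}(\sigma)\,t}+\sigma^2t\Big)\le Le^{-t/L}.$$
   Context: $\Pi_K$ is the metric projection onto $K$; $\|\cdot\|$ is the Euclidean norm. $\mathrm{div}\,\hat\mu_K^{\mathrm{seq}}(\sigma)$ denotes the divergence $\sum_{i=1}^n\partial(\Pi_K)_i/\partial y_i$ of the ($1$-Lipschitz, hence a.e. differentiable) map $\Pi_K$ evaluated at $y=\mu_0+\sigma h$ (in (1), (4) take $\sigma>0$). $T_K(\mu_0)=\mathrm{cl}\{\alpha(\nu-\mu_0):\alpha\ge0,\nu\in K\}$ is the tangent cone, and $\delta_T=\mathbb{E}\|\Pi_T(h)\|^2$ for a closed convex cone $T$. *)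

theory Defs
  imports "HOL-Probability.Probability" "HOL-Library.Function_Algebras"
begin

text \<open>
  The absolute constant in the tail bound must not depend on the dimension, so the
  dimension is a natural number and the space of dimension n is the carrier
  \<^prop>\<open>x \<in> topspace (Euclidean_space n)\<close>, i.e. the sequences that vanish from index n on.
  The product topology on \<^typ>\<open>nat \<Rightarrow> real\<close> induces the Euclidean topology on this carrier.
  The pointwise vector space structure below makes the library's \<^term>\<open>convex\<close> available.
\<close>

instantiation "fun" :: (type, real_vector) real_vector
begin

definition "c *\<^sub>R f = (\<lambda>x. c *\<^sub>R f x)"

instance
  by standard (simp_all add: scaleR_fun_def fun_eq_iff scaleR_add_right scaleR_add_left)

end

definition norm_n :: "nat \<Rightarrow> (nat \<Rightarrow> real) \<Rightarrow> real" where
  "norm_n n x = L2_set x {..<n}"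

definition inner_n :: "nat \<Rightarrow> (nat \<Rightarrow> real) \<Rightarrow> (nat \<Rightarrow> real) \<Rightarrow> real" where
  "inner_n n x y = (\<Sum>i<n. x i * y i)"

text \<open>The product measure lives on functions that are \<^term>\<open>undefined\<close> outside
  \<^term>\<open>{..<n}\<close>; the image measure replaces these values by 0.\<close>

definition std_gaussian :: "nat \<Rightarrow> (nat \<Rightarrow> real) measure" where
  "std_gaussian n =
     distr (PiM {..<n} (\<lambda>_. std_normal_distribution)) borel (\<lambda>x i. if i < n then x i else 0)"

definition proj :: "nat \<Rightarrow> (nat \<Rightarrow> real) set \<Rightarrow> (nat \<Rightarrow> real) \<Rightarrow> (nat \<Rightarrow> real)" where
  "proj n K y = arg_min_on (\<lambda>x. norm_n n (y - x)) K"

text \<open>Where a partial derivative does not exist, \<^term>\<open>deriv\<close> has an unspecified value;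
  for a Lipschitz map this concerns a null set only.\<close>

definition divergence :: "nat \<Rightarrow> ((nat \<Rightarrow> real) \<Rightarrow> (nat \<Rightarrow> real)) \<Rightarrow> (nat \<Rightarrow> real) \<Rightarrow> real" where
  "divergence n F y = (\<Sum>i<n. deriv (\<lambda>s. F (y(i := s)) i) (y i))"

definition mu_seq ::
  "nat \<Rightarrow> (nat \<Rightarrow> real) set \<Rightarrow> (nat \<Rightarrow> real) \<Rightarrow> real \<Rightarrow> (nat \<Rightarrow> real) \<Rightarrow> (nat \<Rightarrow> real)" where
  "mu_seq n K \<mu>\<^sub>0 \<sigma> h = proj n K (\<mu>\<^sub>0 + \<sigma> *\<^sub>R h)"

definition err ::
  "nat \<Rightarrow> (nat \<Rightarrow> real) set \<Rightarrow> (nat \<Rightarrow> real) \<Rightarrow> real \<Rightarrow> (nat \<Rightarrow> real) \<Rightarrow> real" where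
  "err n K \<mu>\<^sub>0 \<sigma> h = (norm_n n (mu_seq n K \<mu>\<^sub>0 \<sigma> h - \<mu>\<^sub>0))\<^sup>2"

definition dof ::
  "nat \<Rightarrow> (nat \<Rightarrow> real) set \<Rightarrow> (nat \<Rightarrow> real) \<Rightarrow> real \<Rightarrow> (nat \<Rightarrow> real) \<Rightarrow> real" where
  "dof n K \<mu>\<^sub>0 \<sigma> h = inner_n n (mu_seq n K \<mu>\<^sub>0 \<sigma> h - \<mu>\<^sub>0) (\<sigma> *\<^sub>R h)"

definition div_mu_seq ::
  "nat \<Rightarrow> (nat \<Rightarrow> real) set \<Rightarrow> (nat \<Rightarrow> real) \<Rightarrow> real \<Rightarrow> (nat \<Rightarrow> real) \<Rightarrow> real" where
  "div_mu_seq n K \<mu>\<^sub>0 \<sigma> h = divergence n (proj n K) (\<mu>\<^sub>0 + \<sigma> *\<^sub>R h)"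

definition tangent_cone ::
  "nat \<Rightarrow> (nat \<Rightarrow> real) set \<Rightarrow> (nat \<Rightarrow> real) \<Rightarrow> (nat \<Rightarrow> real) set" where
  "tangent_cone n K \<mu>\<^sub>0 =
     (Euclidean_space n) closure_of {\<alpha> *\<^sub>R (\<nu> - \<mu>\<^sub>0) | \<alpha> \<nu>. 0 \<le> \<alpha> \<and> \<nu> \<in> K}"

definition stat_dim :: "nat \<Rightarrow> (nat \<Rightarrow> real) set \<Rightarrow> real" where
  "stat_dim n T = prob_space.expectation (std_gaussian n) (\<lambda>h. (norm_n n (proj n T h))\<^sup>2)"

end

theory Submission
  imports Defs
begin

text \<open>
  Along a ray \<open>\<tau> \<mapsto> \<mu>\<^sub>0 + \<tau> h\<close> the variational inequality for the projection gives the monotonicity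
  statements, and it identifies \<open>dof - err / 2\<close> with a convex potential \<open>\<Phi>\<close> satisfying
  \<open>(\<Phi>(\<tau>) / \<tau>)' = err(\<tau>) / (2 \<tau>\<^sup>2)\<close>, which yields the integral bound. For the limits,
  \<open>(\<Pi>\<^sub>K(\<mu>\<^sub>0 + \<sigma> h) - \<mu>\<^sub>0) / \<sigma>\<close> is the projection of \<open>h\<close> onto \<open>(K - \<mu>\<^sub>0) / \<sigma>\<close>, and these sets increase to
  a dense subset of the tangent cone.

  Each coordinate of the projection is monotone and 1-Lipschitz in the same coordinate of its
  argument, hence differentiable almost everywhere there (Lebesgue, by Vitali covering), so a
  one-dimensional Stein identity and Fubini suffice for the divergence formula; no Rademacher theorem
  is needed.

  Variance and tail bounds both come from Maurey's property \<open>\<tau>\<close>: if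
  \<open>A(x) B(y) \<le> exp (\<parallel>x - y\<parallel>\<^sup>2 / 4)\<close> for all \<open>x, y\<close>, then \<open>E A \<cdot> E B \<le> 1\<close>. On the line this is the
  Prekopa-Leindler inequality, and it tensorizes. With \<open>f = dof / \<sigma>\<^sup>2\<close> and \<open>\<nu> = sqrt err / \<sigma>\<close>, the function
  \<open>f\<close> has local Lipschitz constant \<open>2 \<nu>\<close> and \<open>\<nu>\<close> is 1-Lipschitz. The choice
  \<open>A = exp (\<epsilon> f - c \<nu>\<^sup>2)\<close>, \<open>B = exp (- \<epsilon> f)\<close> with \<open>c \<approx> 4 \<epsilon>\<^sup>2\<close> gives the sharp variance bound at
  second order in \<open>\<epsilon>\<close>. For the tail one also needs \<open>E exp (\<nu>\<^sup>2 / 8) \<le> exp (E \<nu>\<^sup>2 / 4)\<close>, which is the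
  choice \<open>A = exp (\<nu>\<^sup>2 / 8)\<close>, \<open>B = exp (- \<nu>\<^sup>2 / 4)\<close>.
\<close>

subsection \<open>Property \<open>\<tau>\<close> of the Gaussian measure\<close>

text \<open>The variance bound is what a Gaussian Poincare inequality would give for a gradient of
  norm at most \<open>2 * \<nu>\<close>. Property \<tau> asks for bounds on increments instead of
  gradients, so the projection enters through its variational inequality alone, and no constant
  depends on the dimension. The weight 1/4 comes from the midpoint: the product of the standard
  normal densities at x and y, times \<open>exp ((x - y)\<^sup>2 / 4)\<close>, is the squared
  density at \<open>(x + y) / 2\<close>. The obstacle is that \<nu> is unbounded, so
  \<open>f\<close> has no global Lipschitz constant. To leading order the exponent of
  \<open>A\<close> must absorb the maximum of \<open>2 \<epsilon> \<nu> r - r\<^sup>2 / 4\<close>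
  over r, which is \<open>4 \<epsilon>\<^sup>2 \<nu>\<^sup>2\<close>. At second order the product
  bound then reads \<open>\<epsilon>\<^sup>2 Var f - 4 \<epsilon>\<^sup>2 E \<nu>\<^sup>2 \<le>
  0\<close>. In the tail bound this compensator has to be removed again, which is why an exponential
  moment of \<open>\<nu>\<^sup>2\<close> is required. The limit of the expected divergence is
  reached through \<open>dof\<close>: the tangent cone is a cone, so the inner product of the
  projection of h with h is its squared norm, and \<open>dof\<close> and \<open>err\<close> have the
  same rescaled limit.\<close>

lemma emeasure_lborel_double:
  fixes d :: real
  assumes [measurable]: "S \<in> sets borel"
  shows "emeasure lborel S = 2 * emeasure lborel {x. 2 * x - d \<in> S}"
proof -
  have "emeasure lborel S = (\<integral>\<^sup>+x. indicator S x \<partial>lborel)" by simp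
  also have "\<dots> = ennreal \<bar>2\<bar> * (\<integral>\<^sup>+x. indicator S (-d + 2 * x) \<partial>lborel)"
    by (rule nn_integral_real_affine) auto
  also have "(\<integral>\<^sup>+x. indicator S (-d + 2 * x) \<partial>lborel) = (\<integral>\<^sup>+x. indicator {x. 2 * x - d \<in> S} x \<partial>lborel)"
    by (intro nn_integral_cong) (auto simp: indicator_def)
  also have "\<dots> = emeasure lborel {x. 2 * x - d \<in> S}"
    by (intro nn_integral_indicator) measurable
  finally show ?thesis by simp
qed

text \<open>This is the one-dimensional Brunn-Minkowski inequality. \<open>W\<close> is any Borel
  set containing the midpoints, because the set of midpoints itself may fail to be Borel. The
  supremum of \<open>S\<close> and the infimum of \<open>T\<close> need not be attained, so
  near-extremal points \<open>s\<close> and \<open>d\<close> are used, and \<open>e\<close> pays for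
  the two ends cut off.\<close>

lemma emeasure_midpoints_bounded:
  fixes S T W :: "real set"
  assumes [measurable]: "S \<in> sets borel" "T \<in> sets borel" "W \<in> sets borel"
    and ne: "S \<noteq> {}" "T \<noteq> {}" and bdd: "bounded S" "bounded T"
    and W: "\<And>x y. x \<in> S \<Longrightarrow> y \<in> T \<Longrightarrow> (x + y) / 2 \<in> W"
  shows "emeasure lborel S + emeasure lborel T \<le> 2 * emeasure lborel W"
proof (rule ennreal_le_epsilon)
  fix e :: real assume e: "e > 0"
  obtain s where s: "s \<in> S" "s > Sup S - e/2"
    using less_cSupD[of S "Sup S - e/2"] ne e by auto
  obtain d where d: "d \<in> T" "d < Inf T + e/2"
    using cInf_lessD[of T "Inf T + e/2"] ne e by auto
  have S: "x \<le> Sup S" if "x \<in> S" for x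
    using that bdd(1) by (intro cSup_upper bounded_imp_bdd_above) auto
  have T: "Inf T \<le> x" if "x \<in> T" for x
    using that bdd(2) by (intro cInf_lower bounded_imp_bdd_below) auto
  txt \<open>\<open>W\<close> contains the essentially disjoint half-size copies \<open>A\<close> of \<open>S \<inter> {..s}\<close> and
    \<open>B\<close> of \<open>T \<inter> {d..}\<close>; they lie on the two sides of \<open>(s + d) / 2\<close>.\<close>
  define A where "A = {x. 2 * x - d \<in> S \<inter> {..s}}"
  define B where "B = {x. 2 * x - s \<in> T \<inter> {d..}}"
  have [measurable]: "A \<in> sets borel" "B \<in> sets borel"
    unfolding A_def B_def by measurable
  have 1: "emeasure lborel S \<le> emeasure lborel (S \<inter> {..s}) + ennreal (e/2)"
  proof -
    have "emeasure lborel S \<le> emeasure lborel ((S \<inter> {..s}) \<union> {s..Sup S})"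
      using S by (intro emeasure_mono) auto
    also have "\<dots> \<le> emeasure lborel (S \<inter> {..s}) + emeasure lborel {s..Sup S}"
      by (rule emeasure_subadditive) auto
    also have "emeasure lborel {s..Sup S} \<le> ennreal (e/2)"
      using s S[OF s(1)] by (auto intro!: ennreal_leI)
    finally show ?thesis by (simp add: add_left_mono)
  qed
  have 2: "emeasure lborel T \<le> emeasure lborel (T \<inter> {d..}) + ennreal (e/2)"
  proof -
    have "emeasure lborel T \<le> emeasure lborel ((T \<inter> {d..}) \<union> {Inf T..d})"
      using T by (intro emeasure_mono) auto
    also have "\<dots> \<le> emeasure lborel (T \<inter> {d..}) + emeasure lborel {Inf T..d}"
      by (rule emeasure_subadditive) auto
    also have "emeasure lborel {Inf T..d} \<le> ennreal (e/2)"
      using d T[OF d(1)] by (auto intro!: ennreal_leI)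
    finally show ?thesis by (simp add: add_left_mono)
  qed
  have W1: "x \<in> W" if "x \<in> A" for x
    using W[of "2*x - d" d] that d by (auto simp: A_def)
  have W2: "x \<in> W" if "x \<in> B" for x
    using W[of s "2*x - s"] that s by (auto simp: B_def)
  have "emeasure lborel A + emeasure lborel B = emeasure lborel (A \<union> B) + emeasure lborel (A \<inter> B)"
    by (rule emeasure_Un_Int) auto
  also have "emeasure lborel (A \<inter> B) \<le> emeasure lborel {(s + d) / 2}"
    by (intro emeasure_mono) (auto simp: A_def B_def)
  also have "\<dots> = 0" by simp
  finally have "emeasure lborel A + emeasure lborel B \<le> emeasure lborel (A \<union> B)"
    by (simp add: add_left_mono)
  also have "\<dots> \<le> emeasure lborel W"
    using W1 W2 by (intro emeasure_mono) auto
  finally have "2 * (emeasure lborel A + emeasure lborel B) \<le> 2 * emeasure lborel W"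
    by (rule mult_left_mono) simp
  then have "2 * emeasure lborel A + 2 * emeasure lborel B \<le> 2 * emeasure lborel W"
    by (simp only: distrib_left)
  moreover have "emeasure lborel (S \<inter> {..s}) = 2 * emeasure lborel A"
    unfolding A_def by (rule emeasure_lborel_double) auto
  moreover have "emeasure lborel (T \<inter> {d..}) = 2 * emeasure lborel B"
    unfolding B_def by (rule emeasure_lborel_double) auto
  ultimately have 3: "emeasure lborel (S \<inter> {..s}) + emeasure lborel (T \<inter> {d..}) \<le> 2 * emeasure lborel W"
    by simp
  have "emeasure lborel S + emeasure lborel T \<le> (emeasure lborel (S \<inter> {..s}) + ennreal (e/2)) + (emeasure lborel (T \<inter> {d..}) + ennreal (e/2))"
    using 1 2 by (rule add_mono)
  also have "\<dots> = (emeasure lborel (S \<inter> {..s}) + emeasure lborel (T \<inter> {d..})) + (ennreal (e/2) + ennreal (e/2))"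
    by (simp add: ac_simps)
  also have "ennreal (e/2) + ennreal (e/2) = ennreal e"
    using e by (simp flip: ennreal_plus)
  also have "(emeasure lborel (S \<inter> {..s}) + emeasure lborel (T \<inter> {d..})) + ennreal e \<le> 2 * emeasure lborel W + ennreal e"
    using 3 by (rule add_right_mono)
  finally show "emeasure lborel S + emeasure lborel T \<le> 2 * emeasure lborel W + ennreal e" .
qed

text \<open>Truncation to \<open>{- k..k}\<close> makes both sets bounded and, once \<open>k\<close>
  reaches \<open>k0\<close>, leaves them nonempty; the truncated measures converge to the full
  ones.\<close>

lemma emeasure_midpoints:
  fixes S T W :: "real set"
  assumes [measurable]: "S \<in> sets borel" "T \<in> sets borel" "W \<in> sets borel"
    and ne: "S \<noteq> {}" "T \<noteq> {}"
    and W: "\<And>x y. x \<in> S \<Longrightarrow> y \<in> T \<Longrightarrow> (x + y) / 2 \<in> W"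
  shows "emeasure lborel S + emeasure lborel T \<le> 2 * emeasure lborel W"
proof -
  obtain s t where st: "s \<in> S" "t \<in> T" using ne by auto
  define I where "I k = {- real k..real k}" for k
  have lim: "(\<lambda>k. emeasure lborel (X \<inter> I k)) \<longlonglongrightarrow> emeasure lborel X"
    if [measurable]: "X \<in> sets borel" for X
  proof -
    have "(\<lambda>k. emeasure lborel (X \<inter> I k)) \<longlonglongrightarrow> emeasure lborel (\<Union>k. X \<inter> I k)"
      by (intro Lim_emeasure_incseq) (auto simp: incseq_def I_def)
    also have "(\<Union>k. X \<inter> I k) = X"
    proof -
      have "\<exists>k. x \<in> I k" for x :: real
        using real_arch_simple[of "\<bar>x\<bar>"] by (auto simp: I_def abs_le_iff minus_le_iff)
      then show ?thesis by auto
    qed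
    finally show ?thesis .
  qed
  obtain k0 where k0: "max \<bar>s\<bar> \<bar>t\<bar> \<le> real k0" using real_arch_simple by blast
  show ?thesis
  proof (rule LIMSEQ_le_const2[OF tendsto_add[OF lim lim]])
    show "\<exists>N. \<forall>k\<ge>N. emeasure lborel (S \<inter> I k) + emeasure lborel (T \<inter> I k) \<le> 2 * emeasure lborel W"
    proof (intro exI[of _ k0] allI impI, rule emeasure_midpoints_bounded)
      fix k assume "k \<ge> k0"
      then have "s \<in> I k" "t \<in> I k" using k0 by (auto simp: I_def)
      then show "S \<inter> I k \<noteq> {}" "T \<inter> I k \<noteq> {}" using st by auto
    qed (auto simp: I_def intro: W bounded_Int)
  qed auto
qed

section \<open>Prekopa-Leindler inequality on the line\<close>

text \<open>Fubini for the region under the graph. Where \<open>u\<close> is negative,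
  \<open>ennreal\<close> gives 0 on the left, and \<open>indicator {0<..} t\<close> discards the
  levels t \<le> 0 on the right.\<close>

lemma nn_integral_layer_cake:
  fixes u :: "'a \<Rightarrow> real"
  assumes "sigma_finite_measure M" and [measurable]: "u \<in> borel_measurable M"
  shows "(\<integral>\<^sup>+x. ennreal (u x) \<partial>M) = (\<integral>\<^sup>+t. indicator {0<..} t * emeasure M {x \<in> space M. t < u x} \<partial>lborel)"
proof -
  interpret sigma_finite_measure M by fact
  interpret P: pair_sigma_finite M lborel ..
  have "(\<integral>\<^sup>+x. ennreal (u x) \<partial>M) = (\<integral>\<^sup>+x. \<integral>\<^sup>+t. indicator {0<..} t * indicator {..<u x} t \<partial>lborel \<partial>M)"
  proof (intro nn_integral_cong)
    fix x
    have "(\<integral>\<^sup>+t. indicator {0<..} t * indicator {..<u x} t \<partial>lborel) = (\<integral>\<^sup>+t. indicator {0<..<u x} t \<partial>lborel)"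
      by (intro nn_integral_cong) (auto simp: indicator_def)
    also have "\<dots> = emeasure lborel {0<..<u x}" by (rule nn_integral_indicator) simp
    also have "\<dots> = ennreal (u x)"
      by (cases "0 \<le> u x") (auto simp: ennreal_neg)
    finally show "ennreal (u x) = (\<integral>\<^sup>+t. indicator {0<..} t * indicator {..<u x} t \<partial>lborel)" ..
  qed
  also have "\<dots> = (\<integral>\<^sup>+x. \<integral>\<^sup>+t. indicator {0<..} t * indicator {(x, t). t < u x} (x, t) \<partial>lborel \<partial>M)"
    by (intro nn_integral_cong) (auto simp: indicator_def)
  also have "\<dots> = (\<integral>\<^sup>+t. \<integral>\<^sup>+x. indicator {0<..} t * indicator {z \<in> space (M \<Otimes>\<^sub>M lborel). snd z < u (fst z)} (x, t) \<partial>M \<partial>lborel)"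
    by (subst P.Fubini'[symmetric])
       (auto intro!: nn_integral_cong simp: indicator_def space_pair_measure cong: nn_integral_cong_simp)
  also have "\<dots> = (\<integral>\<^sup>+t. indicator {0<..} t * emeasure M {x \<in> space M. t < u x} \<partial>lborel)"
  proof (intro nn_integral_cong)
    fix t :: real
    have "(\<integral>\<^sup>+x. indicator {0<..} t * indicator {z \<in> space (M \<Otimes>\<^sub>M lborel). snd z < u (fst z)} (x, t) \<partial>M)
      = (\<integral>\<^sup>+x. indicator {0<..} t * indicator {x \<in> space M. t < u x} x \<partial>M)"
      by (intro nn_integral_cong) (auto simp: indicator_def space_pair_measure)
    also have "\<dots> = indicator {0<..} t * emeasure M {x \<in> space M. t < u x}"
      by (subst nn_integral_cmult) (auto simp: nn_integral_indicator)
    finally show "(\<integral>\<^sup>+x. indicator {0<..} t * indicator {z \<in> space (M \<Otimes>\<^sub>M lborel). snd z < u (fst z)} (x, t) \<partial>M)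
      = indicator {0<..} t * emeasure M {x \<in> space M. t < u x}" .
  qed
  finally show ?thesis .
qed

text \<open>If \<open>u x\<close> and \<open>v y\<close> exceed a level t > 0, then so does
  \<open>w\<close> at the midpoint, so the midpoint inequality for sets can be integrated over t. It
  requires both sets to be nonempty; with both suprema equal to 1, neither is empty for t < 1 and
  both are for t \<ge> 1.\<close>

lemma prekopa_leindler_normalized:
  fixes u v w :: "real \<Rightarrow> real"
  assumes [measurable]: "u \<in> borel_measurable borel" "v \<in> borel_measurable borel" "w \<in> borel_measurable borel"
    and u: "\<And>x. u x \<le> 1" "\<And>t. t < 1 \<Longrightarrow> \<exists>x. t < u x"
    and v: "\<And>x. v x \<le> 1" "\<And>t. t < 1 \<Longrightarrow> \<exists>x. t < v x"
    and w: "\<And>x. 0 \<le> w x"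
    and uvw: "\<And>x y. 0 < u x \<Longrightarrow> 0 < v y \<Longrightarrow> u x * v y \<le> (w ((x + y) / 2))\<^sup>2"
  shows "(\<integral>\<^sup>+x. u x \<partial>lborel) + (\<integral>\<^sup>+x. v x \<partial>lborel) \<le> 2 * (\<integral>\<^sup>+x. w x \<partial>lborel)"
proof -
  note lc = nn_integral_layer_cake[OF lborel.sigma_finite_measure_axioms]
  have "(\<integral>\<^sup>+x. u x \<partial>lborel) + (\<integral>\<^sup>+x. v x \<partial>lborel) =
    (\<integral>\<^sup>+t. indicator {0<..} t * emeasure lborel {x. t < u x} + indicator {0<..} t * emeasure lborel {x. t < v x} \<partial>lborel)"
    by (subst nn_integral_add) (auto simp: lc)
  also have "\<dots> \<le> (\<integral>\<^sup>+t. 2 * (indicator {0<..} t * emeasure lborel {x. t < w x}) \<partial>lborel)"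
  proof (intro nn_integral_mono)
    fix t :: real
    show "indicator {0<..} t * emeasure lborel {x. t < u x} + indicator {0<..} t * emeasure lborel {x. t < v x}
      \<le> 2 * (indicator {0<..} t * emeasure lborel {x. t < w x})"
    proof (cases "0 < t \<and> t < 1")
      case True
      have "emeasure lborel {x. t < u x} + emeasure lborel {x. t < v x} \<le> 2 * emeasure lborel {x. t < w x}"
      proof (rule emeasure_midpoints)
        fix x y assume "x \<in> {x. t < u x}" "y \<in> {x. t < v x}"
        then have xy: "t < u x" "t < v y" by auto
        then have "t * t < u x * v y" using True by (intro mult_strict_mono) auto
        also have "\<dots> \<le> (w ((x + y) / 2))\<^sup>2" using xy True by (intro uvw) auto
        finally have "t\<^sup>2 < (w ((x + y) / 2))\<^sup>2" by (simp add: power2_eq_square)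
        then show "(x + y) / 2 \<in> {x. t < w x}"
          using power_less_imp_less_base[of t 2] w by auto
      qed (use True u(2) v(2) in auto)
      then show ?thesis using True by simp
    next
      case False
      then consider "t \<le> 0" | "t \<ge> 1" by linarith
      then show ?thesis
      proof cases
        case 2
        then have "{x. t < u x} = {}" "{x. t < v x}  = {}"
          using u(1) v(1) by (auto simp: not_less intro: order.trans[of _ 1])
        then show ?thesis by simp
      qed simp
    qed
  qed
  also have "\<dots> = 2 * (\<integral>\<^sup>+x. w x \<partial>lborel)"
    by (subst nn_integral_cmult) (auto simp: lc)
  finally show ?thesis .
qed

text \<open>Dividing \<open>u\<close> and \<open>v\<close> by their suprema \<open>a\<close> and
  \<open>b\<close>, and \<open>w\<close> by \<open>sqrt (a * b)\<close>, gives
  \<open>p / a + q / b \<le> 2 / sqrt (a * b)\<close> for the integrals \<open>p\<close> and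
  \<open>q\<close>. The inequality of arithmetic and geometric means then cancels \<open>a\<close>
  and \<open>b\<close>.\<close>

lemma prekopa_leindler_bounded:
  fixes u v w :: "real \<Rightarrow> real"
  assumes [measurable]: "u \<in> borel_measurable borel" "v \<in> borel_measurable borel" "w \<in> borel_measurable borel"
    and u: "\<And>x. 0 \<le> u x" "\<And>x. u x \<le> C" and v: "\<And>x. 0 \<le> v x" "\<And>x. v x \<le> C"
    and w: "\<And>x. 0 \<le> w x"
    and uvw: "\<And>x y. u x * v y \<le> (w ((x + y) / 2))\<^sup>2"
    and w1: "(\<integral>\<^sup>+x. w x \<partial>lborel) = 1"
  shows "(\<integral>\<^sup>+x. u x \<partial>lborel) * (\<integral>\<^sup>+x. v x \<partial>lborel) \<le> 1"
proof (cases "(\<forall>x. u x = 0) \<or> (\<forall>x. v x = 0)")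
  case True
  then show ?thesis by auto
next
  case False
  then obtain x0 y0 where xy0: "u x0 > 0" "v y0 > 0"
    using u(1) v(1) by (metis less_eq_real_def)
  define a b where "a = Sup (range u)" and "b = Sup (range v)"
  have ua: "u x \<le> a" for x
    unfolding a_def using u(2) by (intro cSup_upper) (auto simp: bdd_above_def)
  have vb: "v x \<le> b" for x
    unfolding b_def using v(2) by (intro cSup_upper) (auto simp: bdd_above_def)
  have ab: "a > 0" "b > 0" using ua[of x0] vb[of y0] xy0 by auto
  have ca: "\<exists>x. t < u x / a" if "t < 1" for t
  proof -
    have "t * a < Sup (range u)" using that ab by (simp add: a_def[symmetric])
    then obtain x where "t * a < u x" using less_cSupD[of "range u" "t*a"] by auto
    then show ?thesis using ab by (auto simp: field_simps)
  qed
  have cb: "\<exists>x. t < v x / b" if "t < 1" for t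
  proof -
    have "t * b < Sup (range v)" using that ab by (simp add: b_def[symmetric])
    then obtain x where "t * b < v x" using less_cSupD[of "range v" "t*b"] by auto
    then show ?thesis using ab by (auto simp: field_simps)
  qed
  have "(\<integral>\<^sup>+x. ennreal (u x / a) \<partial>lborel) + (\<integral>\<^sup>+x. ennreal (v x / b) \<partial>lborel) \<le> 2 * (\<integral>\<^sup>+x. ennreal (w x / sqrt (a * b)) \<partial>lborel)"
  proof (rule prekopa_leindler_normalized)
    fix x y
    show "u x / a * (v y / b) \<le> (w ((x + y) / 2) / sqrt (a * b))\<^sup>2"
      using uvw[of x y] ab by (simp add: power_divide divide_right_mono)
  qed (use ua vb ab w ca cb in auto)
  also have "(\<integral>\<^sup>+x. ennreal (w x / sqrt (a * b)) \<partial>lborel) = (\<integral>\<^sup>+x. ennreal (1 / sqrt (a * b)) * ennreal (w x) \<partial>lborel)"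
    using ab w by (intro nn_integral_cong) (simp flip: ennreal_mult)
  also have "\<dots> = ennreal (1 / sqrt (a * b))"
    by (subst nn_integral_cmult) (auto simp: w1)
  also have "(\<integral>\<^sup>+x. ennreal (u x / a) \<partial>lborel) = (\<integral>\<^sup>+x. ennreal (1/a) * ennreal (u x) \<partial>lborel)"
    using ab u by (intro nn_integral_cong) (simp flip: ennreal_mult)
  also have "\<dots> = ennreal (1/a) * (\<integral>\<^sup>+x. u x \<partial>lborel)" by (rule nn_integral_cmult) simp
  also have "(\<integral>\<^sup>+x. ennreal (v x / b) \<partial>lborel) = (\<integral>\<^sup>+x. ennreal (1/b) * ennreal (v x) \<partial>lborel)"
    using ab v by (intro nn_integral_cong) (simp flip: ennreal_mult)
  also have "\<dots> = ennreal (1/b) * (\<integral>\<^sup>+x. v x \<partial>lborel)" by (rule nn_integral_cmult) simp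
  finally have *: "ennreal (1/a) * (\<integral>\<^sup>+x. u x \<partial>lborel) + ennreal (1/b) * (\<integral>\<^sup>+x. v x \<partial>lborel) \<le> 2 * ennreal (1 / sqrt (a * b))" .
  have fin: "(\<integral>\<^sup>+x. u x \<partial>lborel) < \<infinity>" "(\<integral>\<^sup>+x. v x \<partial>lborel) < \<infinity>"
    using * ab by (auto simp: less_top[symmetric] ennreal_mult_top top_unique ennreal_mult_eq_top_iff)
  then obtain p q where pq: "(\<integral>\<^sup>+x. u x \<partial>lborel) = ennreal p" "(\<integral>\<^sup>+x. v x \<partial>lborel) = ennreal q" "p \<ge> 0" "q \<ge> 0"
    by (metis infinity_ennreal_def less_top_ennreal)
  have "p / a + q / b \<le> 2 / sqrt (a * b)"
    using * ab pq by (simp flip: ennreal_mult ennreal_plus ennreal_numeral add: ennreal_le_iff)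
  then have "(p / a + q / b)\<^sup>2 \<le> (2 / sqrt (a * b))\<^sup>2"
    using pq ab by (intro power_mono) auto
  then have "(p / a + q / b)\<^sup>2 \<le> 4 / (a * b)" using ab by (simp add: power_divide)
  moreover have "4 * ((p / a) * (q / b)) \<le> (p / a + q / b)\<^sup>2"
    using zero_le_power2[of "p/a - q/b"] unfolding power2_diff power2_sum by linarith
  ultimately have "4 * (p * q) / (a * b) \<le> 4 / (a * b)" by simp
  then have "p * q \<le> 1" using ab by (simp add: divide_le_cancel)
  then show ?thesis using pq by (simp flip: ennreal_mult)
qed

text \<open>By the identity \<open>x\<^sup>2 / 2 + y\<^sup>2 / 2 - (x - y)\<^sup>2 / 4 = ((x + y) /
  2)\<^sup>2\<close>, the normal density itself can serve as \<open>w\<close>. Cutting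
  \<open>A\<close> and \<open>B\<close> at integers makes their suprema finite, and monotone
  convergence removes the cut.\<close>

lemma gaussian_tau_real:
  fixes A B :: "real \<Rightarrow> ennreal"
  assumes [measurable]: "A \<in> borel_measurable borel" "B \<in> borel_measurable borel"
    and AB: "\<And>x y. A x * B y \<le> ennreal (exp ((x - y)\<^sup>2 / 4))"
  shows "(\<integral>\<^sup>+x. A x \<partial>std_normal_distribution) * (\<integral>\<^sup>+x. B x \<partial>std_normal_distribution) \<le> 1"
proof -
  define A' B' where "A' k x = min (A x) (of_nat k)" and "B' k x = min (B x) (of_nat k)" for k :: nat and x
  have [measurable]: "A' k \<in> borel_measurable borel" "B' k \<in> borel_measurable borel" for k
    unfolding A'_def B'_def by measurable
  have *: "(\<integral>\<^sup>+x. A' k x \<partial>std_normal_distribution) * (\<integral>\<^sup>+x. B' j x \<partial>std_normal_distribution) \<le> 1" for k j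
  proof -
    define a b where "a x = enn2real (A' k x)" and "b x = enn2real (B' j x)" for x
    have Aa: "A' k x = ennreal (a x)" "B' j x = ennreal (b x)" for x
      unfolding a_def b_def A'_def B'_def by (auto simp: ennreal_enn2real_if min_def top_unique)
    have a0: "0 \<le> a x" "0 \<le> b x" for x by (auto simp: a_def b_def)
    have "ennreal (a x) \<le> ennreal (real k)" "ennreal (b x) \<le> ennreal (real j)" for x
      unfolding Aa[symmetric] by (auto simp: A'_def B'_def ennreal_of_nat_eq_real_of_nat)
    then have ak: "a x \<le> real k" "b x \<le> real j" for x by simp_all
    have ab: "a x * b y \<le> exp ((x - y)\<^sup>2 / 4)" for x y
    proof -
      have "ennreal (a x * b y) = A' k x * B' j y" using a0 by (simp add: Aa ennreal_mult)
      also have "\<dots> \<le> A x * B y" by (intro mult_mono) (auto simp: A'_def B'_def)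
      also note AB
      finally show ?thesis by simp
    qed
    have [measurable]: "a \<in> borel_measurable borel" "b \<in> borel_measurable borel"
      unfolding a_def b_def by measurable
    have "(\<integral>\<^sup>+x. ennreal (std_normal_density x * a x) \<partial>lborel) * (\<integral>\<^sup>+x. ennreal (std_normal_density x * b x) \<partial>lborel) \<le> 1"
    proof (rule prekopa_leindler_bounded[where w = std_normal_density and C = "real k + real j"])
      have le1: "std_normal_density x \<le> 1" for x
      proof -
        have "1 \<le> 2 * pi" using pi_ge_two by simp
        then have "1 / sqrt (2 * pi) * exp (- x\<^sup>2 / 2) \<le> 1 * 1"
          by (intro mult_mono) auto
        then show ?thesis by (simp add: std_normal_density_def)
      qed
      show "std_normal_density x * a x \<le> real k + real j" for x
        using mult_mono[OF le1 ak(1), of x x] a0[of x] by simp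
      show "std_normal_density x * b x \<le> real k + real j" for x
        using mult_mono[OF le1 ak(2), of x x] a0[of x] by simp
      show "std_normal_density x * a x * (std_normal_density y * b y) \<le> (std_normal_density ((x + y) / 2))\<^sup>2" for x y
      proof -
        have "exp (- x\<^sup>2 / 2) * exp (- y\<^sup>2 / 2) * (a x * b y) \<le> exp (- x\<^sup>2 / 2) * exp (- y\<^sup>2 / 2) * exp ((x - y)\<^sup>2 / 4)"
          by (intro mult_left_mono ab) auto
        also have "\<dots> = (exp (- ((x + y) / 2)\<^sup>2 / 2))\<^sup>2"
          unfolding power2_eq_square exp_add[symmetric] by (simp add: field_simps power2_eq_square)
        finally have "1 / (2 * pi) * (exp (- x\<^sup>2 / 2) * exp (- y\<^sup>2 / 2) * (a x * b y)) \<le> 1 / (2 * pi) * (exp (- ((x + y) / 2)\<^sup>2 / 2))\<^sup>2"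
          by (intro mult_left_mono) auto
        then show ?thesis
          unfolding std_normal_density_def power_mult_distrib by (simp add: field_simps real_sqrt_mult)
      qed
      show "(\<integral>\<^sup>+x. ennreal (std_normal_density x) \<partial>lborel) = 1"
        using prob_space.emeasure_space_1[OF prob_space_normal_density[of 1 0]]
        by (simp add: emeasure_density)
    qed (use a0 in auto)
    then show ?thesis
      by (simp add: nn_integral_density Aa ennreal_mult a0)
  qed
  have sup: "(\<integral>\<^sup>+x. F x \<partial>std_normal_distribution) = (SUP k. (\<integral>\<^sup>+x. min (F x) (of_nat k) \<partial>std_normal_distribution))"
    if [measurable]: "F \<in> borel_measurable borel" for F :: "real \<Rightarrow> ennreal"
  proof -
    have "(SUP k. (\<integral>\<^sup>+x. min (F x) (of_nat k) \<partial>std_normal_distribution)) = (\<integral>\<^sup>+x. (SUP k. min (F x) (of_nat k)) \<partial>std_normal_distribution)"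
      by (intro nn_integral_monotone_convergence_SUP[symmetric])
         (auto simp: incseq_def le_fun_def intro: min.coboundedI2)
    also have "(\<lambda>x. SUP k. min (F x) (of_nat k)) = F"
      by (simp flip: inf_min inf_SUP add: ennreal_SUP_of_nat_eq_top)
    finally show ?thesis ..
  qed
  have "(\<integral>\<^sup>+x. A x \<partial>std_normal_distribution) * (\<integral>\<^sup>+x. B x \<partial>std_normal_distribution)
    = (SUP k. SUP j. (\<integral>\<^sup>+x. A' k x \<partial>std_normal_distribution) * (\<integral>\<^sup>+x. B' j x \<partial>std_normal_distribution))"
    unfolding A'_def B'_def sup[OF assms(1)] sup[OF assms(2)]
    by (simp add: SUP_mult_right_ennreal SUP_mult_left_ennreal, rule SUP_commute)
  also have "\<dots> \<le> 1" by (intro SUP_least *)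
  finally show ?thesis .
qed

section \<open>Tensorization\<close>

lemma product_std_normal: "product_sigma_finite (\<lambda>_. std_normal_distribution)"
  unfolding product_sigma_finite_def
  by (intro allI prob_space_imp_sigma_finite prob_space_normal_density) simp

text \<open>Fix the new coordinate at s in \<open>A\<close> and at t in \<open>B\<close>. The factor
  \<open>c\<close> removes its share of the cost, so the induction hypothesis bounds the product of
  the partial integrals by \<open>exp ((s - t)\<^sup>2 / 4)\<close>, which is exactly what the
  one-dimensional case asks of them.\<close>

lemma gaussian_tau_PiM:
  assumes "finite I"
    and "A \<in> borel_measurable (PiM I (\<lambda>_. std_normal_distribution))"
    and "B \<in> borel_measurable (PiM I (\<lambda>_. std_normal_distribution))"
    and "\<And>x y. x \<in> space (PiM I (\<lambda>_. std_normal_distribution)) \<Longrightarrow> y \<in> space (PiM I (\<lambda>_. std_normal_distribution))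
      \<Longrightarrow> A x * B y \<le> ennreal (exp ((\<Sum>i\<in>I. (x i - y i)\<^sup>2) / 4))"
  shows "(\<integral>\<^sup>+x. A x \<partial>PiM I (\<lambda>_. std_normal_distribution)) * (\<integral>\<^sup>+x. B x \<partial>PiM I (\<lambda>_. std_normal_distribution)) \<le> 1"
  using assms
proof (induction I arbitrary: A B)
  case empty
  then show ?case
    using empty.prems(3)[of "\<lambda>_. undefined" "\<lambda>_. undefined"]
    by (simp add: PiM_empty nn_integral_count_space_finite)
next
  case (insert i I)
  let ?M = "\<lambda>_. std_normal_distribution"
  interpret product_sigma_finite ?M by (rule product_std_normal)
  interpret I: finite_product_sigma_finite ?M I by standard fact
  note [measurable] = insert.prems(1,2)
  define A' B' where "A' s = (\<integral>\<^sup>+x. A (x(i := s)) \<partial>PiM I ?M)" and "B' s = (\<integral>\<^sup>+x. B (x(i := s)) \<partial>PiM I ?M)" for s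
  have [measurable]: "(\<lambda>(s, x). A (x(i := s))) \<in> borel_measurable (borel \<Otimes>\<^sub>M PiM I ?M)"
     "(\<lambda>(s, x). B (x(i := s))) \<in> borel_measurable (borel \<Otimes>\<^sub>M PiM I ?M)"
    by measurable
  have [measurable]: "A' \<in> borel_measurable borel" "B' \<in> borel_measurable borel"
    unfolding A'_def B'_def by measurable
  have upd: "(\<lambda>x. x(i := s)) \<in> measurable (PiM I ?M) (PiM (insert i I) ?M)" for s
    by measurable
  have "A' s * B' t \<le> ennreal (exp ((s - t)\<^sup>2 / 4))" for s t
  proof -
    define c where "c = exp (- ((s - t)\<^sup>2 / 4))"
    have "(\<integral>\<^sup>+x. ennreal c * A (x(i := s)) \<partial>PiM I ?M) * (\<integral>\<^sup>+x. B (x(i := t)) \<partial>PiM I ?M) \<le> 1"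
    proof (rule insert.IH)
      show "(\<lambda>x. ennreal c * A (x(i := s))) \<in> borel_measurable (PiM I ?M)"
        "(\<lambda>x. B (x(i := t))) \<in> borel_measurable (PiM I ?M)"
        using upd by measurable
      fix x y assume xy: "x \<in> space (PiM I ?M)" "y \<in> space (PiM I ?M)"
      have "A (x(i := s)) * B (y(i := t)) \<le> ennreal (exp ((\<Sum>j\<in>insert i I. ((x(i := s)) j - (y(i := t)) j)\<^sup>2) / 4))"
        by (intro insert.prems(3) measurable_space[OF upd] xy)
      also have "(\<Sum>j\<in>insert i I. ((x(i := s)) j - (y(i := t)) j)\<^sup>2) = (s - t)\<^sup>2 + (\<Sum>j\<in>I. (x j - y j)\<^sup>2)"
        using insert.hyps by (simp, intro sum.cong) auto
      finally have "ennreal c * (A (x(i := s)) * B (y(i := t))) \<le> ennreal c * ennreal (exp (((s - t)\<^sup>2 + (\<Sum>j\<in>I. (x j - y j)\<^sup>2)) / 4))"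
        by (rule mult_left_mono) simp
      also have "\<dots> = ennreal (exp ((\<Sum>j\<in>I. (x j - y j)\<^sup>2) / 4))"
        by (simp add: c_def add_divide_distrib flip: ennreal_mult exp_add)
      finally show "ennreal c * A (x(i := s)) * B (y(i := t)) \<le> ennreal (exp ((\<Sum>j\<in>I. (x j - y j)\<^sup>2) / 4))"
        by (simp add: mult.assoc)
    qed
    also have "(\<integral>\<^sup>+x. ennreal c * A (x(i := s)) \<partial>PiM I ?M) = ennreal c * A' s"
      unfolding A'_def using upd by (intro nn_integral_cmult) measurable
    finally have "ennreal c * A' s * B' t \<le> 1" unfolding B'_def .
    then have "ennreal (1 / c) * (ennreal c * A' s * B' t) \<le> ennreal (1 / c) * 1"
      by (rule mult_left_mono) simp
    also have "ennreal (1 / c) * (ennreal c * A' s * B' t) = (ennreal (1 / c) * ennreal c) * (A' s * B' t)"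
      by (simp add: ac_simps)
    also have "ennreal (1 / c) * ennreal c = 1"
      by (simp add: c_def flip: ennreal_mult)
    finally show ?thesis by (simp add: c_def exp_minus inverse_eq_divide)
  qed
  then have "(\<integral>\<^sup>+s. A' s \<partial>std_normal_distribution) * (\<integral>\<^sup>+s. B' s \<partial>std_normal_distribution) \<le> 1"
    by (intro gaussian_tau_real) auto
  then show ?case
    unfolding A'_def B'_def
    by (simp add: product_nn_integral_insert_rev[OF insert.hyps(1,2)])
qed

subsection \<open>Metric projections\<close>

lemma inner_n_add_left: "inner_n n (x + y) z = inner_n n x z + inner_n n y z"
  and inner_n_add_right: "inner_n n z (x + y) = inner_n n z x + inner_n n z y"
  and inner_n_diff_left: "inner_n n (x - y) z = inner_n n x z - inner_n n y z"
  and inner_n_diff_right: "inner_n n z (x - y) = inner_n n z x - inner_n n z y"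
  and inner_n_scaleR_left: "inner_n n (c *\<^sub>R x) z = c * inner_n n x z"
  and inner_n_scaleR_right: "inner_n n z (c *\<^sub>R x) = c * inner_n n z x"
  by (simp_all add: inner_n_def sum.distrib sum_subtractf sum_distrib_left algebra_simps scaleR_fun_def)

lemma inner_n_zero_left: "inner_n n 0 z = 0"
  and inner_n_zero_right: "inner_n n z 0 = 0"
  and inner_n_minus_left: "inner_n n (- x) z = - inner_n n x z"
  and inner_n_minus_right: "inner_n n z (- x) = - inner_n n z x"
  by (simp_all add: inner_n_def sum_negf)

lemma inner_n_commute: "inner_n n x y = inner_n n y x"
  by (simp add: inner_n_def mult.commute)

lemmas inner_n_simps = inner_n_add_left inner_n_add_right inner_n_diff_left inner_n_diff_right
  inner_n_scaleR_left inner_n_scaleR_right inner_n_zero_left inner_n_zero_right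
  inner_n_minus_left inner_n_minus_right

lemma norm_n_nonneg [simp]: "0 \<le> norm_n n x"
  by (simp add: norm_n_def L2_set_nonneg)

lemma norm_n_sq: "(norm_n n x)\<^sup>2 = inner_n n x x"
  by (simp add: norm_n_def L2_set_def inner_n_def sum_nonneg power2_eq_square)

lemma inner_n_ge_0 [simp]: "0 \<le> inner_n n x x"
  by (simp flip: norm_n_sq)

lemma inner_n_le_norm: "\<bar>inner_n n x y\<bar> \<le> norm_n n x * norm_n n y"
proof -
  have "\<bar>inner_n n x y\<bar> \<le> (\<Sum>i<n. \<bar>x i\<bar> * \<bar>y i\<bar>)"
    unfolding inner_n_def by (rule order.trans[OF sum_abs]) (simp add: abs_mult)
  also have "\<dots> \<le> norm_n n x * norm_n n y"
    unfolding norm_n_def by (rule L2_set_mult_ineq)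
  finally show ?thesis .
qed

lemma norm_n_scaleR: "norm_n n (c *\<^sub>R x) = \<bar>c\<bar> * norm_n n x"
  by (rule power2_eq_imp_eq) (simp_all add: norm_n_sq inner_n_simps power_mult_distrib power2_eq_square[of c] mult.assoc)

lemma norm_n_triangle: "norm_n n (x + y) \<le> norm_n n x + norm_n n y"
  unfolding norm_n_def plus_fun_apply by (rule L2_set_triangle_ineq)

lemma norm_n_minus_commute: "norm_n n (x - y) = norm_n n (y - x)"
  by (rule power2_eq_imp_eq) (simp_all add: norm_n_sq inner_n_simps)

lemma norm_n_triangle_sub: "norm_n n x \<le> norm_n n y + norm_n n (x - y)"
  using norm_n_triangle[of n y "x - y"] by simp

lemma abs_le_norm_n: "i < n \<Longrightarrow> \<bar>x i\<bar> \<le> norm_n n x"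
  unfolding norm_n_def using member_le_L2_set[of "{..<n}" i "\<lambda>i. \<bar>x i\<bar>"]
  by (simp add: L2_set_def)

lemma continuous_on_norm_n_diff: "continuous_on UNIV (\<lambda>x. norm_n n (y - x))"
  unfolding fun_diff_def norm_n_def L2_set_def
  by (intro continuous_intros continuous_on_product_coordinates)

lemma compact_product_box:
  fixes B :: "'i \<Rightarrow> 'a::topological_space set"
  assumes "\<And>i. compact (B i)"
  shows "compact (PiE UNIV B)"
  using assms compactin_PiE[of "\<lambda>_. euclidean" UNIV B]
  by (simp add: euclidean_product_topology)

section \<open>Nearest points in a closed convex set\<close>

locale closed_convex =
  fixes n :: nat and K :: "(nat \<Rightarrow> real) set"
  assumes closed_K: "closedin (Euclidean_space n) K"
    and convex_K: "convex K"
    and K_nonempty: "K \<noteq> {}"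
begin

lemma K_zero: "x \<in> K \<Longrightarrow> n \<le> i \<Longrightarrow> x i = 0"
  using closedin_subset[OF closed_K] by (auto simp: topspace_Euclidean_space)

text \<open>The points of \<open>K\<close> no farther from \<open>y\<close> than a fixed
  \<open>z\<close> form a closed subset of a box whose factors are compact intervals, and
  \<open>{0}\<close> from index \<open>n\<close> on; Tychonoff's theorem makes the box
  compact.\<close>

lemma nearest_exists: "\<exists>p\<in>K. \<forall>x\<in>K. norm_n n (y - p) \<le> norm_n n (y - x)"
proof -
  obtain z where z: "z \<in> K" using K_nonempty by auto
  define R where "R = norm_n n (y - z)"
  define C where "C = K \<inter> {x. norm_n n (y - x) \<le> R}"
  define B where "B = PiE UNIV (\<lambda>i. if i < n then {y i - R..y i + R} else {0})"
  have cont: "continuous_on UNIV (\<lambda>x. norm_n n (y - x))"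
    by (rule continuous_on_norm_n_diff)
  have "closed C"
    unfolding C_def
    by (intro closed_Int closedin_Euclidean_imp_closed[OF closed_K] closed_Collect_le cont continuous_on_const)
  moreover have "compact B"
    unfolding B_def by (intro compact_product_box) auto
  moreover have "C \<subseteq> B"
  proof
    fix x assume x: "x \<in> C"
    have "\<bar>y i - x i\<bar> \<le> R" if "i < n" for i
      using abs_le_norm_n[OF that, of "y - x"] x by (auto simp: C_def)
    then show "x \<in> B" using x K_zero[of x] by (fastforce simp: B_def C_def abs_le_iff)
  qed
  ultimately have "compact C" by (metis compact_Int_closed inf.absorb_iff2)
  moreover have "C \<noteq> {}" using z by (auto simp: C_def R_def)
  ultimately obtain p where p: "p \<in> C" "\<And>x. x \<in> C \<Longrightarrow> norm_n n (y - p) \<le> norm_n n (y - x)"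
    using continuous_attains_inf[of C "\<lambda>x. norm_n n (y - x)"] continuous_on_subset[OF cont] by blast
  have "norm_n n (y - p) \<le> norm_n n (y - x)" if "x \<in> K" for x
  proof (cases "x \<in> C")
    case False
    then have "R < norm_n n (y - x)" using that by (auto simp: C_def)
    then show ?thesis using p(1) by (auto simp: C_def)
  qed (rule p)
  then show ?thesis using p(1) by (auto simp: C_def)
qed

text \<open>\<open>arg_min_on\<close> is a choice; the chosen point has the minimality property
  because some minimizer exists.\<close>

lemma proj_in_K: "proj n K y \<in> K"
  and proj_nearest: "x \<in> K \<Longrightarrow> norm_n n (y - proj n K y) \<le> norm_n n (y - x)"
proof -
  obtain p where p: "p \<in> K" "\<And>x. x \<in> K \<Longrightarrow> norm_n n (y - p) \<le> norm_n n (y - x)"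
    using nearest_exists by metis
  have "proj n K y \<in> K \<and> (\<forall>x\<in>K. \<not> norm_n n (y - x) < norm_n n (y - proj n K y))"
    unfolding proj_def arg_min_on_def
  proof (rule arg_minI[where Q = "\<lambda>q. q \<in> K \<and> (\<forall>z\<in>K. \<not> norm_n n (y - z) < norm_n n (y - q))"])
    show "p \<in> K" by (rule p)
    show "\<not> norm_n n (y - x) < norm_n n (y - p)" if "x \<in> K" for x
      using p(2)[OF that] by simp
    show "x \<in> K \<and> (\<forall>z\<in>K. \<not> norm_n n (y - z) < norm_n n (y - x))"
      if "x \<in> K" "\<forall>z. z \<in> K \<longrightarrow> \<not> norm_n n (y - z) < norm_n n (y - x)" for x
      using that by simp
  qed
  then have "proj n K y \<in> K" and *: "\<forall>x\<in>K. \<not> norm_n n (y - x) < norm_n n (y - proj n K y)"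
    by (rule conjunct1, rule conjunct2)
  then show "proj n K y \<in> K" by (simp only:)
  show "x \<in> K \<Longrightarrow> norm_n n (y - proj n K y) \<le> norm_n n (y - x)"
    by (rule leI) (rule bspec[OF *])
qed

text \<open>Moving from \<open>p\<close> towards \<open>x\<close> by a fraction t changes the
  squared distance to \<open>y\<close> by \<open>t * t * c - 2 * t * d\<close>. Minimality of
  \<open>p\<close> keeps this nonnegative, which for small t is incompatible with
  \<open>d > 0\<close>.\<close>

lemma proj_variational:
  assumes x: "x \<in> K"
  shows "inner_n n (x - proj n K y) (y - proj n K y) \<le> 0"
proof (rule ccontr)
  define p where "p = proj n K y"
  define d where "d = inner_n n (x - p) (y - p)"
  define c where "c = inner_n n (x - p) (x - p)"
  assume "\<not> ?thesis"
  then have d: "d > 0" by (simp add: d_def p_def)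
  have c: "c \<ge> 0" by (simp add: c_def)
  have *: "2 * d \<le> t * c" if t: "0 < t" "t \<le> 1" for t
  proof -
    have "(1 - t) *\<^sub>R p + t *\<^sub>R x \<in> K"
      using convexD_alt[OF convex_K _ x] proj_in_K t by (auto simp: p_def)
    moreover have "(1 - t) *\<^sub>R p + t *\<^sub>R x = p + t *\<^sub>R (x - p)"
      by (simp add: algebra_simps)
    ultimately have "(norm_n n (y - p))\<^sup>2 \<le> (norm_n n (y - (p + t *\<^sub>R (x - p))))\<^sup>2"
      unfolding p_def by (intro power_mono proj_nearest) auto
    also have "y - (p + t *\<^sub>R (x - p)) = (y - p) - t *\<^sub>R (x - p)" by simp
    also have "(norm_n n ((y - p) - t *\<^sub>R (x - p)))\<^sup>2 = (norm_n n (y - p))\<^sup>2 - 2 * t * d + t * t * c"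
      unfolding norm_n_sq c_def d_def inner_n_diff_left[of n "y - p" "t *\<^sub>R (x - p)"]
        inner_n_diff_right[of n _ "y - p" "t *\<^sub>R (x - p)"] inner_n_scaleR_left inner_n_scaleR_right
      by (simp add: inner_n_commute[of n "y - p" "x - p"] algebra_simps)
    finally have "(norm_n n (y - p))\<^sup>2 \<le> (norm_n n (y - p))\<^sup>2 - 2 * t * d + t * t * c" .
    then have "t * (2 * d) \<le> t * (t * c)" by (simp add: ac_simps)
    then show ?thesis using t by simp
  qed
  \<comment> \<open>Small enough for \<open>t * c \<le> d < 2 * d\<close>; the 1 in the denominator
    covers \<open>c = 0\<close>.\<close>
  define t where "t = min 1 (d / (c + 1))"
  have t: "0 < t" "t \<le> 1" using d c by (auto simp: t_def)
  have "t * c \<le> d / (c + 1) * c" using c by (intro mult_right_mono) (auto simp: t_def)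
  also have "\<dots> \<le> d" using c d by (simp add: field_simps)
  finally show False using *[OF t] d by simp
qed

lemma proj_eq_self: "x \<in> K \<Longrightarrow> proj n K x = x"
proof -
  assume x: "x \<in> K"
  have "norm_n n (x - proj n K x) \<le> norm_n n (x - x)" by (rule proj_nearest[OF x])
  also have "\<dots> = 0" by (simp add: norm_n_def L2_set_def)
  finally have *: "norm_n n (x - proj n K x) = 0" using norm_n_nonneg[of n "x - proj n K x"] by linarith
  show ?thesis
  proof
    fix i show "proj n K x i = x i"
      using abs_le_norm_n[of i n "x - proj n K x"] * K_zero[OF x, of i] K_zero[OF proj_in_K, of i x]
      by (cases "i < n") auto
  qed
qed

text \<open>Sum of the variational inequalities at \<open>y\<close> and at \<open>z\<close>, each
  tested with the other projection.\<close>

lemma proj_firmly_nonexpansive: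
  "(norm_n n (proj n K y - proj n K z))\<^sup>2 \<le> inner_n n (proj n K y - proj n K z) (y - z)"
  using proj_variational[OF proj_in_K, of z y] proj_variational[OF proj_in_K, of y z]
  by (simp add: norm_n_sq inner_n_simps inner_n_commute)

lemma proj_nonexpansive: "norm_n n (proj n K y - proj n K z) \<le> norm_n n (y - z)"
proof (cases "norm_n n (proj n K y - proj n K z) = 0")
  case False
  then have pos: "norm_n n (proj n K y - proj n K z) > 0"
    using norm_n_nonneg[of n "proj n K y - proj n K z"] by linarith
  have "(norm_n n (proj n K y - proj n K z))\<^sup>2 \<le> norm_n n (proj n K y - proj n K z) * norm_n n (y - z)"
    using proj_firmly_nonexpansive[of y z] inner_n_le_norm[of n "proj n K y - proj n K z" "y - z"] by linarith
  then show ?thesis using pos by (simp add: power2_eq_square)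
qed simp

end

section \<open>The projection along a ray\<close>

locale sequence_model = closed_convex +
  fixes \<mu>\<^sub>0 :: "nat \<Rightarrow> real"
  assumes mu0: "\<mu>\<^sub>0 \<in> K"

locale projection_path = sequence_model +
  fixes h :: "nat \<Rightarrow> real"
begin

definition P :: "real \<Rightarrow> nat \<Rightarrow> real" where
  "P \<tau> = proj n K (\<mu>\<^sub>0 + \<tau> *\<^sub>R h) - \<mu>\<^sub>0"

text \<open>This is \<open>dof\<close> with one factor \<tau> removed; in this form it is monotone
  and Lipschitz in \<tau>.\<close>

definition slope :: "real \<Rightarrow> real" where
  "slope \<tau> = inner_n n (P \<tau>) h"

lemma err_eq: "err n K \<mu>\<^sub>0 \<tau> h = inner_n n (P \<tau>) (P \<tau>)"
  by (simp add: err_def mu_seq_def P_def norm_n_sq)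

lemma dof_eq: "dof n K \<mu>\<^sub>0 \<tau> h = \<tau> * slope \<tau>"
  by (simp add: dof_def mu_seq_def P_def slope_def inner_n_simps)

lemma P_0: "P 0 = 0"
  using proj_eq_self[OF mu0] by (simp add: P_def)

lemma P_variational_mu0: "inner_n n (P a) (P a) \<le> a * slope a"
  using proj_variational[OF mu0, of "\<mu>\<^sub>0 + a *\<^sub>R h"]
  by (simp add: P_def slope_def inner_n_simps inner_n_commute algebra_simps)

text \<open>The projection at parameter \<open>a\<close> is tested with the one at parameter
  \<open>b\<close>. The monotonicity statements along the ray come from this inequality, used in one
  or both orders of \<open>a\<close> and \<open>b\<close>.\<close>

lemma P_variational:
  "a * (slope b - slope a) \<le> inner_n n (P a) (P b) - inner_n n (P a) (P a)"
  using proj_variational[OF proj_in_K, of "\<mu>\<^sub>0 + b *\<^sub>R h" "\<mu>\<^sub>0 + a *\<^sub>R h"]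
  by (simp add: P_def slope_def inner_n_simps inner_n_commute algebra_simps)

lemma err_le_dof: "err n K \<mu>\<^sub>0 \<tau> h \<le> dof n K \<mu>\<^sub>0 \<tau> h"
  using P_variational_mu0 by (simp add: err_eq dof_eq)

lemma P_lipschitz: "norm_n n (P a - P b) \<le> \<bar>a - b\<bar> * norm_n n h"
proof -
  have "norm_n n (P a - P b) = norm_n n (proj n K (\<mu>\<^sub>0 + a *\<^sub>R h) - proj n K (\<mu>\<^sub>0 + b *\<^sub>R h))"
    by (simp add: P_def)
  also have "\<dots> \<le> norm_n n ((\<mu>\<^sub>0 + a *\<^sub>R h) - (\<mu>\<^sub>0 + b *\<^sub>R h))" by (rule proj_nonexpansive)
  also have "(\<mu>\<^sub>0 + a *\<^sub>R h) - (\<mu>\<^sub>0 + b *\<^sub>R h) = (a - b) *\<^sub>R h" by (simp add: algebra_simps)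
  finally show ?thesis unfolding norm_n_scaleR .
qed

lemma norm_P_le: "norm_n n (P a) \<le> \<bar>a\<bar> * norm_n n h"
  using P_lipschitz[of a 0] by (simp add: P_0)

lemma slope_lipschitz: "\<bar>slope a - slope b\<bar> \<le> \<bar>a - b\<bar> * (norm_n n h)\<^sup>2"
proof -
  have "\<bar>slope a - slope b\<bar> \<le> norm_n n (P a - P b) * norm_n n h"
    using inner_n_le_norm[of n "P a - P b" h] by (simp add: slope_def inner_n_simps)
  also have "\<dots> \<le> (\<bar>a - b\<bar> * norm_n n h) * norm_n n h"
    by (intro mult_right_mono P_lipschitz) simp
  finally show ?thesis by (simp add: power2_eq_square mult.assoc)
qed

lemma slope_0: "slope 0 = 0"
  unfolding slope_def P_0 by (simp add: inner_n_def)

lemma slope_mono: "a \<le> b \<Longrightarrow> slope a \<le> slope b"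
proof -
  assume ab: "a \<le> b"
  have "0 \<le> inner_n n (P b - P a) (P b - P a)" by simp
  also have "\<dots> \<le> (b - a) * (slope b - slope a)"
    using P_variational[of a b] P_variational[of b a] by (simp add: inner_n_simps inner_n_commute algebra_simps)
  finally show ?thesis using ab by (cases "a = b") (auto simp: zero_le_mult_iff)
qed

lemma slope_nonneg: "0 \<le> a \<Longrightarrow> 0 \<le> slope a"
  using slope_mono[of 0 a] slope_0 by simp

text \<open>Eliminating \<open>slope b - slope a\<close> from the inequalities at \<open>a\<close>
  and at \<open>b\<close> gives \<open>a * (y\<^sup>2 - c) \<le> b * (c - x\<^sup>2)\<close>.
  Cauchy-Schwarz turns this into \<open>a * y * (y - x) \<le> b * x * (y - x)\<close>, and
  \<open>y - x\<close> is positive in the nontrivial case.\<close>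

lemma norm_P_sublinear:
  assumes ab: "0 < a" "a \<le> b"
  shows "a * norm_n n (P b) \<le> b * norm_n n (P a)"
proof (cases "norm_n n (P b) \<le> norm_n n (P a)")
  case True
  then show ?thesis using ab by (intro mult_mono) auto
next
  case False
  define x y c where "x = norm_n n (P a)" and "y = norm_n n (P b)" and "c = inner_n n (P a) (P b)"
  have cxy: "c \<le> x * y" using inner_n_le_norm[of n "P a" "P b"] by (simp add: x_def y_def c_def)
  have sa: "a * (slope b - slope a) \<le> c - x\<^sup>2"
    using P_variational[of a b] by (simp add: x_def c_def norm_n_sq)
  have sb: "b * (slope b - slope a) \<ge> y\<^sup>2 - c"
    using P_variational[of b a] by (simp add: y_def c_def norm_n_sq inner_n_commute algebra_simps)
  have "a * (y\<^sup>2 - x * y) \<le> a * (y\<^sup>2 - c)"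
    using cxy ab by (intro mult_left_mono) auto
  also have "\<dots> \<le> a * (b * (slope b - slope a))" using sb ab by (intro mult_left_mono) auto
  also have "\<dots> = b * (a * (slope b - slope a))" by simp
  also have "\<dots> \<le> b * (c - x\<^sup>2)" using sa ab by (intro mult_left_mono) auto
  also have "\<dots> \<le> b * (x * y - x\<^sup>2)" using cxy ab by (intro mult_left_mono) auto
  finally have "(a * y) * (y - x) \<le> (b * x) * (y - x)" by (simp add: power2_eq_square algebra_simps)
  then show ?thesis using False by (simp add: x_def y_def)
qed

text \<open>The increment \<open>a * (slope b - slope a)\<close> is at most
  \<open>c - x\<^sup>2\<close>. Here \<open>c \<le> x * y\<close> and
  \<open>a * y \<le> b * x\<close>, so \<open>a * (c - x\<^sup>2) \<le> (b - a) * x\<^sup>2\<close>,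
  and \<open>x\<^sup>2\<close> is at most \<open>a * slope a\<close>.\<close>

lemma slope_sublinear:
  assumes ab: "0 < a" "a \<le> b"
  shows "a * slope b \<le> b * slope a"
proof -
  define x y c where "x = norm_n n (P a)" and "y = norm_n n (P b)" and "c = inner_n n (P a) (P b)"
  have cxy: "c \<le> x * y" using inner_n_le_norm[of n "P a" "P b"] by (simp add: x_def y_def c_def)
  have sa: "a * (slope b - slope a) \<le> c - x\<^sup>2"
    using P_variational[of a b] by (simp add: x_def c_def norm_n_sq)
  have xs: "x\<^sup>2 \<le> a * slope a" using P_variational_mu0[of a] by (simp add: x_def norm_n_sq)
  have "a * c \<le> x * (a * y)" using mult_left_mono[OF cxy, of a] ab by (simp add: ac_simps)
  also have "\<dots> \<le> x * (b * x)"
    using norm_P_sublinear[OF ab] by (intro mult_left_mono) (auto simp: x_def y_def)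
  finally have ac: "a * (c - x\<^sup>2) \<le> (b - a) * x\<^sup>2" by (simp add: power2_eq_square algebra_simps)
  also have "\<dots> \<le> (b - a) * (a * slope a)" using xs ab by (intro mult_left_mono) auto
  finally have "a * (c - x\<^sup>2) \<le> a * ((b - a) * slope a)" by (simp add: ac_simps)
  then have "c - x\<^sup>2 \<le> (b - a) * slope a" using ab by simp
  then show ?thesis using sa by (simp add: algebra_simps)
qed

lemma dof_div_antimono: "antimono_on {0<..} (\<lambda>\<sigma>. dof n K \<mu>\<^sub>0 \<sigma> h / \<sigma>\<^sup>2)"
proof (rule monotone_onI)
  fix a b :: real assume ab: "a \<in> {0<..}" "b \<in> {0<..}" "a \<le> b"
  then show "dof n K \<mu>\<^sub>0 a h / a\<^sup>2 \<ge> dof n K \<mu>\<^sub>0 b h / b\<^sup>2"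
    using slope_sublinear[of a b] by (simp add: dof_eq power2_eq_square field_simps)
qed

lemma dof_scaling:
  assumes "0 \<le> \<sigma>" "1 \<le> M"
  shows "dof n K \<mu>\<^sub>0 \<sigma> h \<le> dof n K \<mu>\<^sub>0 (M * \<sigma>) h"
    and "dof n K \<mu>\<^sub>0 (M * \<sigma>) h \<le> M\<^sup>2 * dof n K \<mu>\<^sub>0 \<sigma> h"
proof -
  have le: "\<sigma> \<le> M * \<sigma>" using mult_right_mono[of 1 M \<sigma>] assms by simp
  show "dof n K \<mu>\<^sub>0 \<sigma> h \<le> dof n K \<mu>\<^sub>0 (M * \<sigma>) h"
    unfolding dof_eq using le assms slope_mono[OF le] slope_nonneg[of \<sigma>] by (intro mult_mono) auto
  show "dof n K \<mu>\<^sub>0 (M * \<sigma>) h \<le> M\<^sup>2 * dof n K \<mu>\<^sub>0 \<sigma> h"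
  proof (cases "\<sigma> = 0")
    case False
    then have pos: "\<sigma> > 0" using assms by simp
    have "\<sigma> * slope (M * \<sigma>) \<le> \<sigma> * (M * slope \<sigma>)"
      using slope_sublinear[OF pos le] by (simp add: ac_simps)
    then have "M * (\<sigma> * slope (M * \<sigma>)) \<le> M * (\<sigma> * (M * slope \<sigma>))"
      by (rule mult_left_mono) (use assms in auto)
    then show ?thesis unfolding dof_eq power2_eq_square by (simp only: ac_simps)
  qed (simp add: dof_eq)
qed

text \<open>The convex potential \<open>\<tau> \<mapsto> max {\<langle>x - \<mu>\<^sub>0, \<tau> h\<rangle> - \<parallel>x - \<mu>\<^sub>0\<parallel>\<^sup>2 / 2 | x. x \<in> K}\<close>, whose derivative is \<^term>\<open>slope\<close>.\<close>

definition potential :: "real \<Rightarrow> real" where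
  "potential \<tau> = \<tau> * slope \<tau> - inner_n n (P \<tau>) (P \<tau>) / 2"

text \<open>\<open>slope a\<close> is a subgradient at \<open>a\<close>: the gap between the two
  sides is at least half the squared norm of \<open>P b - P a\<close>.\<close>

lemma potential_ge: "potential a + (b - a) * slope a \<le> potential b"
proof -
  have "0 \<le> inner_n n (P b - P a) (P b - P a)" by simp
  then show ?thesis
    using P_variational[of b a] by (simp add: potential_def inner_n_simps inner_n_commute algebra_simps)
qed

text \<open>The subgradient inequalities at \<open>a\<close> and at \<open>a + k\<close> enclose the
  increment of the potential between \<open>k * slope a\<close> and
  \<open>k * slope (a + k)\<close>, and \<open>slope\<close> is Lipschitz.\<close>

lemma potential_deriv: "(potential has_real_derivative slope a) (at a)"
proof -
  have bound: "\<bar>(potential (a + k) - potential a) / k - slope a\<bar> \<le> \<bar>k\<bar> * (norm_n n h)\<^sup>2" if "k \<noteq> 0" for k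
  proof -
    have "0 \<le> potential (a + k) - potential a - k * slope a"
      using potential_ge[of a "a + k"] by simp
    moreover have "potential (a + k) - potential a - k * slope a \<le> k * (slope (a + k) - slope a)"
      using potential_ge[of "a + k" a] by (simp add: algebra_simps)
    ultimately have "\<bar>potential (a + k) - potential a - k * slope a\<bar> \<le> \<bar>k\<bar> * \<bar>slope (a + k) - slope a\<bar>"
      by (simp flip: abs_mult)
    also have "\<dots> \<le> \<bar>k\<bar> * (\<bar>k\<bar> * (norm_n n h)\<^sup>2)"
      using slope_lipschitz[of "a + k" a] by (intro mult_left_mono) auto
    finally have "\<bar>potential (a + k) - potential a - k * slope a\<bar> / \<bar>k\<bar> \<le> \<bar>k\<bar> * (norm_n n h)\<^sup>2"
      using that by (simp add: divide_le_eq ac_simps)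
    moreover have "\<bar>potential (a + k) - potential a - k * slope a\<bar> / \<bar>k\<bar> = \<bar>(potential (a + k) - potential a) / k - slope a\<bar>"
      using that by (simp add: diff_divide_distrib flip: abs_divide)
    ultimately show ?thesis by simp
  qed
  have "((\<lambda>k. (potential (a + k) - potential a) / k - slope a) \<longlongrightarrow> 0) (at 0)"
  proof (rule Lim_null_comparison)
    show "\<forall>\<^sub>F k in at 0. norm ((potential (a + k) - potential a) / k - slope a) \<le> \<bar>k\<bar> * (norm_n n h)\<^sup>2"
      using bound by (auto simp: eventually_at_filter)
    show "((\<lambda>k. \<bar>k\<bar> * (norm_n n h)\<^sup>2) \<longlongrightarrow> 0) (at 0)"
      by (auto intro!: tendsto_eq_intros)
  qed
  then show ?thesis unfolding DERIV_def by (simp add: LIM_zero_iff)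
qed

text \<open>Fundamental theorem of calculus for \<open>2 * potential \<tau> / \<tau>\<close>. At
  \<tau> = 0 the division yields 0, which is also the limit, because
  \<open>0 \<le> potential k \<le> k * (k * (norm_n n h)\<^sup>2)\<close> for \<open>k > 0\<close>;
  the antiderivative is therefore continuous on the closed interval.\<close>

lemma err_integral:
  assumes "\<sigma> > 0"
  shows "((\<lambda>\<tau>. err n K \<mu>\<^sub>0 \<tau> h / \<tau>\<^sup>2) has_integral 2 * potential \<sigma> / \<sigma>) {0..\<sigma>}"
proof -
  have "((\<lambda>\<tau>. 2 * potential \<tau> / \<tau>) has_vector_derivative err n K \<mu>\<^sub>0 \<tau> h / \<tau>\<^sup>2) (at \<tau>)" if "\<tau> > 0" for \<tau>
  proof -
    have "((\<lambda>\<tau>. 2 * potential \<tau> / \<tau>) has_real_derivative (2 * slope \<tau> * \<tau> - 2 * potential \<tau> * 1) / (\<tau> * \<tau>)) (at \<tau>)"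
      using that by (intro DERIV_divide DERIV_cmult potential_deriv DERIV_ident) auto
    also have "(2 * slope \<tau> * \<tau> - 2 * potential \<tau> * 1) / (\<tau> * \<tau>) = err n K \<mu>\<^sub>0 \<tau> h / \<tau>\<^sup>2"
      by (simp add: err_eq potential_def power2_eq_square)
    finally show ?thesis by (simp add: has_real_derivative_iff_has_vector_derivative)
  qed
  moreover have "continuous_on {0..\<sigma>} (\<lambda>\<tau>. 2 * potential \<tau> / \<tau>)"
    unfolding continuous_on_eq_continuous_within
  proof
    fix x assume x: "x \<in> {0..\<sigma>}"
    show "continuous (at x within {0..\<sigma>}) (\<lambda>\<tau>. 2 * potential \<tau> / \<tau>)"
    proof (cases "x = 0")
      case False
      then show ?thesis
        using DERIV_isCont[OF potential_deriv] continuous_at_imp_continuous_at_within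
        by (intro continuous_intros) auto
    next
      case True
      have "\<bar>2 * potential k / k\<bar> \<le> 2 * k * (norm_n n h)\<^sup>2" if "k \<ge> 0" for k
      proof (cases "k = 0")
        case False
        then have k: "k > 0" using that by simp
        have "0 \<le> potential k"
          using P_variational_mu0[of k] inner_n_ge_0[of n "P k"] unfolding potential_def by linarith
        moreover have "potential k \<le> k * slope k"
          using inner_n_ge_0[of n "P k"] unfolding potential_def by linarith
        moreover have "slope k \<le> k * (norm_n n h)\<^sup>2" using slope_lipschitz[of k 0] k by (simp add: slope_0)
        then have "k * slope k \<le> k * (k * (norm_n n h)\<^sup>2)" using k by (intro mult_left_mono) auto
        ultimately have "0 \<le> potential k" "potential k \<le> k * (k * (norm_n n h)\<^sup>2)"
          by linarith+
        then show ?thesis using k by (simp add: divide_le_eq ac_simps)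
      qed simp
      then have bd: "\<forall>\<^sub>F k in at 0 within {0..\<sigma>}. norm (2 * potential k / k) \<le> 2 * k * (norm_n n h)\<^sup>2"
        unfolding eventually_at_filter real_norm_def by (intro always_eventually) simp
      have "((\<lambda>k. 2 * k * (norm_n n h)\<^sup>2) \<longlongrightarrow> 2 * 0 * (norm_n n h)\<^sup>2) (at 0 within {0..\<sigma>})"
        by (intro tendsto_intros)
      then have "((\<lambda>\<tau>. 2 * potential \<tau> / \<tau>) \<longlongrightarrow> 0) (at 0 within {0..\<sigma>})"
        by (intro Lim_null_comparison[OF bd]) simp
      then show ?thesis using True by (simp add: continuous_within)
    qed
  qed
  ultimately show ?thesis
    using fundamental_theorem_of_calculus_interior[of 0 \<sigma> "\<lambda>\<tau>. 2 * potential \<tau> / \<tau>" "\<lambda>\<tau>. err n K \<mu>\<^sub>0 \<tau> h / \<tau>\<^sup>2"] assms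
    by simp
qed

text \<open>The right-hand side of the bound equals \<open>2 * dof - err\<close>, and
  \<open>err \<le> dof\<close>.\<close>

lemma dof_le_integral:
  assumes "\<sigma> > 0"
  shows "(\<lambda>\<tau>. err n K \<mu>\<^sub>0 \<tau> h / \<tau>\<^sup>2) integrable_on {0..\<sigma>}"
    and "dof n K \<mu>\<^sub>0 \<sigma> h \<le> \<sigma> * integral {0..\<sigma>} (\<lambda>\<tau>. err n K \<mu>\<^sub>0 \<tau> h / \<tau>\<^sup>2)"
proof -
  note * = err_integral[OF assms]
  show "(\<lambda>\<tau>. err n K \<mu>\<^sub>0 \<tau> h / \<tau>\<^sup>2) integrable_on {0..\<sigma>}"
    using * by (rule has_integral_integrable)
  show "dof n K \<mu>\<^sub>0 \<sigma> h \<le> \<sigma> * integral {0..\<sigma>} (\<lambda>\<tau>. err n K \<mu>\<^sub>0 \<tau> h / \<tau>\<^sup>2)"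
    unfolding integral_unique[OF *]
    using err_le_dof[of \<sigma>] assms by (simp add: potential_def err_eq dof_eq)
qed

end

section \<open>The tangent cone and pointwise small-noise limits\<close>

lemma closure_fun_combination:
  fixes C :: "('i \<Rightarrow> real) set"
  assumes x: "x \<in> closure C" and y: "y \<in> closure C"
    and C: "\<And>x y. x \<in> C \<Longrightarrow> y \<in> C \<Longrightarrow> a *\<^sub>R x + b *\<^sub>R y \<in> C"
  shows "a *\<^sub>R x + b *\<^sub>R y \<in> closure C"
proof -
  have cont: "continuous_on UNIV (\<lambda>z :: ('i \<Rightarrow> real) \<times> ('i \<Rightarrow> real). a *\<^sub>R fst z + b *\<^sub>R snd z)"
  proof (rule continuous_on_coordinatewise_then_product)
    fix i
    have "continuous_on UNIV (\<lambda>z :: ('i \<Rightarrow> real) \<times> ('i \<Rightarrow> real). fst z i)"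
      "continuous_on UNIV (\<lambda>z :: ('i \<Rightarrow> real) \<times> ('i \<Rightarrow> real). snd z i)"
      by (rule continuous_on_compose2[OF continuous_on_product_coordinates],
          auto intro: continuous_on_fst continuous_on_snd continuous_on_id)+
    then show "continuous_on UNIV (\<lambda>z :: ('i \<Rightarrow> real) \<times> ('i \<Rightarrow> real). (a *\<^sub>R fst z + b *\<^sub>R snd z) i)"
      by (simp add: scaleR_fun_def) (intro continuous_intros)
  qed
  have "a *\<^sub>R fst (x, y) + b *\<^sub>R snd (x, y) \<in> closure C"
  proof (rule image_closure_subset[OF _ closed_closure, of "C \<times> C" "\<lambda>z. a *\<^sub>R fst z + b *\<^sub>R snd z", THEN subsetD])
    show "continuous_on (closure (C \<times> C)) (\<lambda>z. a *\<^sub>R fst z + b *\<^sub>R snd z)"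
      by (rule continuous_on_subset[OF cont]) simp
    show "(\<lambda>z. a *\<^sub>R fst z + b *\<^sub>R snd z) ` (C \<times> C) \<subseteq> closure C"
      using C closure_subset by fastforce
    show "a *\<^sub>R fst (x, y) + b *\<^sub>R snd (x, y) \<in> (\<lambda>z. a *\<^sub>R fst z + b *\<^sub>R snd z) ` closure (C \<times> C)"
      using x y by (intro imageI) (simp add: closure_Times)
  qed
  then show ?thesis by simp
qed

context projection_path
begin

definition feasible_cone :: "(nat \<Rightarrow> real) set" where
  "feasible_cone = {\<alpha> *\<^sub>R (\<nu> - \<mu>\<^sub>0) | \<alpha> \<nu>. 0 \<le> \<alpha> \<and> \<nu> \<in> K}"

abbreviation T :: "(nat \<Rightarrow> real) set" where
  "T \<equiv> tangent_cone n K \<mu>\<^sub>0"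

text \<open>Convexity of \<open>K\<close> merges two directions into one: with total weight
  \<open>g > 0\<close>, the weighted mean \<open>w\<close> of \<nu> and \<xi> lies in
  \<open>K\<close>, and the combination is \<open>g\<close> times
  \<open>w - \<mu>\<^sub>0\<close>.\<close>

lemma feasible_cone_combination:
  assumes "x \<in> feasible_cone" "y \<in> feasible_cone" "0 \<le> a" "0 \<le> b"
  shows "a *\<^sub>R x + b *\<^sub>R y \<in> feasible_cone"
proof -
  obtain \<alpha> \<nu> \<beta> \<xi> where x: "x = \<alpha> *\<^sub>R (\<nu> - \<mu>\<^sub>0)" "0 \<le> \<alpha>" "\<nu> \<in> K" and y: "y = \<beta> *\<^sub>R (\<xi> - \<mu>\<^sub>0)" "0 \<le> \<beta>" "\<xi> \<in> K"
    using assms by (auto simp: feasible_cone_def)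
  define g where "g = a * \<alpha> + b * \<beta>"
  have nn: "a * \<alpha> \<ge> 0" "b * \<beta> \<ge> 0" using x y assms by auto
  show ?thesis
  proof (cases "g = 0")
    case True
    then have z: "a * \<alpha> = 0" "b * \<beta> = 0" unfolding g_def using add_nonneg_eq_0_iff[OF nn] by blast+
    then have "a *\<^sub>R x + b *\<^sub>R y = 0 *\<^sub>R (\<nu> - \<mu>\<^sub>0)"
      by (simp only: x(1) y(1) scaleR_scaleR z scaleR_zero_left add_0_left)
    then show ?thesis using x unfolding feasible_cone_def by blast
  next
    case False
    then have g: "g > 0" using nn by (auto simp: g_def)
    define w where "w = (a * \<alpha> / g) *\<^sub>R \<nu> + (b * \<beta> / g) *\<^sub>R \<xi>"
    have "w \<in> K" unfolding w_def
      using nn g x y by (intro convexD[OF convex_K]) (auto simp: g_def simp flip: add_divide_distrib)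
    moreover have "a *\<^sub>R x + b *\<^sub>R y = g *\<^sub>R (w - \<mu>\<^sub>0)"
      using g by (simp add: x(1) y(1) w_def scaleR_diff_right scaleR_add_right) (simp add: g_def scaleR_add_left)
    ultimately show ?thesis using g unfolding feasible_cone_def by (intro CollectI exI[of _ g] exI[of _ w]) auto
  qed
qed

text \<open>The carrier of dimension \<open>n\<close> is closed in the product topology, so the
  closure relative to it agrees with the closure in the whole sequence space.\<close>

lemma T_eq: "T = closure feasible_cone"
proof -
  let ?E = "topspace (Euclidean_space n)"
  have sub: "feasible_cone \<subseteq> ?E"
    using K_zero K_zero[OF mu0] by (auto simp: feasible_cone_def topspace_Euclidean_space scaleR_fun_def)
  have "closed ?E" using closedin_Euclidean_imp_closed[OF closedin_topspace] .
  then have "closure feasible_cone \<subseteq> ?E" using sub by (rule closure_minimal[rotated])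
  then show ?thesis
    using sub unfolding tangent_cone_def feasible_cone_def[symmetric] Euclidean_space_def closure_of_subtopology
    by (simp add: euclidean_product_topology closure_of_subtopology topspace_Euclidean_space Int_absorb1 Int_absorb2 Euclidean_space_def)
qed

lemma feasible_cone_subset_T: "feasible_cone \<subseteq> T"
  unfolding T_eq by (rule closure_subset)

lemma zero_in_feasible_cone: "0 \<in> feasible_cone"
proof -
  have "0 = 0 *\<^sub>R (\<mu>\<^sub>0 - \<mu>\<^sub>0)" by simp
  then show ?thesis unfolding feasible_cone_def using mu0 by blast
qed

lemma T_combination: "x \<in> T \<Longrightarrow> y \<in> T \<Longrightarrow> 0 \<le> a \<Longrightarrow> 0 \<le> b \<Longrightarrow> a *\<^sub>R x + b *\<^sub>R y \<in> T"
  unfolding T_eq by (intro closure_fun_combination feasible_cone_combination)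

sublocale T: closed_convex n T
proof
  show "closedin (Euclidean_space n) T" by (simp add: tangent_cone_def)
  show "convex T" by (rule convexI) (rule T_combination)
  show "T \<noteq> {}" using zero_in_feasible_cone feasible_cone_subset_T by auto
qed

text \<open>\<open>T\<close> is a cone, so the variational inequality may be tested both at 0 and at
  twice the projection; the two signs force \<open>h - proj n T h\<close> to be orthogonal to the
  projection.\<close>

lemma inner_proj_T: "inner_n n (proj n T h) h = (norm_n n (proj n T h))\<^sup>2"
proof -
  have "2 *\<^sub>R proj n T h \<in> T"
    using T_combination[OF T.proj_in_K T.proj_in_K, of 2 0 h h] by simp
  moreover have "0 \<in> T" using zero_in_feasible_cone feasible_cone_subset_T by auto
  ultimately show ?thesis
    using T.proj_variational[of "2 *\<^sub>R proj n T h" h] T.proj_variational[of 0 h]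
    by (simp add: norm_n_sq inner_n_simps inner_n_commute)
qed

lemma norm_proj_T_le: "norm_n n (proj n T h) \<le> norm_n n h"
proof (cases "norm_n n (proj n T h) = 0")
  case False
  then have "norm_n n (proj n T h) > 0" using norm_n_nonneg[of n "proj n T h"] by linarith
  moreover have "norm_n n (proj n T h) * norm_n n (proj n T h) \<le> norm_n n (proj n T h) * norm_n n h"
    using inner_proj_T inner_n_le_norm[of n "proj n T h" h] by (simp add: power2_eq_square)
  ultimately show ?thesis by simp
qed simp

lemma P_in_feasible_cone: "0 < \<sigma> \<Longrightarrow> (1 / \<sigma>) *\<^sub>R P \<sigma> \<in> feasible_cone"
  unfolding P_def feasible_cone_def using proj_in_K by (intro CollectI exI[of _ "1 / \<sigma>"] exI) auto

text \<open>Density of the feasible directions gives only convergence of the distances from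
  \<open>h\<close>. The variational inequality for \<open>T\<close> upgrades this: by
  \<open>pyth\<close>, the squared distance from \<open>q \<sigma>\<close> to \<open>t\<close> is at
  most the excess of the squared distances.\<close>

lemma directional_derivative: "((\<lambda>\<sigma>. norm_n n ((1 / \<sigma>) *\<^sub>R P \<sigma> - proj n T h)) \<longlongrightarrow> 0) (at_right 0)"
proof -
  define t where "t = proj n T h"
  define q where "q \<sigma> = (1 / \<sigma>) *\<^sub>R P \<sigma>" for \<sigma>
  have lower: "norm_n n (h - t) \<le> norm_n n (h - q \<sigma>)" if "\<sigma> > 0" for \<sigma>
    unfolding t_def q_def using P_in_feasible_cone[OF that] feasible_cone_subset_T
    by (intro T.proj_nearest) auto
  have upper: "norm_n n (h - q \<sigma>) \<le> norm_n n (h - \<alpha> *\<^sub>R (\<nu> - \<mu>\<^sub>0))"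
    if "\<sigma> > 0" "0 \<le> \<alpha>" "\<nu> \<in> K" "\<alpha> * \<sigma> \<le> 1" for \<sigma> \<alpha> \<nu>
  proof -
    \<comment> \<open>This competitor is \<sigma> times the given cone element, shifted by
      \<open>\<mu>\<^sub>0\<close>; it lies in \<open>K\<close> as soon as \<alpha> * \<sigma> \<le>
      1, hence for all small \<sigma>.\<close>
    have "(1 - \<alpha> * \<sigma>) *\<^sub>R \<mu>\<^sub>0 + (\<alpha> * \<sigma>) *\<^sub>R \<nu> \<in> K"
      using that by (intro convexD_alt[OF convex_K mu0]) auto
    from proj_nearest[OF this, of "\<mu>\<^sub>0 + \<sigma> *\<^sub>R h"]
    have "norm_n n (\<mu>\<^sub>0 + \<sigma> *\<^sub>R h - proj n K (\<mu>\<^sub>0 + \<sigma> *\<^sub>R h))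
      \<le> norm_n n (\<mu>\<^sub>0 + \<sigma> *\<^sub>R h - ((1 - \<alpha> * \<sigma>) *\<^sub>R \<mu>\<^sub>0 + (\<alpha> * \<sigma>) *\<^sub>R \<nu>))" .
    also have "\<mu>\<^sub>0 + \<sigma> *\<^sub>R h - proj n K (\<mu>\<^sub>0 + \<sigma> *\<^sub>R h) = \<sigma> *\<^sub>R (h - q \<sigma>)"
      using that by (simp add: q_def P_def algebra_simps)
    also have "\<mu>\<^sub>0 + \<sigma> *\<^sub>R h - ((1 - \<alpha> * \<sigma>) *\<^sub>R \<mu>\<^sub>0 + (\<alpha> * \<sigma>) *\<^sub>R \<nu>) = \<sigma> *\<^sub>R (h - \<alpha> *\<^sub>R (\<nu> - \<mu>\<^sub>0))"
      by (simp add: algebra_simps)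
    finally have "\<bar>\<sigma>\<bar> * norm_n n (h - q \<sigma>) \<le> \<bar>\<sigma>\<bar> * norm_n n (h - \<alpha> *\<^sub>R (\<nu> - \<mu>\<^sub>0))"
      unfolding norm_n_scaleR .
    then show ?thesis using that by simp
  qed
  have lim: "((\<lambda>\<sigma>. norm_n n (h - q \<sigma>)) \<longlongrightarrow> norm_n n (h - t)) (at_right 0)"
  proof (rule order_tendstoI)
    fix a assume "a < norm_n n (h - t)"
    then show "\<forall>\<^sub>F \<sigma> in at_right 0. a < norm_n n (h - q \<sigma>)"
      using lower by (intro eventually_mono[OF eventually_at_right_less]) (auto intro: less_le_trans)
  next
    fix a assume a: "norm_n n (h - t) < a"
    have "t \<in> closure feasible_cone" unfolding t_def using T.proj_in_K T_eq by auto
    moreover have "open {z. norm_n n (h - z) < a}"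
      by (intro open_Collect_less continuous_on_norm_n_diff continuous_on_const)
    ultimately obtain z where "z \<in> feasible_cone" "norm_n n (h - z) < a"
      using a by (auto simp: closure_iff_nhds_not_empty)
    then obtain \<alpha> \<nu> where z: "0 \<le> \<alpha>" "\<nu> \<in> K" "norm_n n (h - \<alpha> *\<^sub>R (\<nu> - \<mu>\<^sub>0)) < a"
      by (auto simp: feasible_cone_def)
    have "norm_n n (h - q \<sigma>) < a" if "0 < \<sigma>" "\<sigma> < 1 / (\<alpha> + 1)" for \<sigma>
    proof -
      have "(\<alpha> + 1) * \<sigma> < 1" using that z by (simp add: field_simps)
      then have "\<alpha> * \<sigma> \<le> 1" using that by (simp add: algebra_simps)
      then show ?thesis using upper[of \<sigma> \<alpha> \<nu>] that z by simp
    qed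
    moreover have "0 < 1 / (\<alpha> + 1)" using z by simp
    ultimately show "\<forall>\<^sub>F \<sigma> in at_right 0. norm_n n (h - q \<sigma>) < a"
      unfolding eventually_at_right_field by blast
  qed
  have pyth: "(norm_n n (q \<sigma> - t))\<^sup>2 \<le> (norm_n n (h - q \<sigma>))\<^sup>2 - (norm_n n (h - t))\<^sup>2" if "\<sigma> > 0" for \<sigma>
  proof -
    have "q \<sigma> \<in> T" using P_in_feasible_cone[OF that] feasible_cone_subset_T by (auto simp: q_def)
    from T.proj_variational[OF this, of h] show ?thesis
      unfolding t_def[symmetric] by (simp add: norm_n_sq inner_n_simps inner_n_commute)
  qed
  have "((\<lambda>\<sigma>. (norm_n n (h - q \<sigma>))\<^sup>2 - (norm_n n (h - t))\<^sup>2) \<longlongrightarrow> 0) (at_right 0)"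
    by (rule tendsto_eq_intros lim refl)+ simp
  then have "((\<lambda>\<sigma>. (norm_n n (q \<sigma> - t))\<^sup>2) \<longlongrightarrow> 0) (at_right 0)"
    by (rule Lim_null_comparison[rotated]) (use pyth in \<open>auto intro!: eventually_mono[OF eventually_at_right_less]\<close>)
  then have "((\<lambda>\<sigma>. sqrt ((norm_n n (q \<sigma> - t))\<^sup>2)) \<longlongrightarrow> sqrt 0) (at_right 0)"
    by (rule tendsto_real_sqrt)
  then show ?thesis by (simp add: q_def t_def)
qed

lemma err_limit: "((\<lambda>\<sigma>. err n K \<mu>\<^sub>0 \<sigma> h / \<sigma>\<^sup>2) \<longlongrightarrow> (norm_n n (proj n T h))\<^sup>2) (at_right 0)"
proof -
  have "((\<lambda>\<sigma>. norm_n n ((1 / \<sigma>) *\<^sub>R P \<sigma>) - norm_n n (proj n T h)) \<longlongrightarrow> 0) (at_right 0)"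
  proof (rule Lim_null_comparison[OF _ directional_derivative])
    show "\<forall>\<^sub>F \<sigma> in at_right 0. norm (norm_n n ((1 / \<sigma>) *\<^sub>R P \<sigma>) - norm_n n (proj n T h)) \<le> norm_n n ((1 / \<sigma>) *\<^sub>R P \<sigma> - proj n T h)"
    proof (intro always_eventually allI)
      fix \<sigma>
      show "norm (norm_n n ((1 / \<sigma>) *\<^sub>R P \<sigma>) - norm_n n (proj n T h)) \<le> norm_n n ((1 / \<sigma>) *\<^sub>R P \<sigma> - proj n T h)"
        using norm_n_triangle_sub[of n "(1 / \<sigma>) *\<^sub>R P \<sigma>" "proj n T h"] norm_n_triangle_sub[of n "proj n T h" "(1 / \<sigma>) *\<^sub>R P \<sigma>"]
        by (simp add: norm_n_minus_commute[of n "proj n T h"] abs_le_iff)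
    qed
  qed
  then have "((\<lambda>\<sigma>. (norm_n n ((1 / \<sigma>) *\<^sub>R P \<sigma>))\<^sup>2) \<longlongrightarrow> (norm_n n (proj n T h))\<^sup>2) (at_right 0)"
    by (intro tendsto_power) (simp add: LIM_zero_iff)
  moreover have "(norm_n n ((1 / \<sigma>) *\<^sub>R P \<sigma>))\<^sup>2 = err n K \<mu>\<^sub>0 \<sigma> h / \<sigma>\<^sup>2" for \<sigma>
    unfolding norm_n_sq err_eq by (simp add: inner_n_simps power2_eq_square)
  ultimately show ?thesis by simp
qed

text \<open>The limit is the inner product of the projection with \<open>h\<close>, which
  \<open>inner_proj_T\<close> identifies with the limit for \<open>err\<close>.\<close>

lemma dof_limit: "((\<lambda>\<sigma>. dof n K \<mu>\<^sub>0 \<sigma> h / \<sigma>\<^sup>2) \<longlongrightarrow> (norm_n n (proj n T h))\<^sup>2) (at_right 0)"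
proof -
  have "((\<lambda>\<sigma>. inner_n n ((1 / \<sigma>) *\<^sub>R P \<sigma>) h - inner_n n (proj n T h) h) \<longlongrightarrow> 0) (at_right 0)"
  proof (rule Lim_null_comparison)
    show "\<forall>\<^sub>F \<sigma> in at_right 0. norm (inner_n n ((1 / \<sigma>) *\<^sub>R P \<sigma>) h - inner_n n (proj n T h) h)
      \<le> norm_n n ((1 / \<sigma>) *\<^sub>R P \<sigma> - proj n T h) * norm_n n h"
      unfolding inner_n_diff_left[symmetric] real_norm_def
      by (intro always_eventually allI inner_n_le_norm)
    show "((\<lambda>\<sigma>. norm_n n ((1 / \<sigma>) *\<^sub>R P \<sigma> - proj n T h) * norm_n n h) \<longlongrightarrow> 0) (at_right 0)"
      by (rule tendsto_mult_left_zero[OF directional_derivative])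
  qed
  then have "((\<lambda>\<sigma>. inner_n n ((1 / \<sigma>) *\<^sub>R P \<sigma>) h) \<longlongrightarrow> (norm_n n (proj n T h))\<^sup>2) (at_right 0)"
    by (simp add: LIM_zero_iff inner_proj_T)
  moreover have "inner_n n ((1 / \<sigma>) *\<^sub>R P \<sigma>) h = dof n K \<mu>\<^sub>0 \<sigma> h / \<sigma>\<^sup>2" for \<sigma>
    by (simp add: dof_eq slope_def inner_n_simps power2_eq_square)
  ultimately show ?thesis by simp
qed

end

subsection \<open>Differentiability of monotone Lipschitz functions\<close>

definition diff_quot :: "(real \<Rightarrow> real) \<Rightarrow> real \<Rightarrow> real \<Rightarrow> real" where
  "diff_quot g x r = (g (x + r) - g x) / r"

lemma DERIV_diff_quot: "DERIV g x :> D \<longleftrightarrow> (diff_quot g x \<longlongrightarrow> D) (at 0)"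
  by (simp add: DERIV_def diff_quot_def[abs_def])

text \<open>For the sake of measurability: the right-hand side involves countably many increments.
  Continuity of \<open>g\<close> and openness of \<open>S\<close> allow a real increment to be
  replaced by a nearby rational one.\<close>

lemma frequently_diff_quot_iff:
  assumes cont: "continuous_on UNIV g" and S: "open S"
  shows "(\<exists>\<^sub>F r in at 0. diff_quot g x r \<in> S) \<longleftrightarrow>
    (\<forall>m::nat. \<exists>r\<in>\<rat>. r \<noteq> 0 \<and> \<bar>r\<bar> < inverse (Suc m) \<and> diff_quot g x r \<in> S)"
proof safe
  fix m :: nat
  assume "\<exists>\<^sub>F r in at 0. diff_quot g x r \<in> S"
  moreover have "\<forall>\<^sub>F r in at 0. \<bar>r\<bar> < inverse (Suc m)"
    unfolding eventually_at by (intro exI[of _ "inverse (Suc m)"]) auto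
  moreover have "\<forall>\<^sub>F r in at (0::real). r \<noteq> 0" by (simp add: eventually_at_filter)
  ultimately have "\<exists>\<^sub>F r in at 0. diff_quot g x r \<in> S \<and> \<bar>r\<bar> < inverse (Suc m) \<and> r \<noteq> 0"
    by (intro frequently_eventually_frequently eventually_conj)
  then obtain r where r: "diff_quot g x r \<in> S" "\<bar>r\<bar> < inverse (Suc m)" "r \<noteq> 0"
    using frequently_ex by blast
  have "isCont (\<lambda>s. g (x + s)) r"
    using continuous_on_compose2[OF cont, of UNIV "\<lambda>s. x + s"]
    by (auto simp: continuous_on_eq_continuous_at intro: continuous_intros)
  then have "isCont (diff_quot g x) r"
    unfolding diff_quot_def[abs_def] using r by (intro continuous_intros) auto
  then have "\<forall>\<^sub>F s in at r. diff_quot g x s \<in> S"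
    unfolding isCont_def using r S by (auto intro: topological_tendstoD)
  moreover have "((\<lambda>s. \<bar>s\<bar>) \<longlongrightarrow> \<bar>r\<bar>) (at r)" by (intro tendsto_intros)
  then have "\<forall>\<^sub>F s in at r. \<bar>s\<bar> < inverse (Suc m)" using r by (auto intro: order_tendstoD)
  moreover have "\<forall>\<^sub>F s in at r. s \<noteq> 0"
    using r by (intro tendsto_imp_eventually_ne[OF tendsto_ident_at])
  ultimately have "\<forall>\<^sub>F s in at r. diff_quot g x s \<in> S \<and> \<bar>s\<bar> < inverse (Suc m) \<and> s \<noteq> 0"
    by (auto simp: eventually_conj_iff)
  then obtain d where d: "d > 0" "\<And>s. s \<noteq> r \<Longrightarrow> dist s r < d \<Longrightarrow> diff_quot g x s \<in> S \<and> \<bar>s\<bar> < inverse (Suc m) \<and> s \<noteq> 0"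
    by (auto simp: eventually_at)
  obtain s where "s \<in> \<rat>" "r < s" "s < r + d" using Rats_dense_in_real[of r "r + d"] d by auto
  then show "\<exists>r\<in>\<rat>. r \<noteq> 0 \<and> \<bar>r\<bar> < inverse (Suc m) \<and> diff_quot g x r \<in> S"
    using d(2)[of s] by (intro bexI[of _ s]) (auto simp: dist_real_def)
next
  assume *: "\<forall>m::nat. \<exists>r\<in>\<rat>. r \<noteq> 0 \<and> \<bar>r\<bar> < inverse (Suc m) \<and> diff_quot g x r \<in> S"
  show "\<exists>\<^sub>F r in at 0. diff_quot g x r \<in> S"
    unfolding frequently_def eventually_at
  proof safe
    fix d :: real assume d: "d > 0" "\<forall>r\<in>UNIV. r \<noteq> 0 \<and> dist r 0 < d \<longrightarrow> diff_quot g x r \<notin> S"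
    then obtain m where "inverse (Suc m) < d" using reals_Archimedean by blast
    moreover obtain r where "r \<noteq> 0" "\<bar>r\<bar> < inverse (Suc m)" "diff_quot g x r \<in> S" using * by blast
    ultimately show False using d(2) by (simp add: dist_real_def)
  qed
qed

text \<open>Difference quotients at nonzero increments lie between 0 and \<open>C\<close>, so an
  infinite derivative is excluded and differentiability can fail only by oscillation. Rational
  \<open>p\<close> and \<open>q\<close> leave countably many cases.\<close>

lemma nondifferentiable_iff:
  assumes mono: "mono g" and lip: "\<And>x y. \<bar>g x - g y\<bar> \<le> C * \<bar>x - y\<bar>"
  shows "(\<nexists>D. DERIV g x :> D) \<longleftrightarrow>
    (\<exists>p\<in>\<rat>. \<exists>q\<in>\<rat>. p < q \<and> (\<exists>\<^sub>F r in at 0. diff_quot g x r < p) \<and> (\<exists>\<^sub>F r in at 0. q < diff_quot g x r))"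
    (is "_ \<longleftrightarrow> ?osc")
proof safe
  fix p q D assume pq: "p < q" "\<exists>\<^sub>F r in at 0. diff_quot g x r < p" "\<exists>\<^sub>F r in at 0. q < diff_quot g x r"
    and "DERIV g x :> D"
  then have lim: "(diff_quot g x \<longlongrightarrow> D) (at 0)" by (simp add: DERIV_diff_quot)
  have "\<not> p < D"
  proof
    assume "p < D"
    from order_tendstoD(1)[OF lim this] have "\<forall>\<^sub>F r in at 0. \<not> diff_quot g x r < p"
      by (rule eventually_mono) simp
    then show False using pq(2) by (simp add: frequently_def)
  qed
  moreover have "\<not> D < q"
  proof
    assume "D < q"
    from order_tendstoD(2)[OF lim this] have "\<forall>\<^sub>F r in at 0. \<not> q < diff_quot g x r"
      by (rule eventually_mono) simp
    then show False using pq(3) by (simp add: frequently_def)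
  qed
  ultimately show False using pq(1) by simp
next
  assume nd: "\<nexists>D. DERIV g x :> D"
  show ?osc
  proof (rule ccontr)
    assume no: "\<not> ?osc"
    have q0: "0 \<le> diff_quot g x r" for r
      using monoD[OF mono, of x "x + r"] monoD[OF mono, of "x + r" x]
      by (cases "0 \<le> r") (auto simp: diff_quot_def divide_nonpos_neg)
    have qC: "diff_quot g x r \<le> C" if "r \<noteq> 0" for r
    proof -
      have "diff_quot g x r \<le> \<bar>diff_quot g x r\<bar>" by simp
      also have "\<dots> = \<bar>g (x + r) - g x\<bar> / \<bar>r\<bar>" by (simp add: diff_quot_def abs_divide)
      also have "\<dots> \<le> C" using lip[of "x + r" x] that by (simp add: divide_le_eq)
      finally show ?thesis .
    qed
    \<comment> \<open>\<open>Sup A\<close> is the lower limit of the difference quotients; without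
      oscillation it is their limit.\<close>
    define A where "A = {p. \<forall>\<^sub>F r in at 0. p \<le> diff_quot g x r}"
    have A0: "0 \<in> A" by (simp add: A_def q0)
    have Abd: "p \<le> C" if "p \<in> A" for p
    proof -
      have "\<forall>\<^sub>F r in at (0::real). p \<le> diff_quot g x r \<and> r \<noteq> 0"
        using that by (auto simp: A_def eventually_conj_iff eventually_at_filter)
      then obtain r where "p \<le> diff_quot g x r" "r \<noteq> 0"
        using eventually_happens[of _ "at (0::real)"] by auto
      then show ?thesis using qC[of r] by simp
    qed
    have bdd: "bdd_above A" using Abd by (auto simp: bdd_above_def)
    have "(diff_quot g x \<longlongrightarrow> Sup A) (at 0)"
    proof (rule order_tendstoI)
      fix c assume "c < Sup A"
      then obtain p where "p \<in> A" "c < p" using less_cSupD[of A c] A0 by auto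
      then show "\<forall>\<^sub>F r in at 0. c < diff_quot g x r" by (auto simp: A_def elim!: eventually_mono)
    next
      fix c assume c: "Sup A < c"
      obtain p where p: "p \<in> \<rat>" "Sup A < p" "p < c" using Rats_dense_in_real[OF c] by auto
      obtain q where q: "q \<in> \<rat>" "p < q" "q < c" using Rats_dense_in_real[OF p(3)] by auto
      have "p \<notin> A" using cSup_upper[OF _ bdd, of p] p by auto
      then have "\<exists>\<^sub>F r in at 0. diff_quot g x r < p" by (simp add: A_def frequently_def not_less)
      then have "\<not> (\<exists>\<^sub>F r in at 0. q < diff_quot g x r)" using no p q by blast
      then have "\<forall>\<^sub>F r in at 0. diff_quot g x r \<le> q" by (simp add: frequently_def not_less)
      then show "\<forall>\<^sub>F r in at 0. diff_quot g x r < c" using q by (auto elim!: eventually_mono)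
    qed
    then show False using nd by (auto simp: DERIV_diff_quot)
  qed
qed

section \<open>Vitali covering and null sets of oscillation\<close>

text \<open>An interval is the closed ball around its midpoint. The point \<open>x\<close> may sit
  anywhere in it, since difference quotients produce intervals that have \<open>x\<close> as an end
  point.\<close>

lemma Vitali_covering_intervals:
  fixes S U :: "real set"
  assumes "open U" "S \<subseteq> U"
    and fine: "\<And>x d. x \<in> S \<Longrightarrow> 0 < d \<Longrightarrow> \<exists>a b. a < b \<and> x \<in> {a..b} \<and> b - a < d \<and> Q a b"
  obtains C where "countable C" "disjoint_family_on (\<lambda>(a, b). {a..b}) C"
    "\<forall>a b. (a, b) \<in> C \<longrightarrow> a < b \<and> {a..b} \<subseteq> U \<and> Q a b"
    "negligible (S - (\<Union>(a, b)\<in>C. {a..b}))"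
proof -
  define I where "I = {(a, b). a < b \<and> {a..b} \<subseteq> U \<and> Q a b}"
  define m r where "m i = (fst i + snd i) / 2" and "r i = (snd i - fst i) / 2" for i :: "real \<times> real"
  have cb: "cball (m i) (r i) = {fst i..snd i}" for i
    unfolding cball_eq_atLeastAtMost m_def r_def by (simp add: field_simps)
  have r0: "0 < r i" if "i \<in> I" for i using that by (auto simp: I_def r_def)
  have fineI: "\<exists>i. i \<in> I \<and> x \<in> cball (m i) (r i) \<and> r i < d" if x: "x \<in> S" and d: "0 < d" for x d
  proof -
    obtain e where e: "e > 0" "ball x e \<subseteq> U" using assms x by (meson open_contains_ball subsetD)
    obtain a b where ab: "a < b" "x \<in> {a..b}" "b - a < min d e" "Q a b" using fine[OF x, of "min d e"] d e by auto
    have "{a..b} \<subseteq> ball x e"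
    proof
      fix y assume "y \<in> {a..b}"
      then have "\<bar>x - y\<bar> < e" using ab by (simp add: abs_less_iff)
      then show "y \<in> ball x e" by (simp add: dist_real_def)
    qed
    then have "(a, b) \<in> I" using ab e unfolding I_def by blast
    moreover have "x \<in> cball (m (a, b)) (r (a, b))" unfolding cb using ab by simp
    moreover have "r (a, b) < d" using ab by (simp add: r_def)
    ultimately show ?thesis by blast
  qed
  obtain C where C: "countable C" "C \<subseteq> I"
    "pairwise (\<lambda>i j. disjnt (cball (m i) (r i)) (cball (m j) (r j))) C"
    "negligible (S - (\<Union>i\<in>C. cball (m i) (r i)))"
    by (rule Vitali_covering_theorem_cballs[of I r S m, OF r0 fineI])
  show thesis
  proof (rule that[of C])
    show "disjoint_family_on (\<lambda>(a, b). {a..b}) C"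
      using C(3) unfolding pairwise_def disjoint_family_on_def cb disjnt_def by (simp add: case_prod_unfold)
    show "negligible (S - (\<Union>(a, b)\<in>C. {a..b}))" using C(4) unfolding cb by (simp add: case_prod_unfold)
    show "\<forall>a b. (a, b) \<in> C \<longrightarrow> a < b \<and> {a..b} \<subseteq> U \<and> Q a b"
      using C(2) by (auto simp: I_def)
  qed (rule C)
qed

lemma frequently_diff_quot_interval:
  assumes "\<exists>\<^sub>F r in at 0. diff_quot g x r \<in> S" "0 < d"
  shows "\<exists>a b. a < b \<and> x \<in> {a..b} \<and> b - a < d \<and> (g b - g a) / (b - a) \<in> S"
proof -
  have "\<not> (\<forall>\<^sub>F r in at 0. diff_quot g x r \<notin> S)" using assms(1) by (simp add: frequently_def)
  then obtain r where r: "r \<noteq> 0" "\<bar>r\<bar> < d" "diff_quot g x r \<in> S"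
    using assms(2) unfolding eventually_at by (auto simp: dist_real_def)
  show ?thesis
  proof (cases "r > 0")
    case True
    then show ?thesis using r by (intro exI[of _ x] exI[of _ "x + r"]) (auto simp: diff_quot_def)
  next
    case False
    have "(g x - g (x + r)) / (x - (x + r)) = diff_quot g x r"
      unfolding diff_quot_def using r by (simp add: divide_simps)
    then show ?thesis using r False by (intro exI[of _ "x + r"] exI[of _ x]) auto
  qed
qed

text \<open>Lebesgue's argument with two coverings. Intervals of slope below \<open>p\<close>,
  inside an open set barely larger than \<open>E\<close>, bound the Stieltjes measure of
  \<open>g\<close> on their union \<open>W\<close> by \<open>p\<close> times nearly the length of
  \<open>E\<close>. Intervals of slope above \<open>q\<close> inside them still cover almost all of
  \<open>E\<close>, so that measure is at least \<open>q\<close> times the length of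
  \<open>E\<close>. Since \<open>p < q\<close>, the length is 0.\<close>

lemma oscillation_null_set:
  assumes mono: "mono g" and cont: "continuous_on UNIV g" and pq: "p < q"
    and [measurable]: "E \<in> sets borel" and fin: "bounded E"
    and E: "\<And>x. x \<in> E \<Longrightarrow> (\<exists>\<^sub>F r in at 0. diff_quot g x r < p) \<and> (\<exists>\<^sub>F r in at 0. q < diff_quot g x r)"
  shows "emeasure lborel E = 0"
proof (cases "E = {}")
  case False
  have q0: "0 \<le> diff_quot g x r" for x r
    using monoD[OF mono, of x "x + r"] monoD[OF mono, of "x + r" x]
    by (cases "0 \<le> r") (auto simp: diff_quot_def divide_nonpos_neg)
  obtain x0 where "x0 \<in> E" using False by auto
  then obtain r0 where "diff_quot g x0 r0 < p" using E frequently_ex by blast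
  then have p0: "p > 0" using q0[of x0 r0] by simp
  define \<mu> where "\<mu> = interval_measure g"
  have [simp]: "sets \<mu> = sets borel" by (simp add: \<mu>_def)
  have \<mu>: "emeasure \<mu> {a..b} = ennreal (g b - g a)" if "a < b" for a b
    unfolding \<mu>_def using that mono by (intro emeasure_interval_measure_Icc cont) (auto dest: monoD)
  have union: "emeasure M (\<Union>(a, b)\<in>C. {a..b}) = (\<integral>\<^sup>+(a, b). emeasure M {a..b} \<partial>count_space C)"
    if "sets M = sets borel" "countable C" "disjoint_family_on (\<lambda>(a, b). {a..b}) C"
    for M :: "real measure" and C
    using that(1) by (subst emeasure_UN_countable[OF _ that(2,3)]) (auto simp: case_prod_unfold)
  have fin_E: "emeasure lborel E < \<infinity>" using fin by (intro emeasure_bounded_finite)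
  have fine_p: "\<exists>a b. a < b \<and> x \<in> {a..b} \<and> b - a < d \<and> (g b - g a) / (b - a) \<in> {..<p}" if "x \<in> E" "0 < d" for x d
    by (rule frequently_diff_quot_interval) (use E that in simp_all)
  have fine_q: "\<exists>a b. a < b \<and> x \<in> {a..b} \<and> b - a < d \<and> (g b - g a) / (b - a) \<in> {q<..}" if "x \<in> E \<inter> V" "0 < d" for x d V
    by (rule frequently_diff_quot_interval) (use E that in simp_all)
  have "q * enn2real (emeasure lborel E) \<le> p * enn2real (emeasure lborel E)"
  proof (rule field_le_epsilon)
    fix e :: real assume e: "e > 0"
    \<comment> \<open>An excess length of \<open>e / p\<close> costs only \<open>e\<close> after
      multiplication by \<open>p\<close>.\<close>
    have "E \<in> sets lebesgue" "0 < e / p" using e p0 by auto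
    then obtain U where U: "open U" "E \<subseteq> U" "U - E \<in> lmeasurable" "emeasure lebesgue (U - E) < ennreal (e / p)"
      by (rule sets_lebesgue_outer_open)
    have "emeasure lborel U = emeasure lborel (E \<union> (U - E))" using U by (simp add: Un_absorb1)
    also have "\<dots> \<le> emeasure lborel E + emeasure lborel (U - E)"
      using U by (intro emeasure_subadditive) auto
    also have "emeasure lborel (U - E) \<le> ennreal (e / p)" using U by simp
    finally have mU: "emeasure lborel U \<le> emeasure lborel E + ennreal (e / p)" by (simp add: add_left_mono)
    obtain C where C: "countable C" "disjoint_family_on (\<lambda>(a, b). {a..b}) C"
      "\<forall>a b. (a, b) \<in> C \<longrightarrow> a < b \<and> {a..b} \<subseteq> U \<and> (g b - g a) / (b - a) \<in> {..<p}"
      "negligible (E - (\<Union>(a, b)\<in>C. {a..b}))"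
      by (rule Vitali_covering_intervals[OF U(1,2), where Q = "\<lambda>a b. (g b - g a) / (b - a) \<in> {..<p}", OF fine_p])
    \<comment> \<open>The interiors form an open set inside which the second covering can be chosen;
      only countably many end points are lost.\<close>
    define V where "V = (\<Union>(a, b)\<in>C. {a<..<b})"
    have "open V" unfolding V_def by auto
    have "countable (fst ` C \<union> snd ` C)" using C(1) by simp
    then have "negligible (fst ` C \<union> snd ` C)"
      by (simp add: negligible_iff_null_sets countable_imp_null_set_lborel null_sets_completionI)
    then have "negligible ((E - (\<Union>(a, b)\<in>C. {a..b})) \<union> (fst ` C \<union> snd ` C))"
      using C(4) by (simp only: negligible_Un_eq)
    moreover have "E - V \<subseteq> (E - (\<Union>(a, b)\<in>C. {a..b})) \<union> (fst ` C \<union> snd ` C)"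
      unfolding V_def by (force simp: less_le)
    ultimately have EV: "negligible (E - V)" by (rule negligible_subset)
    obtain C' where C': "countable C'" "disjoint_family_on (\<lambda>(a, b). {a..b}) C'"
      "\<forall>a b. (a, b) \<in> C' \<longrightarrow> a < b \<and> {a..b} \<subseteq> V \<and> (g b - g a) / (b - a) \<in> {q<..}"
      "negligible (E \<inter> V - (\<Union>(a, b)\<in>C'. {a..b}))"
      by (rule Vitali_covering_intervals[OF \<open>open V\<close> Int_lower2, where Q = "\<lambda>a b. (g b - g a) / (b - a) \<in> {q<..}", OF fine_q])
    define W W' where "W = (\<Union>(a, b)\<in>C. {a..b})" and "W' = (\<Union>(a, b)\<in>C'. {a..b})"
    have [measurable]: "W \<in> sets borel" "W' \<in> sets borel"
      unfolding W_def W'_def by (auto intro!: sets.countable_UN' C(1) C'(1) simp: case_prod_unfold)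
    have "emeasure \<mu> W = (\<integral>\<^sup>+(a, b). emeasure \<mu> {a..b} \<partial>count_space C)"
      unfolding W_def by (rule union[OF _ C(1,2)]) simp
    also have "\<dots> \<le> (\<integral>\<^sup>+(a, b). ennreal p * emeasure lborel {a..b} \<partial>count_space C)"
    proof (intro nn_integral_mono, clarsimp)
      fix a b assume "(a, b) \<in> C"
      then have "a < b" "g b - g a \<le> p * (b - a)" using C(3)[rule_format, of a b] by (auto simp: divide_less_eq)
      then show "emeasure \<mu> {a..b} \<le> ennreal p * emeasure lborel {a..b}"
        using p0 by (simp add: \<mu> ennreal_leI flip: ennreal_mult)
    qed
    also have "\<dots> = ennreal p * emeasure lborel W"
      unfolding W_def by (subst union[OF _ C(1,2)]) (auto simp: case_prod_unfold nn_integral_cmult)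
    also have "\<dots> \<le> ennreal p * (emeasure lborel E + ennreal (e / p))"
      using C(3) U(1) unfolding W_def
      by (intro mult_left_mono order.trans[OF emeasure_mono mU]) auto
    finally have W: "emeasure \<mu> W \<le> ennreal p * (emeasure lborel E + ennreal (e / p))" .
    have "ennreal q * emeasure lborel W' = (\<integral>\<^sup>+(a, b). ennreal q * emeasure lborel {a..b} \<partial>count_space C')"
      unfolding W'_def by (subst union[OF _ C'(1,2)]) (auto simp: case_prod_unfold nn_integral_cmult)
    also have "\<dots> \<le> (\<integral>\<^sup>+(a, b). emeasure \<mu> {a..b} \<partial>count_space C')"
    proof (intro nn_integral_mono, clarsimp)
      fix a b assume "(a, b) \<in> C'"
      then have "a < b" "q * (b - a) \<le> g b - g a" using C'(3)[rule_format, of a b] by (auto simp: less_divide_eq)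
      then show "ennreal q * emeasure lborel {a..b} \<le> emeasure \<mu> {a..b}"
        using p0 pq by (simp add: \<mu> ennreal_leI flip: ennreal_mult)
    qed
    also have "\<dots> = emeasure \<mu> W'"
      unfolding W'_def by (rule union[OF _ C'(1,2), symmetric]) simp
    also have "\<dots> \<le> emeasure \<mu> W"
    proof (rule emeasure_mono)
      have "V \<subseteq> W" unfolding V_def W_def by (intro UN_mono) auto
      then show "W' \<subseteq> W" using C'(3) unfolding W'_def by blast
    qed simp
    finally have qW: "ennreal q * emeasure lborel W' \<le> ennreal p * (emeasure lborel E + ennreal (e / p))"
      using W by simp
    have "negligible (E - W')"
      by (rule negligible_subset[OF negligible_Un[OF EV C'(4)]]) (auto simp: W'_def)
    then have "E - W' \<in> null_sets lborel"
      by (simp add: negligible_iff_null_sets null_sets_completion_iff)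
    then have "emeasure lborel (E - W') = 0" by auto
    moreover have "emeasure lborel E \<le> emeasure lborel (E - W') + emeasure lborel W'"
      by (rule order.trans[OF emeasure_mono emeasure_subadditive]) auto
    ultimately have "ennreal q * emeasure lborel E \<le> ennreal q * emeasure lborel W'"
      by (intro mult_left_mono) auto
    also note qW
    finally have "ennreal q * emeasure lborel E \<le> ennreal p * (emeasure lborel E + ennreal (e / p))" .
    moreover obtain s where s: "emeasure lborel E = ennreal s" "s \<ge> 0"
      using fin_E by (metis infinity_ennreal_def less_top_ennreal)
    ultimately have "q * s \<le> p * (s + e / p)"
      using p0 pq e by (simp flip: ennreal_mult ennreal_plus)
    then show "q * enn2real (emeasure lborel E) \<le> p * enn2real (emeasure lborel E) + e"
      using s p0 by (simp add: algebra_simps)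
  qed
  then have "(q - p) * enn2real (emeasure lborel E) \<le> 0" by (simp add: algebra_simps)
  then have "enn2real (emeasure lborel E) = 0"
    using pq by (simp add: mult_le_0_iff order_antisym)
  then show ?thesis using fin_E by (auto simp: enn2real_eq_0_iff)
qed simp

section \<open>Measurability and almost sure existence of the derivative\<close>

lemma lipschitz_imp_continuous_on:
  fixes g :: "real \<Rightarrow> real"
  assumes "\<And>x y. \<bar>g x - g y\<bar> \<le> C * \<bar>x - y\<bar>"
  shows "continuous_on S g"
proof -
  have "0 \<le> C" using assms[of 1 0] abs_ge_zero[of "g 1 - g 0"] by simp
  then have "C-lipschitz_on S g" using assms by (intro lipschitz_onI) (auto simp: dist_real_def)
  then show ?thesis by (rule lipschitz_on_continuous_on)
qed

text \<open>Both the function and the point vary with a parameter, as they do when one coordinate of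
  the projection is differentiated at a random point.\<close>

lemma measurable_nondifferentiable:
  fixes f :: "'a \<Rightarrow> real \<Rightarrow> real"
  assumes mono: "\<And>y. mono (f y)" and lip: "\<And>y s t. \<bar>f y s - f y t\<bar> \<le> C * \<bar>s - t\<bar>"
    and meas: "\<And>r. (\<lambda>y. f y (x y + r)) \<in> borel_measurable M"
  shows "{y \<in> space M. \<nexists>D. DERIV (f y) (x y) :> D} \<in> sets M"
proof -
  have [measurable]: "(\<lambda>y. diff_quot (f y) (x y) r) \<in> borel_measurable M" for r
    unfolding diff_quot_def using meas[of r] meas[of 0] by simp
  have freq: "(\<exists>\<^sub>F r in at 0. diff_quot (f y) (x y) r < p) \<longleftrightarrow>
      (\<forall>m::nat. \<exists>r\<in>\<rat>. r \<noteq> 0 \<and> \<bar>r\<bar> < inverse (Suc m) \<and> diff_quot (f y) (x y) r < p)"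
    "(\<exists>\<^sub>F r in at 0. p < diff_quot (f y) (x y) r) \<longleftrightarrow>
      (\<forall>m::nat. \<exists>r\<in>\<rat>. r \<noteq> 0 \<and> \<bar>r\<bar> < inverse (Suc m) \<and> p < diff_quot (f y) (x y) r)" for p y
    using frequently_diff_quot_iff[OF lipschitz_imp_continuous_on[OF lip], of "{..<p}" y "x y"]
      frequently_diff_quot_iff[OF lipschitz_imp_continuous_on[OF lip], of "{p<..}" y "x y"] by auto
  have [measurable]: "countable (\<rat> :: real set)" by (rule countable_rat)
  have "{y \<in> space M. \<exists>p\<in>\<rat>. \<exists>q\<in>\<rat>. p < q \<and>
     (\<forall>m::nat. \<exists>r\<in>\<rat>. r \<noteq> 0 \<and> \<bar>r\<bar> < inverse (Suc m) \<and> diff_quot (f y) (x y) r < p) \<and>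
     (\<forall>m::nat. \<exists>r\<in>\<rat>. r \<noteq> 0 \<and> \<bar>r\<bar> < inverse (Suc m) \<and> q < diff_quot (f y) (x y) r)} \<in> sets M"
    by measurable
  then show ?thesis unfolding nondifferentiable_iff[OF mono lip] freq .
qed

text \<open>Where no derivative exists, \<open>deriv\<close> is the choice from the empty predicate,
  the same constant for every function and point. On the measurable complement it is a limit along
  the increments \<open>inverse (Suc j)\<close>.\<close>

lemma measurable_deriv:
  fixes f :: "'a \<Rightarrow> real \<Rightarrow> real"
  assumes mono: "\<And>y. mono (f y)" and lip: "\<And>y s t. \<bar>f y s - f y t\<bar> \<le> C * \<bar>s - t\<bar>"
    and meas: "\<And>r. (\<lambda>y. f y (x y + r)) \<in> borel_measurable M"
  shows "(\<lambda>y. deriv (f y) (x y)) \<in> borel_measurable M"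
proof -
  let ?N = "\<lambda>y. \<nexists>D. DERIV (f y) (x y) :> D"
  have [measurable]: "(\<lambda>y. diff_quot (f y) (x y) r) \<in> borel_measurable M" for r
    unfolding diff_quot_def using meas[of r] meas[of 0] by simp
  have [measurable]: "Measurable.pred M ?N"
    using measurable_nondifferentiable[OF assms] by (simp add: pred_def)
  have "deriv (f y) (x y) = (if ?N y then (SOME D :: real. False) else lim (\<lambda>j. diff_quot (f y) (x y) (inverse (Suc j))))" for y
  proof (cases "?N y")
    case True
    then show ?thesis by (simp add: deriv_def)
  next
    case False
    then obtain D where D: "DERIV (f y) (x y) :> D" by blast
    have "filterlim (\<lambda>j. inverse (real (Suc j))) (at 0) sequentially"
      unfolding filterlim_at using LIMSEQ_inverse_real_of_nat by auto
    then have "(\<lambda>j. diff_quot (f y) (x y) (inverse (Suc j))) \<longlonglongrightarrow> D"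
      using D[unfolded DERIV_diff_quot] by (rule filterlim_compose[rotated])
    then show ?thesis using False D by (simp add: DERIV_imp_deriv limI)
  qed
  then have "(\<lambda>y. deriv (f y) (x y)) = (\<lambda>y. if ?N y then (SOME D :: real. False) else lim (\<lambda>j. diff_quot (f y) (x y) (inverse (Suc j))))"
    by blast
  also have "\<dots> \<in> borel_measurable M" by measurable
  finally show ?thesis .
qed

text \<open>The exceptional set is a countable union of oscillation sets; the index \<open>k\<close>
  only serves to make each of them bounded.\<close>

lemma AE_differentiable_mono_lipschitz:
  fixes g :: "real \<Rightarrow> real"
  assumes mono: "mono g" and lip: "\<And>x y. \<bar>g x - g y\<bar> \<le> C * \<bar>x - y\<bar>"
  shows "AE x in lborel. \<exists>D. DERIV g x :> D"
proof -
  have cont: "continuous_on UNIV g" by (rule lipschitz_imp_continuous_on[OF lip])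
  then have [measurable]: "g \<in> borel_measurable borel" by (rule borel_measurable_continuous_onI)
  have [measurable]: "(\<lambda>x. diff_quot g x r) \<in> borel_measurable borel" for r
    unfolding diff_quot_def by measurable
  have freq: "(\<exists>\<^sub>F r in at 0. diff_quot g x r < p) \<longleftrightarrow>
      (\<forall>m::nat. \<exists>r\<in>\<rat>. r \<noteq> 0 \<and> \<bar>r\<bar> < inverse (Suc m) \<and> diff_quot g x r < p)"
    "(\<exists>\<^sub>F r in at 0. p < diff_quot g x r) \<longleftrightarrow>
      (\<forall>m::nat. \<exists>r\<in>\<rat>. r \<noteq> 0 \<and> \<bar>r\<bar> < inverse (Suc m) \<and> p < diff_quot g x r)" for p x
    using frequently_diff_quot_iff[OF cont, of "{..<p}" x] frequently_diff_quot_iff[OF cont, of "{p<..}" x] by auto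
  have [measurable]: "countable (\<rat> :: real set)" by (rule countable_rat)
  define E where "E p q k = {x. (\<exists>\<^sub>F r in at 0. diff_quot g x r < p) \<and> (\<exists>\<^sub>F r in at 0. q < diff_quot g x r) \<and> \<bar>x\<bar> \<le> real k}" for p q k
  have "AE x in lborel. x \<notin> E p q k" if "p < q" for p q k
  proof (rule AE_not_in)
    have E: "E p q k \<in> sets borel" unfolding E_def freq by measurable
    have "bounded (E p q k)"
      by (rule bounded_subset[OF bounded_cball[of 0 "real k"]]) (auto simp: E_def)
    then have "emeasure lborel (E p q k) = 0"
      by (intro oscillation_null_set[OF mono cont that E]) (auto simp: E_def)
    then show "E p q k \<in> null_sets lborel" using E by (simp add: null_sets_def)
  qed
  then have "AE x in lborel. \<forall>p\<in>\<rat>. \<forall>q\<in>\<rat>. p < q \<longrightarrow> (\<forall>k. x \<notin> E p q k)"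
    by (simp add: AE_ball_countable[OF countable_rat] AE_all_countable)
  then show ?thesis
  proof eventually_elim
    case (elim x)
    show ?case
    proof (rule ccontr)
      assume "\<nexists>D. DERIV g x :> D"
      then obtain p q where pq: "p \<in> \<rat>" "q \<in> \<rat>" "p < q"
        "\<exists>\<^sub>F r in at 0. diff_quot g x r < p" "\<exists>\<^sub>F r in at 0. q < diff_quot g x r"
        unfolding nondifferentiable_iff[OF mono lip] by blast
      obtain k where "\<bar>x\<bar> \<le> real k" using real_arch_simple by blast
      then show False using pq elim by (auto simp: E_def)
    qed
  qed
qed

subsection \<open>The one-dimensional Stein identity\<close>

lemma DERIV_std_normal_density: "DERIV std_normal_density x :> - x * std_normal_density x"
proof -
  have "DERIV (\<lambda>x. exp (- x\<^sup>2 / 2)) x :> exp (- x\<^sup>2 / 2) * - x"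
    by (auto intro!: derivative_eq_intros)
  from DERIV_cmult[OF this, of "1 / sqrt (2 * pi)"] show ?thesis
    unfolding std_normal_density_def[abs_def] by (simp add: ac_simps)
qed

text \<open>One Gaussian majorant for all shifts of size at most 1; it dominates the difference
  quotients in the Stein identity.\<close>

lemma std_normal_density_shift_le:
  assumes "\<bar>s\<bar> \<le> 1"
  shows "std_normal_density (x + s) \<le> 2 * exp (- x\<^sup>2 / 4)"
proof -
  have "x\<^sup>2 \<le> 2 * (x + s)\<^sup>2 + 2 * s\<^sup>2"
    using zero_le_power2[of "x + 2 * s"] by (simp add: power2_eq_square algebra_simps)
  moreover have "s\<^sup>2 \<le> 1" using assms by (simp add: abs_square_le_1)
  ultimately have "- (x + s)\<^sup>2 / 2 \<le> 1/2 + - x\<^sup>2 / 4" by (simp add: field_simps)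
  then have "exp (- (x + s)\<^sup>2 / 2) \<le> exp (1/2 + - x\<^sup>2 / 4)" by simp
  also have "\<dots> = exp (1/2) * exp (- x\<^sup>2 / 4)" by (rule exp_add)
  also have "exp (1/2) \<le> (2::real)" using exp_bound_half[of "1/2::real"] by simp
  finally have "exp (- (x + s)\<^sup>2 / 2) \<le> 2 * exp (- x\<^sup>2 / 4)" by simp
  moreover have "1 / sqrt (2 * pi) \<le> 1" using pi_ge_two by simp
  ultimately have "1 / sqrt (2 * pi) * exp (- (x + s)\<^sup>2 / 2) \<le> 1 * (2 * exp (- x\<^sup>2 / 4))"
    by (intro mult_mono) auto
  then show ?thesis by (simp add: std_normal_density_def)
qed

lemma integrable_quadratic_gaussian: "integrable lborel (\<lambda>x::real. (1 + \<bar>x\<bar>)\<^sup>2 * exp (- x\<^sup>2 / 4))"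
proof -
  have nd: "normal_density 0 (sqrt 2) x = 1 / sqrt (4 * pi) * exp (- x\<^sup>2 / 4)" for x
    by (simp add: normal_density_def)
  have "integrable lborel (\<lambda>x. normal_density 0 (sqrt 2) x * \<bar>x - 0\<bar> ^ k)" for k
    by (rule integrable_normal_moment_abs) simp
  from integrable_mult_right[OF this, of "sqrt (4 * pi)"]
  have *: "integrable lborel (\<lambda>x::real. exp (- x\<^sup>2 / 4) * \<bar>x\<bar> ^ k)" for k
    unfolding nd by (simp add: mult.assoc[symmetric])
  have "integrable lborel (\<lambda>x::real. exp (- x\<^sup>2 / 4) * \<bar>x\<bar> ^ 0 + 2 * (exp (- x\<^sup>2 / 4) * \<bar>x\<bar> ^ 1) + exp (- x\<^sup>2 / 4) * \<bar>x\<bar> ^ 2)"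
    by (intro Bochner_Integration.integrable_add integrable_mult_right *)
  also have "(\<lambda>x::real. exp (- x\<^sup>2 / 4) * \<bar>x\<bar> ^ 0 + 2 * (exp (- x\<^sup>2 / 4) * \<bar>x\<bar> ^ 1) + exp (- x\<^sup>2 / 4) * \<bar>x\<bar> ^ 2)
    = (\<lambda>x. (1 + \<bar>x\<bar>)\<^sup>2 * exp (- x\<^sup>2 / 4))"
    by (rule ext) (simp add: power2_eq_square algebra_simps)
  finally show ?thesis .
qed

text \<open>Integration by parts through translation invariance: for \<open>u = g * density\<close>
  every difference quotient has integral 0. As the increment shrinks, the quotients converge almost
  everywhere to the derivative \<open>f\<close> of \<open>u\<close>, dominated by \<open>w\<close>,
  so \<open>f\<close> has integral 0 as well.\<close>

lemma std_normal_stein: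
  fixes g :: "real \<Rightarrow> real"
  assumes mono: "mono g" and lip: "\<And>x y. \<bar>g x - g y\<bar> \<le> C * \<bar>x - y\<bar>"
  shows "AE x in std_normal_distribution. \<bar>deriv g x\<bar> \<le> C"
    and "(\<integral>x. x * g x \<partial>std_normal_distribution) = (\<integral>x. deriv g x \<partial>std_normal_distribution)"
proof -
  let ?\<phi> = std_normal_density
  have C0: "C \<ge> 0" using lip[of 1 0] abs_ge_zero[of "g 1 - g 0"] by simp
  have cont: "continuous_on UNIV g" by (rule lipschitz_imp_continuous_on[OF lip])
  then have [measurable]: "g \<in> borel_measurable borel" by (rule borel_measurable_continuous_onI)
  have [measurable]: "deriv g \<in> borel_measurable borel"
    using measurable_deriv[OF mono lip, of "\<lambda>x. x" borel] by simp
  have diff: "AE x in lborel. DERIV g x :> deriv g x"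
    using AE_differentiable_mono_lipschitz[OF mono lip]
    by eventually_elim (auto simp: DERIV_imp_deriv)
  have bd: "AE x in lborel. \<bar>deriv g x\<bar> \<le> C"
    using diff
  proof eventually_elim
    case (elim x)
    then have "(diff_quot g x \<longlongrightarrow> deriv g x) (at 0)" by (simp add: DERIV_diff_quot)
    then have "((\<lambda>r. \<bar>diff_quot g x r\<bar>) \<longlongrightarrow> \<bar>deriv g x\<bar>) (at 0)" by (rule tendsto_rabs)
    moreover have "\<bar>diff_quot g x r\<bar> \<le> C" if "r \<noteq> 0" for r
      using lip[of "x + r" x] that by (simp add: diff_quot_def abs_divide divide_le_eq)
    then have "\<forall>\<^sub>F r in at 0. \<bar>diff_quot g x r\<bar> \<le> C" by (simp add: eventually_at_filter)
    ultimately show ?case by (rule tendsto_upperbound) simp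
  qed
  then show "AE x in std_normal_distribution. \<bar>deriv g x\<bar> \<le> C"
    by (simp add: AE_density) (auto elim: eventually_mono)
  define u where "u x = g x * ?\<phi> x" for x
  \<comment> \<open>In the bound on the increment of \<open>u\<close>, the increment of
    \<open>g\<close> contributes \<open>2 * C\<close> and that of the density
    \<open>2 * \<bar>g 0\<bar> + 2 * C\<close>.\<close>
  define K where "K = 4 * C + 2 * \<bar>g 0\<bar>"
  define w where "w x = K * ((1 + \<bar>x\<bar>)\<^sup>2 * exp (- x\<^sup>2 / 4))" for x
  have [measurable]: "u \<in> borel_measurable borel" "w \<in> borel_measurable borel"
    unfolding u_def w_def by measurable
  have w: "integrable lborel w"
    unfolding w_def by (intro integrable_mult_right integrable_quadratic_gaussian)
  have g_le: "\<bar>g x\<bar> \<le> \<bar>g 0\<bar> + C * \<bar>x\<bar>" for x using lip[of x 0] by simp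
  have g_le': "\<bar>g x\<bar> \<le> (\<bar>g 0\<bar> + C) * (1 + \<bar>x\<bar>)" for x
  proof -
    have "0 \<le> C + \<bar>g 0\<bar> * \<bar>x\<bar>" using C0 by simp
    then show ?thesis using g_le[of x] by (simp add: algebra_simps)
  qed
  have e1: "exp (- x\<^sup>2 / 4) \<le> (1 + \<bar>x\<bar>)\<^sup>2 * exp (- x\<^sup>2 / 4)" for x :: real
  proof -
    have "1\<^sup>2 \<le> (1 + \<bar>x\<bar>)\<^sup>2" by (intro power_mono) auto
    then show ?thesis using mult_right_mono[of 1 "(1 + \<bar>x\<bar>)\<^sup>2" "exp (- x\<^sup>2 / 4)"] by simp
  qed
  have xg: "\<bar>g x * (x * ?\<phi> x)\<bar> \<le> w x" for x
  proof -
    have "\<bar>g x * (x * ?\<phi> x)\<bar> = \<bar>g x\<bar> * (\<bar>x\<bar> * ?\<phi> x)" by (simp add: abs_mult)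
    also have "\<dots> \<le> ((\<bar>g 0\<bar> + C) * (1 + \<bar>x\<bar>)) * ((1 + \<bar>x\<bar>) * (2 * exp (- x\<^sup>2 / 4)))"
      using g_le'[of x] std_normal_density_shift_le[of 0 x] C0 by (intro mult_mono) auto
    also have "\<dots> = (2 * \<bar>g 0\<bar> + 2 * C) * ((1 + \<bar>x\<bar>)\<^sup>2 * exp (- x\<^sup>2 / 4))"
      by (simp add: power2_eq_square algebra_simps)
    also have "\<dots> \<le> w x" unfolding w_def K_def using C0 by (intro mult_right_mono) auto
    finally show ?thesis .
  qed
  have "\<bar>u x\<bar> \<le> w x" for x
  proof -
    have "\<bar>u x\<bar> = \<bar>g x\<bar> * (1 * ?\<phi> x)" by (simp add: u_def abs_mult)
    also have "\<dots> \<le> ((\<bar>g 0\<bar> + C) * (1 + \<bar>x\<bar>)) * ((1 + \<bar>x\<bar>) * (2 * exp (- x\<^sup>2 / 4)))"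
      using g_le'[of x] std_normal_density_shift_le[of 0 x] C0 by (intro mult_mono) auto
    also have "\<dots> = (2 * \<bar>g 0\<bar> + 2 * C) * ((1 + \<bar>x\<bar>)\<^sup>2 * exp (- x\<^sup>2 / 4))"
      by (simp add: power2_eq_square algebra_simps)
    also have "\<dots> \<le> w x" unfolding w_def K_def using C0 by (intro mult_right_mono) auto
    finally show ?thesis .
  qed
  then have u: "integrable lborel u"
    by (intro Bochner_Integration.integrable_bound[OF w]) (auto intro!: AE_I2 intro: order.trans[OF _ abs_ge_self])
  have q_le: "\<bar>diff_quot u x t\<bar> \<le> w x" if t: "0 < t" "t \<le> 1" for x t
  proof -
    obtain z where z: "x < z" "z < x + t" "?\<phi> (x + t) - ?\<phi> x = (x + t - x) * (- z * ?\<phi> z)"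
      using MVT2[of x "x + t" ?\<phi> "\<lambda>z. - z * ?\<phi> z"] DERIV_std_normal_density t by auto
    have "?\<phi> z \<le> 2 * exp (- x\<^sup>2 / 4)"
      using std_normal_density_shift_le[of "z - x" x] z t by simp
    moreover have "\<bar>z\<bar> \<le> 1 + \<bar>x\<bar>" using z t by simp
    ultimately have zz: "\<bar>z\<bar> * ?\<phi> z \<le> (1 + \<bar>x\<bar>) * (2 * exp (- x\<^sup>2 / 4))"
      by (intro mult_mono) auto
    have "u (x + t) - u x = (g (x + t) - g x) * ?\<phi> (x + t) + g x * (?\<phi> (x + t) - ?\<phi> x)"
      by (simp add: u_def algebra_simps)
    then have "\<bar>u (x + t) - u x\<bar> \<le> \<bar>g (x + t) - g x\<bar> * ?\<phi> (x + t) + \<bar>g x\<bar> * (t * (\<bar>z\<bar> * ?\<phi> z))"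
      unfolding z(3) using t by (auto intro!: order.trans[OF abs_triangle_ineq4] simp: abs_mult)
    also have "\<dots> \<le> (C * t) * (2 * exp (- x\<^sup>2 / 4)) + ((\<bar>g 0\<bar> + C) * (1 + \<bar>x\<bar>)) * (t * ((1 + \<bar>x\<bar>) * (2 * exp (- x\<^sup>2 / 4))))"
    proof (rule add_mono[OF mult_mono mult_mono])
      show "t * (\<bar>z\<bar> * ?\<phi> z) \<le> t * ((1 + \<bar>x\<bar>) * (2 * exp (- x\<^sup>2 / 4)))"
        using zz t by (intro mult_left_mono) auto
    qed (use lip[of "x + t" x] std_normal_density_shift_le[of t x] g_le'[of x] t C0 in auto)
    also have "\<dots> = t * (2 * C * exp (- x\<^sup>2 / 4) + (2 * \<bar>g 0\<bar> + 2 * C) * ((1 + \<bar>x\<bar>)\<^sup>2 * exp (- x\<^sup>2 / 4)))"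
      by (simp add: power2_eq_square algebra_simps)
    also have "\<dots> \<le> t * (2 * C * ((1 + \<bar>x\<bar>)\<^sup>2 * exp (- x\<^sup>2 / 4)) + (2 * \<bar>g 0\<bar> + 2 * C) * ((1 + \<bar>x\<bar>)\<^sup>2 * exp (- x\<^sup>2 / 4)))"
      using t C0 by (intro mult_left_mono add_right_mono e1) auto
    also have "\<dots> = t * w x" by (simp add: w_def K_def algebra_simps)
    finally have "\<bar>u (x + t) - u x\<bar> / t \<le> w x" using t by (simp add: divide_le_eq mult.commute)
    then show ?thesis using t by (simp add: diff_quot_def abs_divide)
  qed
  define f where "f x = ?\<phi> x * deriv g x - g x * (x * ?\<phi> x)" for x
  have lim: "(\<lambda>j. \<integral>x. diff_quot u x (inverse (Suc j)) \<partial>lborel) \<longlonglongrightarrow> (\<integral>x. f x \<partial>lborel)"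
  proof (rule integral_dominated_convergence[OF _ _ w])
    show "AE x in lborel. (\<lambda>j. diff_quot u x (inverse (Suc j))) \<longlonglongrightarrow> f x"
      using diff
    proof eventually_elim
      case (elim x)
      have "DERIV u x :> f x"
        unfolding u_def f_def using elim
        by (auto intro!: derivative_eq_intros DERIV_std_normal_density simp: algebra_simps)
      moreover have "filterlim (\<lambda>j. inverse (real (Suc j))) (at 0) sequentially"
        unfolding filterlim_at using LIMSEQ_inverse_real_of_nat by auto
      ultimately show ?case unfolding DERIV_diff_quot by (rule filterlim_compose)
    qed
    show "AE x in lborel. norm (diff_quot u x (inverse (Suc j))) \<le> w x" for j
      by (intro AE_I2) (simp add: q_le inverse_le_1_iff del: of_nat_Suc)
  qed (unfold f_def diff_quot_def, measurable)
  have "(\<integral>x. diff_quot u x t \<partial>lborel) = 0" for t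
  proof -
    have "integrable lborel (\<lambda>x. u (t + 1 * x))" by (rule lborel_integrable_real_affine[OF u]) simp
    moreover have "(\<integral>x. u x \<partial>lborel) = (\<integral>x. u (t + 1 * x) \<partial>lborel)"
      using lborel_integral_real_affine[of 1 u t] by simp
    ultimately show ?thesis using u by (simp add: diff_quot_def add.commute)
  qed
  then have f0: "(\<integral>x. f x \<partial>lborel) = 0"
    using lim by (simp add: LIMSEQ_const_iff)
  have i1: "integrable lborel (\<lambda>x. ?\<phi> x * deriv g x)"
  proof (rule Bochner_Integration.integrable_bound[where f = "\<lambda>x. C * ?\<phi> x"])
    show "AE x in lborel. norm (?\<phi> x * deriv g x) \<le> norm (C * ?\<phi> x)"
      using bd
    proof eventually_elim
      case (elim x)
      then show ?case using C0 mult_left_mono[OF elim, of "?\<phi> x"] by (simp add: abs_mult mult.commute)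
    qed
  qed auto
  have i2: "integrable lborel (\<lambda>x. g x * (x * ?\<phi> x))"
    by (rule Bochner_Integration.integrable_bound[OF w])
       (use xg in \<open>auto intro!: AE_I2 intro: order.trans[OF _ abs_ge_self]\<close>)
  have "(\<integral>x. x * g x \<partial>std_normal_distribution) = (\<integral>x. g x * (x * ?\<phi> x) \<partial>lborel)"
    by (subst integral_density) (auto simp: ac_simps)
  also have "\<dots> = (\<integral>x. ?\<phi> x * deriv g x \<partial>lborel)"
    using f0 i1 i2 unfolding f_def by simp
  also have "\<dots> = (\<integral>x. deriv g x \<partial>std_normal_distribution)"
    by (subst integral_density) auto
  finally show "(\<integral>x. x * g x \<partial>std_normal_distribution) = (\<integral>x. deriv g x \<partial>std_normal_distribution)" .
qed

text \<open>Differentiability is known for \<open>G\<close> at almost every z, and \<open>f\<close>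
  is recovered from \<open>G\<close> by the inverse affine map. The chain rule in this direction
  works in the variable z throughout, so no null set has to be transported.\<close>

lemma std_normal_stein_affine:
  fixes f :: "real \<Rightarrow> real"
  assumes mono: "mono f" and lip: "\<And>x y. \<bar>f x - f y\<bar> \<le> 1 * \<bar>x - y\<bar>" and s: "\<sigma> > 0"
  shows "AE z in std_normal_distribution. \<bar>deriv f (b + \<sigma> * z)\<bar> \<le> 1"
    and "(\<integral>z. z * (f (b + \<sigma> * z) - a) \<partial>std_normal_distribution) = \<sigma> * (\<integral>z. deriv f (b + \<sigma> * z) \<partial>std_normal_distribution)"
proof -
  define G where "G z = f (b + \<sigma> * z) - a" for z
  have monoG: "mono G"
    unfolding G_def using s by (intro monoI diff_right_mono monoD[OF mono] add_left_mono mult_left_mono) auto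
  have lipG: "\<bar>G x - G y\<bar> \<le> \<sigma> * \<bar>x - y\<bar>" for x y
  proof -
    have "\<bar>G x - G y\<bar> \<le> \<bar>\<sigma> * (x - y)\<bar>"
      using lip[of "b + \<sigma> * x" "b + \<sigma> * y"] by (simp add: G_def right_diff_distrib)
    then show ?thesis using s by (simp add: abs_mult)
  qed
  have contf: "continuous_on UNIV f" by (rule lipschitz_imp_continuous_on[OF lip])
  then have [measurable]: "f \<in> borel_measurable borel" by (rule borel_measurable_continuous_onI)
  have [measurable]: "(\<lambda>z. deriv f (b + \<sigma> * z)) \<in> borel_measurable borel"
    by (rule measurable_deriv[OF mono lip]) simp
  have [measurable]: "G \<in> borel_measurable borel" unfolding G_def by measurable
  have [measurable]: "deriv G \<in> borel_measurable borel"
    using measurable_deriv[OF monoG lipG, of "\<lambda>x. x" borel] by simp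
  have eq: "AE z in std_normal_distribution. deriv G z = \<sigma> * deriv f (b + \<sigma> * z)"
  proof -
    have "AE z in lborel. deriv G z = \<sigma> * deriv f (b + \<sigma> * z)"
      using AE_differentiable_mono_lipschitz[OF monoG lipG]
    proof eventually_elim
      case (elim z)
      then obtain D where D: "DERIV G z :> D" by blast
      have "((\<lambda>t. (t - b) / \<sigma>) has_real_derivative 1 / \<sigma>) (at (b + \<sigma> * z))"
        using s by (auto intro!: derivative_eq_intros)
      moreover have "DERIV G ((b + \<sigma> * z - b) / \<sigma>) :> D" using D s by simp
      ultimately have "((\<lambda>t. G ((t - b) / \<sigma>)) has_real_derivative D * (1 / \<sigma>)) (at (b + \<sigma> * z))"
        by (rule DERIV_chain2[rotated])
      then have "((\<lambda>t. G ((t - b) / \<sigma>) + a) has_real_derivative D * (1 / \<sigma>) + 0) (at (b + \<sigma> * z))"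
        by (intro DERIV_add DERIV_const)
      moreover have "(\<lambda>t. G ((t - b) / \<sigma>) + a) = f" using s by (simp add: G_def)
      ultimately have "deriv f (b + \<sigma> * z) = D / \<sigma>" by (simp add: DERIV_imp_deriv)
      then show ?case using D s by (simp add: DERIV_imp_deriv)
    qed
    then show ?thesis by (simp add: AE_density) (auto elim: eventually_mono)
  qed
  show "AE z in std_normal_distribution. \<bar>deriv f (b + \<sigma> * z)\<bar> \<le> 1"
    using std_normal_stein(1)[OF monoG lipG] eq
    by eventually_elim (use s in \<open>auto simp: abs_mult\<close>)
  have "(\<integral>z. z * (f (b + \<sigma> * z) - a) \<partial>std_normal_distribution) = (\<integral>z. z * G z \<partial>std_normal_distribution)"
    by (simp add: G_def)
  also have "\<dots> = (\<integral>z. deriv G z \<partial>std_normal_distribution)"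
    by (rule std_normal_stein(2)[OF monoG lipG])
  also have "\<dots> = (\<integral>z. \<sigma> * deriv f (b + \<sigma> * z) \<partial>std_normal_distribution)"
    by (intro integral_cong_AE eq) auto
  finally show "(\<integral>z. z * (f (b + \<sigma> * z) - a) \<partial>std_normal_distribution) = \<sigma> * (\<integral>z. deriv f (b + \<sigma> * z) \<partial>std_normal_distribution)"
    by simp
qed

subsection \<open>Concentration of locally Lipschitz functions\<close>

lemma measurable_zero_extension:
  "(\<lambda>x i. if i < n then x i else 0) \<in> measurable (PiM {..<n} (\<lambda>_. std_normal_distribution)) (borel :: (nat \<Rightarrow> real) measure)"
proof (rule measurable_coordinatewise_then_product)
  fix i
  show "(\<lambda>x. if i < n then x i else 0) \<in> borel_measurable (PiM {..<n} (\<lambda>_. std_normal_distribution))"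
  proof (cases "i < n")
    case True
    then have "(\<lambda>x. x i) \<in> measurable (PiM {..<n} (\<lambda>_. std_normal_distribution)) std_normal_distribution"
      by (intro measurable_component_singleton) auto
    then show ?thesis using True by simp
  qed simp
qed

lemma space_std_gaussian [simp]: "space (std_gaussian n) = UNIV"
  and sets_std_gaussian [simp, measurable_cong]: "sets (std_gaussian n) = sets borel"
  by (simp_all add: std_gaussian_def)

lemma prob_space_std_gaussian: "prob_space (std_gaussian n)"
  unfolding std_gaussian_def
  by (intro prob_space.prob_space_distr prob_space_PiM prob_space_normal_density measurable_zero_extension) simp

lemma gaussian_tau:
  assumes [measurable]: "A \<in> borel_measurable borel" "B \<in> borel_measurable borel"
    and AB: "\<And>x y. A x * B y \<le> ennreal (exp ((norm_n n (x - y))\<^sup>2 / 4))"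
  shows "(\<integral>\<^sup>+x. A x \<partial>std_gaussian n) * (\<integral>\<^sup>+x. B x \<partial>std_gaussian n) \<le> 1"
proof -
  note [measurable] = measurable_zero_extension[of n]
  let ?e = "\<lambda>x i. if i < n then x i else 0 :: real"
  have "(\<integral>\<^sup>+x. A (?e x) \<partial>PiM {..<n} (\<lambda>_. std_normal_distribution)) *
    (\<integral>\<^sup>+x. B (?e x) \<partial>PiM {..<n} (\<lambda>_. std_normal_distribution)) \<le> 1"
  proof (rule gaussian_tau_PiM)
    fix x y :: "nat \<Rightarrow> real"
    have "(norm_n n (?e x - ?e y))\<^sup>2 = (\<Sum>i<n. (x i - y i)\<^sup>2)"
      unfolding norm_n_sq inner_n_def by (intro sum.cong) (auto simp: power2_eq_square)
    then show "A (?e x) * B (?e y) \<le> ennreal (exp ((\<Sum>i<n. (x i - y i)\<^sup>2) / 4))"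
      using AB[of "?e x" "?e y"] by simp
  qed (simp, measurable)
  then show ?thesis
    unfolding std_gaussian_def by (simp add: nn_integral_distr)
qed

text \<open>Integrability is a conclusion: both integrals are nonzero because exp is positive, and a
  product at most 1 of nonzero factors has no infinite factor.\<close>

lemma gaussian_tau_exp:
  assumes [measurable]: "X \<in> borel_measurable borel" "Y \<in> borel_measurable borel"
    and XY: "\<And>x y. X x + Y y \<le> (norm_n n (x - y))\<^sup>2 / 4"
  shows "integrable (std_gaussian n) (\<lambda>x. exp (X x))" (is ?A)
    and "integrable (std_gaussian n) (\<lambda>x. exp (Y x))" (is ?B)
    and "(\<integral>x. exp (X x) \<partial>std_gaussian n) * (\<integral>x. exp (Y x) \<partial>std_gaussian n) \<le> 1" (is ?C)
proof -
  interpret prob_space "std_gaussian n" by (rule prob_space_std_gaussian)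
  have le1: "(\<integral>\<^sup>+x. ennreal (exp (X x)) \<partial>std_gaussian n) * (\<integral>\<^sup>+x. ennreal (exp (Y x)) \<partial>std_gaussian n) \<le> 1"
  proof (rule gaussian_tau)
    fix x y
    have "ennreal (exp (X x)) * ennreal (exp (Y y)) = ennreal (exp (X x + Y y))"
      by (simp add: exp_add ennreal_mult)
    also have "\<dots> \<le> ennreal (exp ((norm_n n (x - y))\<^sup>2 / 4))"
      by (intro ennreal_leI iffD2[OF exp_le_cancel_iff] XY)
    finally show "ennreal (exp (X x)) * ennreal (exp (Y y)) \<le> ennreal (exp ((norm_n n (x - y))\<^sup>2 / 4))" .
  qed auto
  have pos: "(\<integral>\<^sup>+x. ennreal (exp (Z x)) \<partial>std_gaussian n) \<noteq> 0"
    if [measurable]: "Z \<in> borel_measurable borel" for Z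
    by (subst nn_integral_0_iff_AE) (auto simp: AE_False)
  have fin: "(\<integral>\<^sup>+x. ennreal (exp (X x)) \<partial>std_gaussian n) < \<infinity>" "(\<integral>\<^sup>+x. ennreal (exp (Y x)) \<partial>std_gaussian n) < \<infinity>"
    using le1 pos[of X] pos[of Y] by (auto simp: less_top[symmetric] ennreal_mult_top ennreal_top_mult top_unique)
  show ?A ?B using fin by (simp_all add: integrable_iff_bounded)
  then show ?C using le1
    by (simp add: nn_integral_eq_integral flip: ennreal_mult)
qed

section \<open>Moments of the Gaussian norm\<close>

lemma measurable_coordinate [measurable]: "(\<lambda>x::nat \<Rightarrow> real. x i) \<in> borel_measurable borel"
  by (intro borel_measurable_continuous_onI continuous_on_product_coordinates)

lemma measurable_norm_n [measurable]: "norm_n n \<in> borel_measurable borel"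
proof -
  show ?thesis unfolding norm_n_def[abs_def] L2_set_def by measurable
qed

lemma integrable_exp_norm: "integrable (std_gaussian n) (\<lambda>x. exp ((norm_n n x)\<^sup>2 / 8))"
proof (rule gaussian_tau_exp(1)[where Y = "\<lambda>x. - (norm_n n x)\<^sup>2 / 4"])
  fix x y
  have "(norm_n n x)\<^sup>2 \<le> (norm_n n y + norm_n n (x - y))\<^sup>2"
    by (intro power_mono norm_n_triangle_sub) simp
  also have "\<dots> \<le> 2 * (norm_n n y)\<^sup>2 + 2 * (norm_n n (x - y))\<^sup>2"
    using zero_le_power2[of "norm_n n y - norm_n n (x - y)"] by (simp add: power2_sum power2_diff)
  finally show "(norm_n n x)\<^sup>2 / 8 + - (norm_n n y)\<^sup>2 / 4 \<le> (norm_n n (x - y))\<^sup>2 / 4"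
    by simp
qed measurable

lemma exp_ge_sq_half: "0 \<le> x \<Longrightarrow> x\<^sup>2 / 2 \<le> exp (x::real)"
  using exp_lower_Taylor_quadratic[of x] by linarith

lemma integrable_norm_pow2: "integrable (std_gaussian n) (\<lambda>x. (norm_n n x)\<^sup>2)"
proof (rule Bochner_Integration.integrable_bound[OF integrable_mult_right[OF integrable_exp_norm, where c = 8]])
  show "AE x in std_gaussian n. norm ((norm_n n x)\<^sup>2) \<le> norm (8 * exp ((norm_n n x)\<^sup>2 / 8))"
  proof (intro AE_I2)
    fix x
    have "(norm_n n x)\<^sup>2 / 8 \<le> exp ((norm_n n x)\<^sup>2 / 8)"
      using exp_ge_add_one_self[of "(norm_n n x)\<^sup>2 / 8"] by linarith
    then show "norm ((norm_n n x)\<^sup>2) \<le> norm (8 * exp ((norm_n n x)\<^sup>2 / 8))" by simp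
  qed
qed auto

lemma integrable_norm_pow4: "integrable (std_gaussian n) (\<lambda>x. ((norm_n n x)\<^sup>2)\<^sup>2)"
proof (rule Bochner_Integration.integrable_bound[OF integrable_mult_right[OF integrable_exp_norm, where c = 128]])
  show "AE x in std_gaussian n. norm (((norm_n n x)\<^sup>2)\<^sup>2) \<le> norm (128 * exp ((norm_n n x)\<^sup>2 / 8))"
  proof (intro AE_I2)
    fix x
    show "norm (((norm_n n x)\<^sup>2)\<^sup>2) \<le> norm (128 * exp ((norm_n n x)\<^sup>2 / 8))"
      using exp_ge_sq_half[of "(norm_n n x)\<^sup>2 / 8"] by (simp add: power_divide)
  qed
qed auto

text \<open>The quadratic Taylor polynomial is no lower bound for x < 0; the cubic one is, since the
  remainder has even order 4.\<close>

lemma exp_ge_cubic: "1 + x + x\<^sup>2 / 2 + x ^ 3 / 6 \<le> exp (x::real)"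
proof -
  obtain t where "exp x = (\<Sum>m<4. x ^ m / fact m) + exp t / fact 4 * x ^ 4"
    using Maclaurin_exp_le[of x 4] by blast
  moreover have "0 \<le> exp t / fact 4 * x ^ 4" by simp
  moreover have "(\<Sum>m<4. x ^ m / fact m) = 1 + x + x\<^sup>2 / 2 + x ^ 3 / 6"
    by (simp add: eval_nat_numeral)
  ultimately show ?thesis by linarith
qed

section \<open>Variance and tails from a local Lipschitz bound\<close>

text \<open>The local constant \<open>2 * \<nu>\<close> itself moves between x and y, which the
  quadratic term in \<open>f_lipschitz\<close> accounts for. The two growth bounds give the
  integrability of \<open>f\<close>, of its square and of \<open>\<nu>\<^sup>2\<close>.\<close>

locale gaussian_local_lipschitz =
  fixes n :: nat and f \<nu> :: "(nat \<Rightarrow> real) \<Rightarrow> real"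
  assumes measurable_f [measurable]: "f \<in> borel_measurable borel"
    and measurable_nu [measurable]: "\<nu> \<in> borel_measurable borel"
    and nu_nonneg: "0 \<le> \<nu> x"
    and nu_lipschitz: "\<nu> x \<le> \<nu> y + norm_n n (x - y)"
    and f_lipschitz: "\<bar>f x - f y\<bar> \<le> 2 * \<nu> x * norm_n n (x - y) + 2 * (norm_n n (x - y))\<^sup>2"
    and f_bound: "\<bar>f x\<bar> \<le> (norm_n n x)\<^sup>2"
    and nu_bound: "\<nu> x \<le> norm_n n x"
begin

sublocale prob_space "std_gaussian n" by (rule prob_space_std_gaussian)

lemma prob_UNIV [simp]: "prob UNIV = 1"
  using prob_space by simp

definition V :: real where "V = expectation (\<lambda>x. (\<nu> x)\<^sup>2)"

definition fbar :: "(nat \<Rightarrow> real) \<Rightarrow> real" where "fbar x = f x - expectation f"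

lemma measurable_fbar [measurable]: "fbar \<in> borel_measurable borel"
  unfolding fbar_def by measurable

lemma integrable_f: "integrable (std_gaussian n) f"
  by (rule Bochner_Integration.integrable_bound[OF integrable_norm_pow2[of n]])
     (auto simp: f_bound intro!: AE_I2)

lemma integrable_nu2: "integrable (std_gaussian n) (\<lambda>x. (\<nu> x)\<^sup>2)"
  by (rule Bochner_Integration.integrable_bound[OF integrable_norm_pow2[of n]])
     (auto intro!: AE_I2 power_mono nu_bound nu_nonneg)

lemma integrable_f2: "integrable (std_gaussian n) (\<lambda>x. (f x)\<^sup>2)"
proof (rule Bochner_Integration.integrable_bound[OF integrable_norm_pow4[of n]])
  show "AE x in std_gaussian n. norm ((f x)\<^sup>2) \<le> norm (((norm_n n x)\<^sup>2)\<^sup>2)"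
  proof (intro AE_I2)
    fix x
    show "norm ((f x)\<^sup>2) \<le> norm (((norm_n n x)\<^sup>2)\<^sup>2)"
      using power_mono[OF f_bound[of x], of 2] by simp
  qed
qed auto

lemma integrable_fbar: "integrable (std_gaussian n) fbar"
  unfolding fbar_def using integrable_f by simp

lemma expectation_fbar: "expectation fbar = 0"
  unfolding fbar_def using integrable_f by (simp add: prob_space)

lemma integrable_fbar2: "integrable (std_gaussian n) (\<lambda>x. (fbar x)\<^sup>2)"
proof -
  have "(\<lambda>x. (fbar x)\<^sup>2) = (\<lambda>x. (f x)\<^sup>2 - 2 * expectation f * f x + (expectation f)\<^sup>2)"
    by (auto simp: fbar_def power2_diff algebra_simps)
  then show ?thesis using integrable_f integrable_f2 by simp
qed

lemma V_nonneg: "0 \<le> V"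
  unfolding V_def by simp

lemma expectation_exp_ge_1:
  fixes X :: "(nat \<Rightarrow> real) \<Rightarrow> real"
  assumes "integrable (std_gaussian n) X" "integrable (std_gaussian n) (\<lambda>x. exp (X x))"
  shows "1 + expectation X \<le> expectation (\<lambda>x. exp (X x))"
proof -
  have "expectation (\<lambda>x. 1 + X x) \<le> expectation (\<lambda>x. exp (X x))"
    using assms by (intro Bochner_Integration.integral_mono) auto
  then show ?thesis using assms by (simp add: prob_space)
qed

text \<open>The constant is the one for which \<open>2 \<epsilon> \<nu> r - c \<nu>\<^sup>2 \<le> (1/4 - 2 \<epsilon>) r\<^sup>2\<close> holds for all \<open>r\<close>.\<close>

definition c :: "real \<Rightarrow> real" where "c \<epsilon> = \<epsilon>\<^sup>2 / (1/4 - 2 * \<epsilon>)"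

lemma tau_fbar:
  assumes e: "0 < \<epsilon>" "\<epsilon> < 1/8"
  shows "(\<epsilon> * fbar x - c \<epsilon> * (\<nu> x)\<^sup>2) + (- (\<epsilon> * fbar y)) \<le> (norm_n n (x - y))\<^sup>2 / 4"
proof -
  \<comment> \<open>\<open>k\<close> is what the cost 1/4 retains after paying for the quadratic
    term of \<open>f_lipschitz\<close>; it is positive precisely for \<epsilon> < 1/8.\<close>
  define k r where "k = 1/4 - 2 * \<epsilon>" and "r = norm_n n (x - y)"
  have k: "k > 0" using e by (simp add: k_def)
  have "0 \<le> (\<epsilon> * \<nu> x - k * r)\<^sup>2" by simp
  then have "2 * \<epsilon> * \<nu> x * r * k \<le> \<epsilon>\<^sup>2 * (\<nu> x)\<^sup>2 + k * r\<^sup>2 * k"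
    by (simp add: power2_eq_square algebra_simps)
  then have "2 * \<epsilon> * \<nu> x * r \<le> (\<epsilon>\<^sup>2 * (\<nu> x)\<^sup>2 + k * r\<^sup>2 * k) / k"
    using k by (simp add: le_divide_eq)
  also have "\<dots> = c \<epsilon> * (\<nu> x)\<^sup>2 + k * r\<^sup>2"
    using k by (simp add: c_def k_def[symmetric] add_divide_distrib)
  finally have *: "2 * \<epsilon> * \<nu> x * r - c \<epsilon> * (\<nu> x)\<^sup>2 \<le> (1/4 - 2 * \<epsilon>) * r\<^sup>2" by (simp add: k_def)
  have "\<epsilon> * (f x - f y) \<le> \<epsilon> * (2 * \<nu> x * r + 2 * r\<^sup>2)"
    using f_lipschitz[of x y] e unfolding r_def by (intro mult_left_mono) auto
  then show ?thesis using * by (simp add: fbar_def r_def[symmetric] algebra_simps)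
qed

lemma
  assumes e: "0 < \<epsilon>" "\<epsilon> < 1/8"
  shows integrable_exp_fbar: "integrable (std_gaussian n) (\<lambda>x. exp (\<epsilon> * fbar x - c \<epsilon> * (\<nu> x)\<^sup>2))"
    and integrable_exp_fbar': "integrable (std_gaussian n) (\<lambda>x. exp (- (\<epsilon> * fbar x)))"
    and exp_fbar_product: "expectation (\<lambda>x. exp (\<epsilon> * fbar x - c \<epsilon> * (\<nu> x)\<^sup>2)) * expectation (\<lambda>x. exp (- (\<epsilon> * fbar x))) \<le> 1"
  by (rule gaussian_tau_exp[OF _ _ tau_fbar[OF e]]; measurable)+

lemma expectation_exp_fbar':
  assumes "0 < \<epsilon>" "\<epsilon> < 1/8"
  shows "1 \<le> expectation (\<lambda>x. exp (- (\<epsilon> * fbar x)))"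
  using expectation_exp_ge_1[OF _ integrable_exp_fbar'[OF assms]] integrable_fbar
  by (simp add: expectation_fbar)

lemma expectation_exp_fbar:
  assumes "0 < \<epsilon>" "\<epsilon> < 1/8"
  shows "expectation (\<lambda>x. exp (\<epsilon> * fbar x - c \<epsilon> * (\<nu> x)\<^sup>2)) \<le> 1"
proof -
  let ?a = "expectation (\<lambda>x. exp (\<epsilon> * fbar x - c \<epsilon> * (\<nu> x)\<^sup>2))"
  have "?a * 1 \<le> ?a * expectation (\<lambda>x. exp (- (\<epsilon> * fbar x)))"
    by (intro mult_left_mono expectation_exp_fbar' assms) simp
  then show ?thesis using exp_fbar_product[OF assms] by linarith
qed

lemma expectation_exp_nu:
  shows "integrable (std_gaussian n) (\<lambda>x. exp ((\<nu> x)\<^sup>2 / 8))"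
    and "expectation (\<lambda>x. exp ((\<nu> x)\<^sup>2 / 8)) \<le> exp (V / 4)"
proof -
  have tau: "(\<nu> x)\<^sup>2 / 8 + - (\<nu> y)\<^sup>2 / 4 \<le> (norm_n n (x - y))\<^sup>2 / 4" for x y
  proof -
    have "(\<nu> x)\<^sup>2 \<le> (\<nu> y + norm_n n (x - y))\<^sup>2"
      by (intro power_mono nu_lipschitz nu_nonneg)
    also have "\<dots> \<le> 2 * (\<nu> y)\<^sup>2 + 2 * (norm_n n (x - y))\<^sup>2"
      using zero_le_power2[of "\<nu> y - norm_n n (x - y)"] by (simp add: power2_sum power2_diff)
    finally show ?thesis by simp
  qed
  have X: "(\<lambda>x. (\<nu> x)\<^sup>2 / 8) \<in> borel_measurable borel" and Y: "(\<lambda>x. - (\<nu> x)\<^sup>2 / 4) \<in> borel_measurable borel"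
    by measurable
  note * = gaussian_tau_exp[OF X Y tau]
  show "integrable (std_gaussian n) (\<lambda>x. exp ((\<nu> x)\<^sup>2 / 8))" by (rule *)
  \<comment> \<open>Jensen's inequality through the tangent to exp at \<open>- V / 4\<close>, whose
    linear part has mean 0.\<close>
  have "expectation (\<lambda>x. exp (- V / 4) * (1 + (V / 4 - (\<nu> x)\<^sup>2 / 4))) \<le> expectation (\<lambda>x. exp (- (\<nu> x)\<^sup>2 / 4))"
  proof (rule Bochner_Integration.integral_mono)
    fix x
    have "exp (- V / 4) * (1 + (V / 4 - (\<nu> x)\<^sup>2 / 4)) \<le> exp (- V / 4) * exp (V / 4 - (\<nu> x)\<^sup>2 / 4)"
      by (intro mult_left_mono exp_ge_add_one_self) simp
    then show "exp (- V / 4) * (1 + (V / 4 - (\<nu> x)\<^sup>2 / 4)) \<le> exp (- (\<nu> x)\<^sup>2 / 4)"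
      by (simp flip: exp_add)
  qed (use integrable_nu2 * in simp_all)
  also have "expectation (\<lambda>x. exp (- V / 4) * (1 + (V / 4 - (\<nu> x)\<^sup>2 / 4))) = exp (- V / 4)"
    using integrable_nu2 by (simp add: prob_space V_def)
  finally have "expectation (\<lambda>x. exp ((\<nu> x)\<^sup>2 / 8)) * exp (- V / 4) \<le> expectation (\<lambda>x. exp ((\<nu> x)\<^sup>2 / 8)) * expectation (\<lambda>x. exp (- (\<nu> x)\<^sup>2 / 4))"
    by (intro mult_left_mono) auto
  also have "\<dots> \<le> 1" by (rule *)
  finally show "expectation (\<lambda>x. exp ((\<nu> x)\<^sup>2 / 8)) \<le> exp (V / 4)"
    by (simp add: exp_minus field_simps)
qed

text \<open>For the two expectations, \<open>a * b \<le> 1\<close> gives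
  \<open>(a + b - 2) * b \<le> (b - 1)\<^sup>2\<close>, and \<open>b \<ge> 1\<close>, so their sum
  exceeds 2 by at most a square. That square is of order \<open>d\<^sup>2\<close>: from
  \<open>a \<ge> 1 - d\<close> and \<open>d \<le> 1/2\<close> follows
  \<open>b - 1 \<le> 2 * d\<close>.\<close>

lemma second_order_remainder:
  assumes e: "0 < \<epsilon>" "\<epsilon> < 1/8" and cV: "c \<epsilon> * V \<le> 1/2"
  defines "R \<equiv> \<lambda>x. (exp (\<epsilon> * fbar x - c \<epsilon> * (\<nu> x)\<^sup>2) - 1 - (\<epsilon> * fbar x - c \<epsilon> * (\<nu> x)\<^sup>2))
    + (exp (- (\<epsilon> * fbar x)) - 1 + \<epsilon> * fbar x)"
  shows "integrable (std_gaussian n) R" "expectation R \<le> c \<epsilon> * V + 4 * (c \<epsilon> * V)\<^sup>2"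
proof -
  note ints = integrable_exp_fbar[OF e] integrable_exp_fbar'[OF e] integrable_fbar integrable_nu2
  show "integrable (std_gaussian n) R" unfolding R_def using ints by simp
  define a b d where "a = expectation (\<lambda>x. exp (\<epsilon> * fbar x - c \<epsilon> * (\<nu> x)\<^sup>2))"
    and "b = expectation (\<lambda>x. exp (- (\<epsilon> * fbar x)))" and "d = c \<epsilon> * V"
  have c0: "c \<epsilon> \<ge> 0" using e by (simp add: c_def)
  have d: "0 \<le> d" "d \<le> 1/2" using c0 V_nonneg cV by (auto simp: d_def)
  have ER: "expectation R = a + b - 2 + d"
    unfolding R_def a_def b_def d_def V_def using ints by (simp add: prob_space expectation_fbar)
  have ab: "a * b \<le> 1" unfolding a_def b_def by (rule exp_fbar_product[OF e])
  have b1: "1 \<le> b" unfolding b_def by (rule expectation_exp_fbar'[OF e])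
  have "1 - d \<le> a"
    unfolding a_def d_def V_def
    using expectation_exp_ge_1[OF _ integrable_exp_fbar[OF e]] ints
    by (simp add: prob_space expectation_fbar)
  then have "(1 - d) * b \<le> 1" using mult_right_mono[of "1 - d" a b] ab b1 by linarith
  then have bd: "(b - 1) * (1 - d) \<le> d" by (simp add: algebra_simps)
  moreover have "(b - 1) * (1/2) \<le> (b - 1) * (1 - d)" using b1 d by (intro mult_left_mono) auto
  ultimately have b2: "b - 1 \<le> 2 * d" by simp
  have "(b - 1)\<^sup>2 \<le> (2 * d)\<^sup>2" using b1 b2 by (intro power_mono) auto
  then have sq: "(b - 1)\<^sup>2 \<le> 4 * d\<^sup>2" by (simp add: power_mult_distrib)
  have "(a + b - 2) * b = a * b + b\<^sup>2 - 2 * b" by (simp add: algebra_simps power2_eq_square)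
  also have "\<dots> \<le> (b - 1)\<^sup>2" using ab by (simp add: power2_diff)
  also have "\<dots> \<le> (b - 1)\<^sup>2 * b" using b1 mult_left_mono[OF b1, of "(b - 1)\<^sup>2"] by simp
  finally have "a + b - 2 \<le> (b - 1)\<^sup>2" using b1 by simp
  then show "expectation R \<le> c \<epsilon> * V + 4 * (c \<epsilon> * V)\<^sup>2"
    using sq ER by (simp add: d_def)
qed

text \<open>The remainder is divided by \<open>\<epsilon>\<^sup>2\<close> and \<epsilon> tends to 0.
  Cubic Taylor bounds replace the exponentials by the polynomial \<open>l\<close>, which tends to
  \<open>(fbar x)\<^sup>2\<close> pointwise. Fatou's lemma, applied to the positive part taken by
  \<open>ennreal\<close>, requires no dominating function; the upper bound tends to
  \<open>4 * V\<close> because \<open>k\<close> tends to 1/4.\<close>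

lemma variance_bound: "expectation (\<lambda>x. (fbar x)\<^sup>2) \<le> 4 * V"
proof -
  \<comment> \<open>The 9 keeps every term below 1/8, including the one at
    \<open>j = 0\<close>.\<close>
  define e where "e j = inverse (real (Suc j)) / 9" for j
  define k where "k \<epsilon> = 1/4 - 2 * \<epsilon>" for \<epsilon> :: real
  have e: "0 < e j" "e j < 1/8" for j by (auto simp: e_def field_simps)
  have e0: "e \<longlonglongrightarrow> 0"
    unfolding e_def using tendsto_divide[OF LIMSEQ_inverse_real_of_nat tendsto_const[of 9]] by simp
  have kp: "k (e j) > 0" for j using e[of j] by (simp add: k_def)
  have k0: "(\<lambda>j. k (e j)) \<longlonglongrightarrow> 1/4"
    unfolding k_def using e0 by (auto intro!: tendsto_eq_intros)
  have c0: "(\<lambda>j. c (e j)) \<longlonglongrightarrow> 0"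
    unfolding c_def by (rule tendsto_eq_intros e0 k0[unfolded k_def] refl | simp)+
  have cV0: "(\<lambda>j. c (e j) * V) \<longlonglongrightarrow> 0"
    using tendsto_mult_right[OF c0, of V] by simp
  define X where "X j x = fbar x - e j / k (e j) * (\<nu> x)\<^sup>2" for j x
  have X: "e j * fbar x - c (e j) * (\<nu> x)\<^sup>2 = e j * X j x" for j x
    by (simp add: X_def c_def k_def power2_eq_square algebra_simps)
  define l where "l j x = (X j x)\<^sup>2 / 2 + e j * (X j x) ^ 3 / 6 + ((fbar x)\<^sup>2 / 2 - e j * (fbar x) ^ 3 / 6)" for j x
  have [measurable]: "l j \<in> borel_measurable borel" for j
    unfolding l_def X_def by measurable
  define R where "R j x = (exp (e j * fbar x - c (e j) * (\<nu> x)\<^sup>2) - 1 - (e j * fbar x - c (e j) * (\<nu> x)\<^sup>2))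
    + (exp (- (e j * fbar x)) - 1 + e j * fbar x)" for j x
  have R0: "0 \<le> R j x" for j x
    unfolding R_def
    using exp_ge_add_one_self[of "e j * fbar x - c (e j) * (\<nu> x)\<^sup>2"] exp_ge_add_one_self[of "- (e j * fbar x)"]
    by linarith
  have lR: "l j x \<le> R j x / (e j)\<^sup>2" for j x
  proof -
    have "(e j)\<^sup>2 * l j x = ((e j * X j x)\<^sup>2 / 2 + (e j * X j x) ^ 3 / 6) + ((- (e j * fbar x))\<^sup>2 / 2 + (- (e j * fbar x)) ^ 3 / 6)"
      by (simp add: l_def power2_eq_square power3_eq_cube algebra_simps)
    also have "\<dots> \<le> R j x"
      using exp_ge_cubic[of "e j * X j x"] exp_ge_cubic[of "- (e j * fbar x)"]
      unfolding R_def X by linarith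
    finally show ?thesis using e[of j] by (simp add: le_divide_eq mult.commute)
  qed
  have Xlim: "(\<lambda>j. X j x) \<longlonglongrightarrow> fbar x" for x
    unfolding X_def by (rule tendsto_eq_intros e0 k0 refl | simp)+
  have llim: "(\<lambda>j. l j x) \<longlonglongrightarrow> (fbar x)\<^sup>2" for x
    unfolding l_def by (rule tendsto_eq_intros Xlim e0 refl | simp)+
  have ev: "\<forall>\<^sub>F j in sequentially. (\<integral>\<^sup>+x. ennreal (l j x) \<partial>std_gaussian n) \<le> ennreal (V / k (e j) + 4 * (c (e j) * V) * (V / k (e j)))"
    using order_tendstoD(2)[OF cV0, of "1/2", simplified]
  proof eventually_elim
    case (elim j)
    have ej: "(e j)\<^sup>2 > 0" using e[of j] by simp
    have cV: "c (e j) * V \<le> 1/2" using elim by simp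
    have int: "integrable (std_gaussian n) (R j)" and ER: "expectation (R j) \<le> c (e j) * V + 4 * (c (e j) * V)\<^sup>2"
      unfolding R_def using second_order_remainder[OF e cV] by simp_all
    have "(\<integral>\<^sup>+x. ennreal (l j x) \<partial>std_gaussian n) \<le> (\<integral>\<^sup>+x. ennreal (R j x / (e j)\<^sup>2) \<partial>std_gaussian n)"
      by (intro nn_integral_mono ennreal_leI lR)
    also have "\<dots> = ennreal (expectation (R j) / (e j)\<^sup>2)"
      using int R0 by (subst nn_integral_eq_integral) auto
    also have "\<dots> \<le> ennreal (V / k (e j) + 4 * (c (e j) * V) * (V / k (e j)))"
    proof (rule ennreal_leI)
      have cc: "c (e j) = (e j)\<^sup>2 * (1 / k (e j))" by (simp add: c_def k_def)
      have "expectation (R j) / (e j)\<^sup>2 \<le> (c (e j) * V + 4 * (c (e j) * V)\<^sup>2) / (e j)\<^sup>2"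
        using ER by (intro divide_right_mono) auto
      also have "\<dots> = (e j)\<^sup>2 * (V / k (e j) + 4 * (c (e j) * V) * (V / k (e j))) / (e j)\<^sup>2"
        unfolding power2_eq_square[of "c (e j) * V"] by (subst (1 3) cc) (simp add: algebra_simps)
      also have "\<dots> = V / k (e j) + 4 * (c (e j) * V) * (V / k (e j))" using ej by simp
      finally show "expectation (R j) / (e j)\<^sup>2 \<le> V / k (e j) + 4 * (c (e j) * V) * (V / k (e j))" .
    qed
    finally show ?case .
  qed
  have rhs: "(\<lambda>j. ennreal (V / k (e j) + 4 * (c (e j) * V) * (V / k (e j)))) \<longlonglongrightarrow> ennreal (4 * V)"
    by (rule tendsto_ennrealI) (rule tendsto_eq_intros k0 cV0 refl | simp)+
  have "(\<integral>\<^sup>+x. ennreal ((fbar x)\<^sup>2) \<partial>std_gaussian n) = (\<integral>\<^sup>+x. liminf (\<lambda>j. ennreal (l j x)) \<partial>std_gaussian n)"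
    using lim_imp_Liminf[OF _ tendsto_ennrealI[OF llim]] by (intro nn_integral_cong) simp
  also have "\<dots> \<le> liminf (\<lambda>j. \<integral>\<^sup>+x. ennreal (l j x) \<partial>std_gaussian n)"
    by (rule nn_integral_liminf) simp
  also have "\<dots> \<le> liminf (\<lambda>j. ennreal (V / k (e j) + 4 * (c (e j) * V) * (V / k (e j))))"
    by (rule Liminf_mono[OF ev])
  also have "\<dots> = ennreal (4 * V)"
    using lim_imp_Liminf[OF _ rhs] by simp
  finally have "ennreal (expectation (\<lambda>x. (fbar x)\<^sup>2)) \<le> ennreal (4 * V)"
    using integrable_fbar2 by (simp add: nn_integral_eq_integral)
  then show ?thesis using V_nonneg by (simp add: ennreal_le_iff)
qed

text \<open>The threshold \<open>2 * V + 8 * t\<close> is chosen so that Markov's inequality for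
  \<open>exp ((\<nu> x)\<^sup>2 / 8)\<close> costs exactly \<open>exp (- t)\<close>. Below it the
  compensator is under control, and Markov's inequality for the compensated exponential gives the
  other \<open>exp (- t)\<close>.\<close>

lemma upper_tail_eps:
  assumes e: "0 < \<epsilon>" "\<epsilon> \<le> 1/16" and s: "t + c \<epsilon> * (2 * V + 8 * t) \<le> \<epsilon> * s"
  shows "prob {x. s \<le> fbar x} \<le> 2 * exp (- t)"
proof -
  have e': "\<epsilon> < 1/8" using e by simp
  let ?A = "{x \<in> space (std_gaussian n). exp t \<le> exp (\<epsilon> * fbar x - c \<epsilon> * (\<nu> x)\<^sup>2)}"
  let ?B = "{x \<in> space (std_gaussian n). exp (V / 4 + t) \<le> exp ((\<nu> x)\<^sup>2 / 8)}"
  have c0: "c \<epsilon> \<ge> 0" using e by (simp add: c_def)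
  have "{x. s \<le> fbar x} \<subseteq> ?A \<union> ?B"
  proof
    fix x assume "x \<in> {x. s \<le> fbar x}"
    then have "\<epsilon> * s \<le> \<epsilon> * fbar x" using e by simp
    then have *: "t + c \<epsilon> * (2 * V + 8 * t) \<le> \<epsilon> * fbar x" using s by linarith
    show "x \<in> ?A \<union> ?B"
    proof (cases "2 * V + 8 * t \<le> (\<nu> x)\<^sup>2")
      case True
      then show ?thesis by simp
    next
      case False
      then have "c \<epsilon> * (\<nu> x)\<^sup>2 \<le> c \<epsilon> * (2 * V + 8 * t)" using c0 by (intro mult_left_mono) auto
      then show ?thesis using * by simp
    qed
  qed
  then have "prob {x. s \<le> fbar x} \<le> prob (?A \<union> ?B)" by (intro finite_measure_mono) auto
  also have "\<dots> \<le> prob ?A + prob ?B" by (rule measure_Un_le) auto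
  also have "prob ?A \<le> expectation (\<lambda>x. exp (\<epsilon> * fbar x - c \<epsilon> * (\<nu> x)\<^sup>2)) / exp t"
    by (rule integral_Markov_inequality_measure[OF integrable_exp_fbar[OF e(1) e'], of UNIV]) auto
  also have "\<dots> \<le> 1 / exp t" by (intro divide_right_mono expectation_exp_fbar e e') auto
  also have "prob ?B \<le> expectation (\<lambda>x. exp ((\<nu> x)\<^sup>2 / 8)) / exp (V / 4 + t)"
    by (rule integral_Markov_inequality_measure[OF expectation_exp_nu(1), of UNIV]) auto
  also have "\<dots> \<le> exp (V / 4) / exp (V / 4 + t)" by (intro divide_right_mono expectation_exp_nu) auto
  also have "\<dots> = 1 / exp t" by (simp add: exp_add)
  finally show ?thesis by (simp add: exp_minus inverse_eq_divide)
qed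

lemma upper_tail:
  assumes t: "0 < t"
  shows "prob {x. 20 * (sqrt (V * t) + t) \<le> fbar x} \<le> 2 * exp (- t)"
proof -
  define w \<tau> where "w = sqrt V" and "\<tau> = sqrt t"
  have w: "w \<ge> 0" "V = w * w" and \<tau>: "\<tau> > 0" "t = \<tau> * \<tau>" and wt: "sqrt (V * t) = w * \<tau>"
    using V_nonneg t by (auto simp: w_def \<tau>_def real_sqrt_mult)
  have c_le: "c \<epsilon> * z \<le> 8 * \<epsilon>\<^sup>2 * z" if "0 < \<epsilon>" "\<epsilon> \<le> 1/16" "0 \<le> z" for \<epsilon> z
  proof -
    have "\<epsilon>\<^sup>2 / (1/4 - 2 * \<epsilon>) \<le> \<epsilon>\<^sup>2 / (1/8)" using that by (intro divide_left_mono) auto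
    then show ?thesis using that by (intro mult_right_mono) (auto simp: c_def)
  qed
  define \<epsilon> where "\<epsilon> = (if 16 * \<tau> \<le> w then \<tau> / w else 1/16)"
  have "0 < \<epsilon> \<and> \<epsilon> \<le> 1/16 \<and> t + 8 * \<epsilon>\<^sup>2 * (2 * V + 8 * t) \<le> \<epsilon> * (20 * (sqrt (V * t) + t))"
  proof (cases "16 * \<tau> \<le> w")
    case True
    then have wp: "w > 0" using \<tau> by simp
    have e: "\<epsilon> * w = \<tau>" and e16: "\<epsilon> \<le> 1/16" using True wp by (auto simp: \<epsilon>_def field_simps)
    have ep: "\<epsilon> > 0" using True wp \<tau> by (simp add: \<epsilon>_def)
    have "t = (\<epsilon> * w) * \<tau>" unfolding e by (rule \<tau>(2))
    moreover have "\<epsilon> * ((\<epsilon> * w) * w) = \<epsilon> * (\<tau> * w)" by (simp only: e)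
    moreover have "8 * \<epsilon>\<^sup>2 * (2 * V + 8 * t) = 16 * (\<epsilon> * ((\<epsilon> * w) * w)) + 64 * (\<epsilon> * (\<epsilon> * t))"
      unfolding w(2) by (simp add: power2_eq_square algebra_simps)
    ultimately have "t + 8 * \<epsilon>\<^sup>2 * (2 * V + 8 * t) = \<epsilon> * (17 * (w * \<tau>) + 64 * (\<epsilon> * t))"
      by (simp add: algebra_simps)
    also have "\<dots> \<le> \<epsilon> * (20 * (w * \<tau> + t))"
    proof (intro mult_left_mono)
      have "\<epsilon> * t \<le> 1/16 * t" using e16 t by (intro mult_right_mono) auto
      moreover have "0 \<le> w * \<tau>" using w(1) \<tau>(1) by simp
      ultimately show "17 * (w * \<tau>) + 64 * (\<epsilon> * t) \<le> 20 * (w * \<tau> + t)"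
        using t by (simp only: distrib_left)
    qed (use ep in simp)
    finally show ?thesis using ep e16 wt by simp
  next
    case False
    then have e: "\<epsilon> = 1/16" by (simp add: \<epsilon>_def)
    have "V \<le> 16 * (w * \<tau>)" unfolding w(2) using False w(1) mult_left_mono[of w "16 * \<tau>" w] by (simp add: algebra_simps)
    moreover have "0 \<le> w * \<tau>" using w(1) \<tau>(1) by simp
    ultimately show ?thesis unfolding e wt using t by (simp add: power2_eq_square ac_simps)
  qed
  moreover from this have "c \<epsilon> * (2 * V + 8 * t) \<le> 8 * \<epsilon>\<^sup>2 * (2 * V + 8 * t)"
    using V_nonneg t by (intro c_le) auto
  ultimately show ?thesis by (intro upper_tail_eps[of \<epsilon>]) auto
qed

lemma negative: "gaussian_local_lipschitz n (\<lambda>x. - f x) \<nu>"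
  by unfold_locales
     (use nu_nonneg nu_lipschitz f_lipschitz f_bound nu_bound in \<open>auto simp: abs_minus_commute\<close>)

lemma two_sided_tail:
  assumes t: "0 < t"
  shows "prob {x. 20 * (sqrt (V * t) + t) \<le> \<bar>f x - expectation f\<bar>} \<le> 4 * exp (- t)"
proof -
  interpret neg: gaussian_local_lipschitz n "\<lambda>x. - f x" \<nu> by (rule negative)
  have "{x. 20 * (sqrt (V * t) + t) \<le> \<bar>f x - expectation f\<bar>}
    \<subseteq> {x. 20 * (sqrt (V * t) + t) \<le> fbar x} \<union> {x. 20 * (sqrt (neg.V * t) + t) \<le> neg.fbar x}"
    by (auto simp: fbar_def neg.fbar_def V_def neg.V_def abs_if)
  then have "prob {x. 20 * (sqrt (V * t) + t) \<le> \<bar>f x - expectation f\<bar>}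
    \<le> prob ({x. 20 * (sqrt (V * t) + t) \<le> fbar x} \<union> {x. 20 * (sqrt (neg.V * t) + t) \<le> neg.fbar x})"
    by (intro finite_measure_mono) auto
  also have "\<dots> \<le> prob {x. 20 * (sqrt (V * t) + t) \<le> fbar x} + prob {x. 20 * (sqrt (neg.V * t) + t) \<le> neg.fbar x}"
    by (rule measure_Un_le) auto
  also have "\<dots> \<le> 2 * exp (- t) + 2 * exp (- t)"
    by (intro add_mono upper_tail neg.upper_tail t)
  finally show ?thesis by simp
qed

end

subsection \<open>The Gaussian sequence model\<close>

lemma measurable_affine: "(\<lambda>h::nat \<Rightarrow> real. \<mu> + \<sigma> *\<^sub>R h) \<in> borel_measurable borel"
  by (rule measurable_coordinatewise_then_product) (simp add: scaleR_fun_def)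

context closed_convex
begin

lemma abs_proj_diff_le: "\<bar>proj n K y i - proj n K z i\<bar> \<le> norm_n n (y - z)"
proof (cases "i < n")
  case True
  then show ?thesis
    using abs_le_norm_n[OF True, of "proj n K y - proj n K z"] proj_nonexpansive[of y z] by simp
next
  case False
  then show ?thesis using K_zero[OF proj_in_K, of i] by simp
qed

lemma continuous_on_proj: "continuous_on UNIV (\<lambda>z. proj n K z i)"
  unfolding continuous_on_def
proof
  fix y
  have "((\<lambda>z. norm_n n (y - z)) \<longlongrightarrow> norm_n n (y - y)) (at y within UNIV)"
    using continuous_on_norm_n_diff[of n y] unfolding continuous_on_def by blast
  moreover have "norm_n n (y - y) = 0" by (simp add: norm_n_def L2_set_def)
  ultimately have "((\<lambda>z. norm_n n (y - z)) \<longlongrightarrow> 0) (at y)" by simp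
  then have "((\<lambda>z. proj n K z i - proj n K y i) \<longlongrightarrow> 0) (at y)"
    by (rule Lim_null_comparison[rotated])
       (auto intro!: always_eventually simp: abs_minus_commute[of "proj n K _ i" "proj n K y i"] abs_proj_diff_le)
  then show "((\<lambda>z. proj n K z i) \<longlongrightarrow> proj n K y i) (at y within UNIV)" by (simp add: LIM_zero_iff)
qed

lemma measurable_proj:
  "F \<in> measurable M borel \<Longrightarrow> (\<lambda>h. proj n K (F h) i) \<in> borel_measurable M"
  using borel_measurable_continuous_onI[OF continuous_on_proj] by (rule measurable_compose[rotated])

lemma measurable_norm_proj: "(\<lambda>h. (norm_n n (proj n K h))\<^sup>2) \<in> borel_measurable borel"
  unfolding norm_n_sq inner_n_def using measurable_proj[of "\<lambda>h. h" borel] by simp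

text \<open>For two points that differ in coordinate \<open>i\<close> only, the inner product in
  firm nonexpansiveness has a single term. Its nonnegativity makes the slice monotone.\<close>

lemma proj_slice_firm:
  assumes "i < n"
  shows "(norm_n n (proj n K (y(i := s)) - proj n K (y(i := t))))\<^sup>2
    \<le> (proj n K (y(i := s)) i - proj n K (y(i := t)) i) * (s - t)"
proof -
  have "inner_n n x (y(i := s) - y(i := t)) = x i * (s - t)" for x
    unfolding inner_n_def using assms
    by (subst sum.remove[of _ i]) (auto intro!: sum.neutral)
  then show ?thesis using proj_firmly_nonexpansive[of "y(i := s)" "y(i := t)"] by simp
qed

lemma mono_proj_slice: "i < n \<Longrightarrow> mono (\<lambda>s. proj n K (y(i := s)) i)"
proof (rule monoI)
  fix s t :: real assume i: "i < n" and st: "s \<le> t"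
  have "0 \<le> (proj n K (y(i := t)) i - proj n K (y(i := s)) i) * (t - s)"
    using proj_slice_firm[OF i, of y t s] by (rule order.trans[rotated]) simp
  then show "proj n K (y(i := s)) i \<le> proj n K (y(i := t)) i"
    using st by (cases "s = t") (auto simp: zero_le_mult_iff)
qed

lemma lipschitz_proj_slice:
  "\<bar>proj n K (y(i := s)) i - proj n K (y(i := t)) i\<bar> \<le> 1 * \<bar>s - t\<bar>"
proof -
  have "norm_n n (y(i := s) - y(i := t)) \<le> \<bar>s - t\<bar>"
  proof (rule power2_le_imp_le)
    have "(norm_n n (y(i := s) - y(i := t)))\<^sup>2 = (\<Sum>j<n. if j = i then (s - t)\<^sup>2 else 0)"
      unfolding norm_n_sq inner_n_def by (intro sum.cong) (auto simp: power2_eq_square)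
    then show "(norm_n n (y(i := s) - y(i := t)))\<^sup>2 \<le> \<bar>s - t\<bar>\<^sup>2" by (simp add: sum.delta)
  qed simp
  then show ?thesis using abs_proj_diff_le[of "y(i := s)" i "y(i := t)"] by simp
qed

end

section \<open>Stein's formula and limits of expectations\<close>

context sequence_model
begin

lemma path: "projection_path n K \<mu>\<^sub>0"
  by unfold_locales

lemma norm_mu_seq_le: "norm_n n (mu_seq n K \<mu>\<^sub>0 \<sigma> h - \<mu>\<^sub>0) \<le> \<bar>\<sigma>\<bar> * norm_n n h"
  using projection_path.norm_P_le[OF path, of h \<sigma>] by (simp add: projection_path.P_def[OF path] mu_seq_def)

lemma abs_dof_le: "\<bar>dof n K \<mu>\<^sub>0 \<sigma> h\<bar> \<le> \<sigma>\<^sup>2 * (norm_n n h)\<^sup>2"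
proof -
  have "\<bar>dof n K \<mu>\<^sub>0 \<sigma> h\<bar> \<le> norm_n n (mu_seq n K \<mu>\<^sub>0 \<sigma> h - \<mu>\<^sub>0) * norm_n n (\<sigma> *\<^sub>R h)"
    unfolding dof_def by (rule inner_n_le_norm)
  also have "\<dots> \<le> (\<bar>\<sigma>\<bar> * norm_n n h) * (\<bar>\<sigma>\<bar> * norm_n n h)"
    unfolding norm_n_scaleR by (intro mult_right_mono norm_mu_seq_le) simp
  finally show ?thesis by (simp add: power2_eq_square ac_simps)
qed

lemma err_bounds: "0 \<le> err n K \<mu>\<^sub>0 \<sigma> h" "err n K \<mu>\<^sub>0 \<sigma> h \<le> \<sigma>\<^sup>2 * (norm_n n h)\<^sup>2"
  using power_mono[OF norm_mu_seq_le[of \<sigma> h], of 2] by (simp_all add: err_def power_mult_distrib)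

lemma measurable_mu_seq [measurable]: "(\<lambda>h. mu_seq n K \<mu>\<^sub>0 \<sigma> h i) \<in> borel_measurable borel"
  unfolding mu_seq_def by (rule measurable_proj[OF measurable_affine])

lemma measurable_norm_mu_seq [measurable]: "(\<lambda>h. norm_n n (mu_seq n K \<mu>\<^sub>0 \<sigma> h - \<mu>\<^sub>0)) \<in> borel_measurable borel"
  unfolding norm_n_def L2_set_def by simp

lemma measurable_err [measurable]: "err n K \<mu>\<^sub>0 \<sigma> \<in> borel_measurable borel"
  unfolding err_def[abs_def] by measurable

lemma measurable_dof [measurable]: "dof n K \<mu>\<^sub>0 \<sigma> \<in> borel_measurable borel"
  unfolding dof_def[abs_def] inner_n_def by (simp add: scaleR_fun_def)

lemma integrable_err: "integrable (std_gaussian n) (err n K \<mu>\<^sub>0 \<sigma>)"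
  by (rule Bochner_Integration.integrable_bound[OF integrable_mult_right[OF integrable_norm_pow2, where c = "\<sigma>\<^sup>2"]])
     (use err_bounds in \<open>auto intro!: AE_I2\<close>)

lemma integrable_dof: "integrable (std_gaussian n) (dof n K \<mu>\<^sub>0 \<sigma>)"
  by (rule Bochner_Integration.integrable_bound[OF integrable_mult_right[OF integrable_norm_pow2, where c = "\<sigma>\<^sup>2"]])
     (use abs_dof_le in \<open>auto intro!: AE_I2\<close>)

lemma integrable_coordinate_mu_seq:
  assumes i: "i < n"
  shows "integrable (std_gaussian n) (\<lambda>h. h i * (mu_seq n K \<mu>\<^sub>0 \<sigma> h i - \<mu>\<^sub>0 i))"
proof (rule Bochner_Integration.integrable_bound[OF integrable_mult_right[OF integrable_norm_pow2, where c = \<sigma>]])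
  show "AE h in std_gaussian n. norm (h i * (mu_seq n K \<mu>\<^sub>0 \<sigma> h i - \<mu>\<^sub>0 i)) \<le> norm (\<sigma> * (norm_n n h)\<^sup>2)"
  proof (intro AE_I2)
    fix h
    have "\<bar>h i\<bar> * \<bar>mu_seq n K \<mu>\<^sub>0 \<sigma> h i - \<mu>\<^sub>0 i\<bar> \<le> norm_n n h * (\<bar>\<sigma>\<bar> * norm_n n h)"
      using abs_le_norm_n[OF i, of h] abs_le_norm_n[OF i, of "mu_seq n K \<mu>\<^sub>0 \<sigma> h - \<mu>\<^sub>0"] norm_mu_seq_le[of \<sigma> h]
      by (intro mult_mono) auto
    then show "norm (h i * (mu_seq n K \<mu>\<^sub>0 \<sigma> h i - \<mu>\<^sub>0 i)) \<le> norm (\<sigma> * (norm_n n h)\<^sup>2)"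
      by (simp add: abs_mult power2_eq_square ac_simps)
  qed
qed simp

definition partial :: "nat \<Rightarrow> real \<Rightarrow> (nat \<Rightarrow> real) \<Rightarrow> real" where
  "partial i \<sigma> h = deriv (\<lambda>s. proj n K ((\<mu>\<^sub>0 + \<sigma> *\<^sub>R h)(i := s)) i) ((\<mu>\<^sub>0 + \<sigma> *\<^sub>R h) i)"

lemma div_mu_seq_eq: "div_mu_seq n K \<mu>\<^sub>0 \<sigma> h = (\<Sum>i<n. partial i \<sigma> h)"
  by (simp add: div_mu_seq_def divergence_def partial_def)

lemma measurable_partial [measurable]:
  assumes "i < n"
  shows "partial i \<sigma> \<in> borel_measurable borel"
  unfolding partial_def[abs_def]
proof (rule measurable_deriv[OF mono_proj_slice[OF assms] lipschitz_proj_slice])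
  fix r
  have "(\<lambda>h. (\<mu>\<^sub>0 + \<sigma> *\<^sub>R h)(i := (\<mu>\<^sub>0 + \<sigma> *\<^sub>R h) i + r)) \<in> borel_measurable borel"
  proof (rule measurable_coordinatewise_then_product)
    fix j
    show "(\<lambda>h. ((\<mu>\<^sub>0 + \<sigma> *\<^sub>R h)(i := (\<mu>\<^sub>0 + \<sigma> *\<^sub>R h) i + r)) j) \<in> borel_measurable borel"
      by (cases "j = i") (simp_all add: scaleR_fun_def)
  qed
  then show "(\<lambda>h. proj n K ((\<mu>\<^sub>0 + \<sigma> *\<^sub>R h)(i := (\<mu>\<^sub>0 + \<sigma> *\<^sub>R h) i + r)) i) \<in> borel_measurable borel"
    by (rule measurable_proj)
qed

text \<open>Fubini with coordinate \<open>i\<close> innermost: for fixed other coordinates the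
  integrand is an affine reparametrization of a monotone 1-Lipschitz slice. Tonelli first gives
  integrability, since the derivative is bounded by 1 almost everywhere in the inner
  variable.\<close>

lemma partial_stein:
  assumes i: "i < n" and s: "\<sigma> > 0"
  shows "integrable (std_gaussian n) (partial i \<sigma>)"
    and "(\<integral>h. h i * (mu_seq n K \<mu>\<^sub>0 \<sigma> h i - \<mu>\<^sub>0 i) \<partial>std_gaussian n) = \<sigma> * (\<integral>h. partial i \<sigma> h \<partial>std_gaussian n)"
proof -
  let ?N = "\<lambda>_::nat. std_normal_distribution"
  define I where "I = {..<n} - {i}"
  have I: "finite I" "i \<notin> I" and ins: "{..<n} = insert i I" using i by (auto simp: I_def)
  interpret product_sigma_finite ?N by (rule product_std_normal)
  interpret I: prob_space "PiM I ?N" by (intro prob_space_PiM prob_space_normal_density) simp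
  interpret N: prob_space std_normal_distribution by (intro prob_space_normal_density) simp
  define ext where "ext x = (\<lambda>j. if j < n then x j else 0)" for x :: "nat \<Rightarrow> real"
  have ext_meas [measurable]: "ext \<in> measurable (PiM {..<n} ?N) borel"
    unfolding ext_def by (rule measurable_zero_extension)
  have std: "std_gaussian n = distr (PiM {..<n} ?N) borel ext"
    unfolding std_gaussian_def ext_def ..
  define slice where "slice x s = proj n K ((\<mu>\<^sub>0 + \<sigma> *\<^sub>R ext x)(i := s)) i" for x s
  have ext_upd: "ext (x(i := z)) = (ext x)(i := z)" for x z using i by (auto simp: ext_def)
  \<comment> \<open>The slice does not see coordinate \<open>i\<close> of \<open>x\<close>, so z
    enters only through the point at which the slice is evaluated or differentiated.\<close>
  have upd: "(\<mu>\<^sub>0 + \<sigma> *\<^sub>R (ext x)(i := z))(i := s) = (\<mu>\<^sub>0 + \<sigma> *\<^sub>R ext x)(i := s)"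
    "\<mu>\<^sub>0 + \<sigma> *\<^sub>R (ext x)(i := z) = (\<mu>\<^sub>0 + \<sigma> *\<^sub>R ext x)(i := \<mu>\<^sub>0 i + \<sigma> * z)" for x z s
    by (auto simp: scaleR_fun_def)
  have pe: "partial i \<sigma> (ext (x(i := z))) = deriv (slice x) (\<mu>\<^sub>0 i + \<sigma> * z)" for x z
    unfolding partial_def ext_upd upd(1) slice_def by (simp add: scaleR_fun_def)
  have me: "mu_seq n K \<mu>\<^sub>0 \<sigma> (ext (x(i := z))) i = slice x (\<mu>\<^sub>0 i + \<sigma> * z)" for x z
    unfolding mu_seq_def ext_upd upd(2) slice_def ..
  have mono: "mono (slice x)" for x
    unfolding slice_def by (rule mono_proj_slice[OF i])
  have lip: "\<bar>slice x s - slice x t\<bar> \<le> 1 * \<bar>s - t\<bar>" for x s t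
    unfolding slice_def by (rule lipschitz_proj_slice)
  note stein = std_normal_stein_affine[OF mono lip s]
  have "(\<integral>\<^sup>+h. ennreal \<bar>partial i \<sigma> h\<bar> \<partial>std_gaussian n) = (\<integral>\<^sup>+x. ennreal \<bar>partial i \<sigma> (ext x)\<bar> \<partial>PiM (insert i I) ?N)"
    unfolding std by (subst nn_integral_distr) (use i in \<open>simp_all add: ins[symmetric]\<close>)
  also have "\<dots> = (\<integral>\<^sup>+x. (\<integral>\<^sup>+z. ennreal \<bar>deriv (slice x) (\<mu>\<^sub>0 i + \<sigma> * z)\<bar> \<partial>std_normal_distribution) \<partial>PiM I ?N)"
    by (subst product_nn_integral_insert[OF I]) (use i in \<open>simp_all add: pe ins[symmetric]\<close>)
  also have "\<dots> \<le> (\<integral>\<^sup>+x. (\<integral>\<^sup>+z. 1 \<partial>std_normal_distribution) \<partial>PiM I ?N)"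
  proof (rule nn_integral_mono, rule nn_integral_mono_AE)
    fix x
    show "AE z in std_normal_distribution. ennreal \<bar>deriv (slice x) (\<mu>\<^sub>0 i + \<sigma> * z)\<bar> \<le> 1"
      using stein(1)[of x "\<mu>\<^sub>0 i"] by eventually_elim simp
  qed
  also have "\<dots> = 1" using N.emeasure_space_1 I.emeasure_space_1 by simp
  finally have "(\<integral>\<^sup>+h. ennreal \<bar>partial i \<sigma> h\<bar> \<partial>std_gaussian n) < \<infinity>"
    by (rule order.strict_trans1) simp
  then show int1: "integrable (std_gaussian n) (partial i \<sigma>)"
    using measurable_partial[OF i] by (simp add: integrable_iff_bounded)
  have fub: "(\<integral>h. F h \<partial>std_gaussian n) = (\<integral>x. (\<integral>z. F (ext (x(i := z))) \<partial>std_normal_distribution) \<partial>PiM I ?N)"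
    if F: "integrable (std_gaussian n) F" for F :: "(nat \<Rightarrow> real) \<Rightarrow> real"
  proof -
    have [measurable]: "F \<in> borel_measurable borel" using borel_measurable_integrable[OF F] by simp
    have "integrable (PiM (insert i I) ?N) (\<lambda>x. F (ext x))"
      using F unfolding std by (subst (asm) integrable_distr_eq) (simp_all add: ins[symmetric])
    from product_integral_insert[OF I this] show ?thesis
      unfolding std by (subst integral_distr) (simp_all add: ins[symmetric])
  qed
  show "(\<integral>h. h i * (mu_seq n K \<mu>\<^sub>0 \<sigma> h i - \<mu>\<^sub>0 i) \<partial>std_gaussian n) = \<sigma> * (\<integral>h. partial i \<sigma> h \<partial>std_gaussian n)"
  proof -
    have exti: "ext (x(i := z)) i = z" for x z by (simp add: ext_upd)
    show ?thesis unfolding fub[OF int1] fub[OF integrable_coordinate_mu_seq[OF i]] pe me exti stein(2) by simp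
  qed
qed

lemma stein:
  assumes "\<sigma> > 0"
  shows "integrable (std_gaussian n) (div_mu_seq n K \<mu>\<^sub>0 \<sigma>)"
    and "(\<integral>h. dof n K \<mu>\<^sub>0 \<sigma> h \<partial>std_gaussian n) = \<sigma>\<^sup>2 * (\<integral>h. div_mu_seq n K \<mu>\<^sub>0 \<sigma> h \<partial>std_gaussian n)"
proof -
  show "integrable (std_gaussian n) (div_mu_seq n K \<mu>\<^sub>0 \<sigma>)"
    unfolding div_mu_seq_eq[abs_def]
    using partial_stein(1)[OF _ assms] by (intro Bochner_Integration.integrable_sum) auto
  have "dof n K \<mu>\<^sub>0 \<sigma> h = (\<Sum>i<n. \<sigma> * (h i * (mu_seq n K \<mu>\<^sub>0 \<sigma> h i - \<mu>\<^sub>0 i)))" for h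
    unfolding dof_def inner_n_def by (intro sum.cong) (simp_all add: scaleR_fun_def)
  then have "(\<integral>h. dof n K \<mu>\<^sub>0 \<sigma> h \<partial>std_gaussian n) = (\<Sum>i<n. \<sigma> * (\<integral>h. h i * (mu_seq n K \<mu>\<^sub>0 \<sigma> h i - \<mu>\<^sub>0 i) \<partial>std_gaussian n))"
    using integrable_coordinate_mu_seq by simp
  also have "\<dots> = (\<Sum>i<n. \<sigma>\<^sup>2 * (\<integral>h. partial i \<sigma> h \<partial>std_gaussian n))"
    using partial_stein(2)[OF _ assms] by (intro sum.cong) (simp_all add: power2_eq_square)
  also have "\<dots> = \<sigma>\<^sup>2 * (\<integral>h. div_mu_seq n K \<mu>\<^sub>0 \<sigma> h \<partial>std_gaussian n)"
    unfolding div_mu_seq_eq using partial_stein(1)[OF _ assms] by (simp add: sum_distrib_left)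
  finally show "(\<integral>h. dof n K \<mu>\<^sub>0 \<sigma> h \<partial>std_gaussian n) = \<sigma>\<^sup>2 * (\<integral>h. div_mu_seq n K \<mu>\<^sub>0 \<sigma> h \<partial>std_gaussian n)" .
qed

text \<open>The cone does not depend on the direction of the ray, so the facts proved along a ray
  are instantiated at direction 0.\<close>

lemma closed_convex_tangent_cone: "closed_convex n (tangent_cone n K \<mu>\<^sub>0)"
proof -
  interpret projection_path n K \<mu>\<^sub>0 "0" ..
  show ?thesis by (rule T.closed_convex_axioms)
qed

lemma integrable_norm_proj_tangent_cone:
  "integrable (std_gaussian n) (\<lambda>h. (norm_n n (proj n (tangent_cone n K \<mu>\<^sub>0) h))\<^sup>2)"
proof (rule Bochner_Integration.integrable_bound[OF integrable_norm_pow2])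
  show "(\<lambda>h. (norm_n n (proj n (tangent_cone n K \<mu>\<^sub>0) h))\<^sup>2) \<in> borel_measurable (std_gaussian n)"
    using closed_convex.measurable_norm_proj[OF closed_convex_tangent_cone] by simp
  show "AE h in std_gaussian n. norm ((norm_n n (proj n (tangent_cone n K \<mu>\<^sub>0) h))\<^sup>2) \<le> norm ((norm_n n h)\<^sup>2)"
    using projection_path.norm_proj_T_le[OF path] by (auto intro!: AE_I2 power_mono)
qed

lemma expectation_limit:
  assumes [measurable]: "\<And>\<sigma>. g \<sigma> \<in> borel_measurable borel"
    and bound: "\<And>\<sigma> h. \<sigma> > 0 \<Longrightarrow> \<bar>g \<sigma> h\<bar> \<le> (norm_n n h)\<^sup>2"
    and lim: "\<And>h. ((\<lambda>\<sigma>. g \<sigma> h) \<longlongrightarrow> (norm_n n (proj n (tangent_cone n K \<mu>\<^sub>0) h))\<^sup>2) (at_right 0)"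
  shows "((\<lambda>\<sigma>. \<integral>h. g \<sigma> h \<partial>std_gaussian n) \<longlongrightarrow> stat_dim n (tangent_cone n K \<mu>\<^sub>0)) (at_right (0::real))"
  unfolding tendsto_at_iff_sequentially stat_dim_def comp_def
proof (intro allI impI)
  fix X :: "nat \<Rightarrow> real" assume X: "\<forall>i. X i \<in> {0<..} - {0}" "X \<longlonglongrightarrow> 0"
  show "(\<lambda>j. \<integral>h. g (X j) h \<partial>std_gaussian n) \<longlonglongrightarrow> (\<integral>h. (norm_n n (proj n (tangent_cone n K \<mu>\<^sub>0) h))\<^sup>2 \<partial>std_gaussian n)"
  proof (rule integral_dominated_convergence[OF _ _ integrable_norm_pow2])
    show "(\<lambda>h. (norm_n n (proj n (tangent_cone n K \<mu>\<^sub>0) h))\<^sup>2) \<in> borel_measurable (std_gaussian n)"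
      using closed_convex.measurable_norm_proj[OF closed_convex_tangent_cone] by simp
    show "AE h in std_gaussian n. (\<lambda>j. g (X j) h) \<longlonglongrightarrow> (norm_n n (proj n (tangent_cone n K \<mu>\<^sub>0) h))\<^sup>2"
      using lim X unfolding tendsto_at_iff_sequentially comp_def by (intro AE_I2) blast
    show "AE h in std_gaussian n. norm (g (X j) h) \<le> (norm_n n h)\<^sup>2" for j
      using bound X by (intro AE_I2) simp
  qed simp
qed

lemma err_expectation_limit:
  "((\<lambda>\<sigma>. (\<integral>h. err n K \<mu>\<^sub>0 \<sigma> h \<partial>std_gaussian n) / \<sigma>\<^sup>2) \<longlongrightarrow> stat_dim n (tangent_cone n K \<mu>\<^sub>0)) (at_right 0)"
proof -
  have "((\<lambda>\<sigma>. \<integral>h. err n K \<mu>\<^sub>0 \<sigma> h / \<sigma>\<^sup>2 \<partial>std_gaussian n) \<longlongrightarrow> stat_dim n (tangent_cone n K \<mu>\<^sub>0)) (at_right 0)"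
    by (rule expectation_limit)
       (use err_bounds projection_path.err_limit[OF path] in \<open>auto simp: divide_le_eq mult.commute\<close>)
  then show ?thesis by simp
qed

text \<open>By Stein's formula the expected divergence is the expectation of
  \<open>dof / \<sigma>\<^sup>2\<close>, so pointwise convergence is asked of \<open>dof\<close>
  only.\<close>

lemma div_expectation_limit:
  "((\<lambda>\<sigma>. \<integral>h. div_mu_seq n K \<mu>\<^sub>0 \<sigma> h \<partial>std_gaussian n) \<longlongrightarrow> stat_dim n (tangent_cone n K \<mu>\<^sub>0)) (at_right 0)"
proof -
  have "((\<lambda>\<sigma>. \<integral>h. dof n K \<mu>\<^sub>0 \<sigma> h / \<sigma>\<^sup>2 \<partial>std_gaussian n) \<longlongrightarrow> stat_dim n (tangent_cone n K \<mu>\<^sub>0)) (at_right 0)"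
    by (rule expectation_limit)
       (use abs_dof_le projection_path.dof_limit[OF path] in \<open>auto simp: abs_divide divide_le_eq mult.commute\<close>)
  moreover have "\<forall>\<^sub>F \<sigma> in at_right 0. (\<integral>h. dof n K \<mu>\<^sub>0 \<sigma> h / \<sigma>\<^sup>2 \<partial>std_gaussian n) = (\<integral>h. div_mu_seq n K \<mu>\<^sub>0 \<sigma> h \<partial>std_gaussian n)"
    using stein(2) by (intro eventually_mono[OF eventually_at_right_less[of 0]]) simp
  ultimately show ?thesis by (simp cong: tendsto_cong)
qed

section \<open>Concentration of the degrees of freedom\<close>

text \<open>Splitting the increment of \<open>dof\<close> leaves the inner product of
  \<open>p - q\<close> with \<sigma> y, for which Cauchy-Schwarz would bring in the norm of y. The
  variational inequality bounds it instead by half the difference of the squared norms of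
  \<open>p\<close> and \<open>q\<close>, which depends only on \<open>d\<close> and
  \<open>r\<close>; the reverse increment is treated with the roles exchanged.\<close>

lemma local_lipschitz:
  assumes s: "\<sigma> > 0"
  shows "gaussian_local_lipschitz n (\<lambda>h. dof n K \<mu>\<^sub>0 \<sigma> h / \<sigma>\<^sup>2) (\<lambda>h. norm_n n (mu_seq n K \<mu>\<^sub>0 \<sigma> h - \<mu>\<^sub>0) / \<sigma>)"
proof
  fix x y
  define p q where "p = mu_seq n K \<mu>\<^sub>0 \<sigma> x - \<mu>\<^sub>0" and "q = mu_seq n K \<mu>\<^sub>0 \<sigma> y - \<mu>\<^sub>0"
  define r where "r = \<sigma> * norm_n n (x - y)"
  have sxy: "(\<mu>\<^sub>0 + \<sigma> *\<^sub>R x) - (\<mu>\<^sub>0 + \<sigma> *\<^sub>R y) = \<sigma> *\<^sub>R (x - y)" by (simp add: algebra_simps)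
  have pq: "norm_n n (p - q) \<le> r"
    using proj_nonexpansive[of "\<mu>\<^sub>0 + \<sigma> *\<^sub>R x" "\<mu>\<^sub>0 + \<sigma> *\<^sub>R y"] s
    unfolding sxy norm_n_scaleR by (simp add: p_def q_def mu_seq_def r_def)
  have np: "norm_n n p \<le> norm_n n q + r" and nq: "norm_n n q \<le> norm_n n p + r"
    using norm_n_triangle_sub[of n p q] norm_n_triangle_sub[of n q p] pq
    by (simp_all add: norm_n_minus_commute[of n q p])
  show "norm_n n p / \<sigma> \<le> norm_n n q / \<sigma> + norm_n n (x - y)"
    using np s by (simp add: r_def field_simps)
  define d where "d = norm_n n p"
  have r0: "r \<ge> 0" and d0: "d \<ge> 0" using s by (simp_all add: r_def d_def)
  have ip: "\<bar>inner_n n p (\<sigma> *\<^sub>R (x - y))\<bar> \<le> d * r" and iq: "\<bar>inner_n n q (\<sigma> *\<^sub>R (x - y))\<bar> \<le> norm_n n q * r"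
    using inner_n_le_norm[of n p "\<sigma> *\<^sub>R (x - y)"] inner_n_le_norm[of n q "\<sigma> *\<^sub>R (x - y)"] s
    by (simp_all add: norm_n_scaleR r_def d_def)
  have iq': "norm_n n q * r \<le> (d + r) * r" using nq r0 by (intro mult_right_mono) (auto simp: d_def)
  have pp: "inner_n n p p = d\<^sup>2" by (simp add: d_def norm_n_sq)
  have qq: "inner_n n q q = (norm_n n q)\<^sup>2" by (simp add: norm_n_sq)
  have q2: "(norm_n n q)\<^sup>2 \<le> (d + r)\<^sup>2" using nq by (intro power_mono) (auto simp: d_def)
  have p2: "d\<^sup>2 \<le> (norm_n n q)\<^sup>2 + 2 * d * r"
  proof -
    have "(norm_n n q + d) * (d - norm_n n q) \<le> 2 * d * r"
    proof (cases "d \<le> norm_n n q")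
      case True
      then have "(norm_n n q + d) * (d - norm_n n q) \<le> 0" using d0 by (intro mult_nonneg_nonpos) auto
      then show ?thesis using d0 r0 by (simp add: order.trans)
    next
      case False
      then show ?thesis using np d0 by (intro mult_mono) (auto simp: d_def)
    qed
    then show ?thesis by (simp add: power2_eq_square algebra_simps)
  qed
  have vq: "inner_n n p (\<sigma> *\<^sub>R y) - inner_n n q (\<sigma> *\<^sub>R y) \<le> inner_n n p q - inner_n n q q"
    using proj_variational[OF proj_in_K, of "\<mu>\<^sub>0 + \<sigma> *\<^sub>R x" "\<mu>\<^sub>0 + \<sigma> *\<^sub>R y"]
    by (simp add: p_def q_def mu_seq_def inner_n_simps inner_n_commute algebra_simps)
  have vp: "inner_n n q (\<sigma> *\<^sub>R x) - inner_n n p (\<sigma> *\<^sub>R x) \<le> inner_n n p q - inner_n n p p"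
    using proj_variational[OF proj_in_K, of "\<mu>\<^sub>0 + \<sigma> *\<^sub>R y" "\<mu>\<^sub>0 + \<sigma> *\<^sub>R x"]
    by (simp add: p_def q_def mu_seq_def inner_n_simps inner_n_commute algebra_simps)
  have pq2: "2 * inner_n n p q \<le> inner_n n p p + inner_n n q q"
    using inner_n_ge_0[of n "p - q"] by (simp add: inner_n_simps inner_n_commute)
  have split: "inner_n n z (\<sigma> *\<^sub>R x) = inner_n n z (\<sigma> *\<^sub>R y) + inner_n n z (\<sigma> *\<^sub>R (x - y))" for z
    by (simp add: inner_n_simps algebra_simps)
  have sq: "(d + r)\<^sup>2 = d\<^sup>2 + 2 * d * r + r\<^sup>2" "(d + r) * r = d * r + r\<^sup>2"
    by (simp_all add: power2_eq_square algebra_simps)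
  have r2: "0 \<le> r\<^sup>2" "0 \<le> d * r" using r0 d0 by auto
  have dofs: "dof n K \<mu>\<^sub>0 \<sigma> x = inner_n n p (\<sigma> *\<^sub>R x)" "dof n K \<mu>\<^sub>0 \<sigma> y = inner_n n q (\<sigma> *\<^sub>R y)"
    by (simp_all add: dof_def p_def q_def)
  have "\<bar>dof n K \<mu>\<^sub>0 \<sigma> x - dof n K \<mu>\<^sub>0 \<sigma> y\<bar> \<le> 2 * d * r + 2 * r\<^sup>2"
    using vq vp pq2 ip iq iq' pp qq q2 p2 split[of p] split[of q] r2
    unfolding dofs sq abs_le_iff by linarith
  then have "\<bar>dof n K \<mu>\<^sub>0 \<sigma> x - dof n K \<mu>\<^sub>0 \<sigma> y\<bar> / \<sigma>\<^sup>2 \<le> (2 * d * r + 2 * r\<^sup>2) / \<sigma>\<^sup>2"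
    by (rule divide_right_mono) simp
  also have "(2 * d * r + 2 * r\<^sup>2) / \<sigma>\<^sup>2 = 2 * (d / \<sigma>) * norm_n n (x - y) + 2 * (norm_n n (x - y))\<^sup>2"
    using s by (simp add: r_def power2_eq_square add_divide_distrib)
  finally show "\<bar>dof n K \<mu>\<^sub>0 \<sigma> x / \<sigma>\<^sup>2 - dof n K \<mu>\<^sub>0 \<sigma> y / \<sigma>\<^sup>2\<bar>
    \<le> 2 * (norm_n n p / \<sigma>) * norm_n n (x - y) + 2 * (norm_n n (x - y))\<^sup>2"
    by (simp add: d_def abs_divide flip: diff_divide_distrib)
  show "\<bar>dof n K \<mu>\<^sub>0 \<sigma> x / \<sigma>\<^sup>2\<bar> \<le> (norm_n n x)\<^sup>2"
    using abs_dof_le[of \<sigma> x] s by (simp add: abs_divide divide_le_eq mult.commute)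
  show "norm_n n p / \<sigma> \<le> norm_n n x"
    using norm_mu_seq_le[of \<sigma> x] s by (simp add: p_def divide_le_eq mult.commute)
  show "0 \<le> norm_n n p / \<sigma>" using s by simp
qed simp_all

lemma concentration:
  assumes s: "\<sigma> > 0"
  shows "integrable (std_gaussian n) (\<lambda>h. (dof n K \<mu>\<^sub>0 \<sigma> h)\<^sup>2)" (is ?int)
    and "prob_space.variance (std_gaussian n) (dof n K \<mu>\<^sub>0 \<sigma>)
      \<le> 4 * \<sigma>\<^sup>2 * prob_space.expectation (std_gaussian n) (err n K \<mu>\<^sub>0 \<sigma>)" (is ?var)
    and "0 \<le> t \<Longrightarrow> prob_space.prob (std_gaussian n)
       {h \<in> space (std_gaussian n). inverse 20 * \<bar>dof n K \<mu>\<^sub>0 \<sigma> h - prob_space.expectation (std_gaussian n) (dof n K \<mu>\<^sub>0 \<sigma>)\<bar>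
          \<ge> sqrt (\<sigma>\<^sup>2 * prob_space.expectation (std_gaussian n) (err n K \<mu>\<^sub>0 \<sigma>) * t) + \<sigma>\<^sup>2 * t}
       \<le> 20 * exp (- t / 20)" (is "_ \<Longrightarrow> ?tail")
proof -
  interpret gaussian_local_lipschitz n "\<lambda>h. dof n K \<mu>\<^sub>0 \<sigma> h / \<sigma>\<^sup>2" "\<lambda>h. norm_n n (mu_seq n K \<mu>\<^sub>0 \<sigma> h - \<mu>\<^sub>0) / \<sigma>"
    by (rule local_lipschitz[OF s])
  have s2: "\<sigma>\<^sup>2 > 0" using s by simp
  have V: "expectation (err n K \<mu>\<^sub>0 \<sigma>) = \<sigma>\<^sup>2 * V"
    unfolding V_def using s by (simp add: power_divide flip: err_def)
  have fb: "dof n K \<mu>\<^sub>0 \<sigma> h - expectation (dof n K \<mu>\<^sub>0 \<sigma>) = \<sigma>\<^sup>2 * fbar h" for h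
    unfolding fbar_def using s2 by (simp add: right_diff_distrib)
  have "integrable (std_gaussian n) (\<lambda>h. \<sigma> ^ 4 * (dof n K \<mu>\<^sub>0 \<sigma> h / \<sigma>\<^sup>2)\<^sup>2)"
    using integrable_f2 by (rule integrable_mult_right)
  moreover have "\<sigma> ^ 4 * (dof n K \<mu>\<^sub>0 \<sigma> h / \<sigma>\<^sup>2)\<^sup>2 = (dof n K \<mu>\<^sub>0 \<sigma> h)\<^sup>2" for h
    using s by (simp add: power_divide)
  ultimately show ?int by simp
  have "variance (dof n K \<mu>\<^sub>0 \<sigma>) = \<sigma>\<^sup>2 * \<sigma>\<^sup>2 * expectation (\<lambda>h. (fbar h)\<^sup>2)"
    unfolding fb power_mult_distrib by (simp add: power2_eq_square)
  also have "\<dots> \<le> \<sigma>\<^sup>2 * \<sigma>\<^sup>2 * (4 * V)" by (intro mult_left_mono variance_bound) simp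
  finally show ?var unfolding V by (simp add: ac_simps)
  assume t: "0 \<le> t"
  show ?tail
  \<comment> \<open>The tail lemma takes t > 0; at 0 the right-hand side is 20 and exceeds any
    probability.\<close>
  proof (cases "t = 0")
    case True
    have "prob A \<le> 20" for A by (rule order.trans[OF prob_le_1]) simp
    then show ?thesis using True by simp
  next
    case False
    have "\<sigma>\<^sup>2 * (\<sigma>\<^sup>2 * V) * t = (\<sigma>\<^sup>2)\<^sup>2 * (V * t)"
      by (simp add: power2_eq_square)
    then have "sqrt (\<sigma>\<^sup>2 * (\<sigma>\<^sup>2 * V) * t) = \<sigma>\<^sup>2 * sqrt (V * t)"
      by (simp only: real_sqrt_mult[of "(\<sigma>\<^sup>2)\<^sup>2"] real_sqrt_abs abs_power2)
    then have eq: "inverse 20 * \<bar>dof n K \<mu>\<^sub>0 \<sigma> h - expectation (dof n K \<mu>\<^sub>0 \<sigma>)\<bar> \<ge> sqrt (\<sigma>\<^sup>2 * (\<sigma>\<^sup>2 * V) * t) + \<sigma>\<^sup>2 * t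
      \<longleftrightarrow> 20 * (sqrt (V * t) + t) \<le> \<bar>fbar h\<bar>" for h
      unfolding fb using s2 mult_le_cancel_left_pos[OF s2, of "20 * (sqrt (V * t) + t)" "\<bar>fbar h\<bar>"]
      by (simp add: abs_mult algebra_simps)
    have "prob {h. 20 * (sqrt (V * t) + t) \<le> \<bar>fbar h\<bar>} \<le> 4 * exp (- t)"
      using two_sided_tail[of t] t False unfolding fbar_def by simp
    \<comment> \<open>A single constant serves as scale, prefactor and rate; the scale fixes it at
      20, and the other two are weakened to match.\<close>
    also have "\<dots> \<le> 20 * exp (- t / 20)" using t by (intro mult_mono) auto
    finally show ?thesis unfolding V eq by simp
  qed
qed

end

theorem proposition4p8:
  shows "\<exists>L::real. L > 0 \<and>
    (\<forall>(n::nat) (K :: (nat \<Rightarrow> real) set) (\<mu>\<^sub>0 :: nat \<Rightarrow> real).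
      closedin (Euclidean_space n) K \<and> convex K \<and> \<mu>\<^sub>0 \<in> K \<longrightarrow>
      \<comment> \<open>(1)\<close>
      (\<forall>\<sigma>>0. integrable (std_gaussian n) (dof n K \<mu>\<^sub>0 \<sigma>) \<and>
          integrable (std_gaussian n) (div_mu_seq n K \<mu>\<^sub>0 \<sigma>) \<and>
          prob_space.expectation (std_gaussian n) (dof n K \<mu>\<^sub>0 \<sigma>)
            = \<sigma>\<^sup>2 * prob_space.expectation (std_gaussian n) (div_mu_seq n K \<mu>\<^sub>0 \<sigma>)) \<and>
      \<comment> \<open>(2)\<close>
      (\<forall>h \<in> topspace (Euclidean_space n).
          antimono_on {0<..} (\<lambda>\<sigma>. dof n K \<mu>\<^sub>0 \<sigma> h / \<sigma>\<^sup>2) \<and>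
          (\<forall>\<sigma>\<ge>0. \<forall>M\<ge>1. dof n K \<mu>\<^sub>0 \<sigma> h \<le> dof n K \<mu>\<^sub>0 (M * \<sigma>) h \<and>
             dof n K \<mu>\<^sub>0 (M * \<sigma>) h \<le> M\<^sup>2 * dof n K \<mu>\<^sub>0 \<sigma> h)) \<and>
      \<comment> \<open>(3)\<close>
      (\<forall>h \<in> topspace (Euclidean_space n). \<forall>\<sigma>>0.
          err n K \<mu>\<^sub>0 \<sigma> h \<le> dof n K \<mu>\<^sub>0 \<sigma> h \<and>
          (\<lambda>\<tau>. err n K \<mu>\<^sub>0 \<tau> h / \<tau>\<^sup>2) integrable_on {0..\<sigma>} \<and>
          dof n K \<mu>\<^sub>0 \<sigma> h \<le> \<sigma> * integral {0..\<sigma>} (\<lambda>\<tau>. err n K \<mu>\<^sub>0 \<tau> h / \<tau>\<^sup>2)) \<and>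
      (\<forall>\<sigma>>0. integrable (std_gaussian n) (err n K \<mu>\<^sub>0 \<sigma>)) \<and>
      integrable (std_gaussian n) (\<lambda>h. (norm_n n (proj n (tangent_cone n K \<mu>\<^sub>0) h))\<^sup>2) \<and>
      ((\<lambda>\<sigma>. prob_space.expectation (std_gaussian n) (div_mu_seq n K \<mu>\<^sub>0 \<sigma>))
         \<longlongrightarrow> stat_dim n (tangent_cone n K \<mu>\<^sub>0)) (at_right 0) \<and>
      ((\<lambda>\<sigma>. prob_space.expectation (std_gaussian n) (err n K \<mu>\<^sub>0 \<sigma>) / \<sigma>\<^sup>2)
         \<longlongrightarrow> stat_dim n (tangent_cone n K \<mu>\<^sub>0)) (at_right 0) \<and>
      \<comment> \<open>(4)\<close>
      (\<forall>\<sigma>>0.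
          integrable (std_gaussian n) (\<lambda>h. (dof n K \<mu>\<^sub>0 \<sigma> h)\<^sup>2) \<and>
          prob_space.variance (std_gaussian n) (dof n K \<mu>\<^sub>0 \<sigma>)
            \<le> 4 * \<sigma>\<^sup>2 * prob_space.expectation (std_gaussian n) (err n K \<mu>\<^sub>0 \<sigma>) \<and>
          (\<forall>t\<ge>0.
             prob_space.prob (std_gaussian n)
               {h \<in> space (std_gaussian n).
                  inverse L * \<bar>dof n K \<mu>\<^sub>0 \<sigma> h
                      - prob_space.expectation (std_gaussian n) (dof n K \<mu>\<^sub>0 \<sigma>)\<bar>
                    \<ge> sqrt (\<sigma>\<^sup>2 * prob_space.expectation (std_gaussian n) (err n K \<mu>\<^sub>0 \<sigma>) * t)
                       + \<sigma>\<^sup>2 * t}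
             \<le> L * exp (- t / L))))"
proof (rule exI[of _ "20::real"], rule conjI, simp, intro allI impI, goal_cases)
  case (1 n K \<mu>\<^sub>0)
  then interpret sequence_model n K \<mu>\<^sub>0 by unfold_locales auto
  show ?case
  proof (intro conjI allI impI ballI, goal_cases)
    case 1 show ?case by (rule integrable_dof)
  next
    case 2 then show ?case by (rule stein)
  next
    case 3 then show ?case by (rule stein)
  next
    case 4 show ?case by (rule projection_path.dof_div_antimono[OF path])
  next
    case 5 then show ?case by (intro projection_path.dof_scaling[OF path])
  next
    case 6 then show ?case by (intro projection_path.dof_scaling[OF path])
  next
    case 7 show ?case by (rule projection_path.err_le_dof[OF path])
  next
    case 8 then show ?case by (intro projection_path.dof_le_integral[OF path])
  next
    case 9 then show ?case by (intro projection_path.dof_le_integral[OF path])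
  next
    case 10 show ?case by (rule integrable_err)
  next
    case 11 show ?case by (rule integrable_norm_proj_tangent_cone)
  next
    case 12 show ?case by (rule div_expectation_limit)
  next
    case 13 show ?case by (rule err_expectation_limit)
  next
    case 14 then show ?case by (rule concentration)
  next
    case 15 then show ?case by (rule concentration)
  next
    case 16 then show ?case by (intro concentration(3))
  qed
qed

end
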